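(* Let $r\ge 1$ and let $G$ be an $r$-outerplanar triangulated disk with $n$ vertices (with its fixed plane embedding and layers $L_1,\dots,L_r$). Then $G$ contains a well-formed separator sequence of length at least $\left\lfloor \sqrt[2r]{\log n}\,/\,6^{r}\right\rfloor$ and width at most $2r$ (here $\log$ is the logarithm to base 2).
   Context: A plane graph $G=(V,E)$ is a planar graph with a fixed embedding. Its layer decomposition is the partition $V=L_1\uplus\dots\uplus L_r$ where $L_1$ is the set of vertices on the outer face of $G$ and $L_i$ is the set of vertices on the outer face of $G-\bigcup_{j<i}L_j$. $G$ is $r$-outerplanar if it has an embedding whose layer decomposition has at most $r$ layers. A plane graph is a triangulated disk if its outer face is bounded by a simple cycle and all its inner faces are triangles. For an $r$-outerplanar triangulated disk one fixes an embedding with at most $r$ layers. Well-formed separator sequence: Let $G=(V,E)$ be a graph with a fixed plane embedding with layers $L_1,\dots,L_r$. A well-formed separator sequence of length $t$ and width $p$ is a sequence $(A_1,S_1,B_1),\dots,(A_t,S_t,B_t)$ of triples of vertex sets such that: (i) $V=A_i\cup B_i$ for each $i$; (ii) there is no edge between $A_i\setminus B_i$ and $B_i\setminus A_i$; (iii) $S_i=A_i\cap B_i$ and $|S_i|=p$; (iv) $A_i\subsetneq A_{i+1}$ and $B_i\supsetneq B_{i+1}$ for $i<t$; (v) one of the following holds: (a) for all $i$, $S_i$ induces a path $(v_{i,1},\dots,v_{i,p'})$ with $v_{i,1},v_{i,p'}\in L_1$ and $p'=p$; or (b) $L_1\subseteq A_1$ and for all $i$, $S_i$ induces a cycle $(v^*,v_{i,1},\dots,v_{i,p'},v^\dagger)$,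 where the vertices $v^*$ and $v^\dagger$ (possibly $v^*=v^\dagger$) lie on the layer of minimum index that intersects $S_i$, and $p'\in\{p-1,p-2\}$; (vi) for all $1\le i,j\le t$ and $1\le k,\ell\le p'$, if $v_{i,k}=v_{j,\ell}$ then $k=\ell$; (vii) each $S_i$ contains at most two vertices from each layer; (viii) for all $i,j$ and $1\le k\le p'$, $v_{i,k}$ and $v_{j,k}$ lie on the same layer. *)

theory Defs
  imports "HOL-Analysis.Analysis"
begin

text \<open>
  A finite simple graph, whose edges are two-element sets of vertices, together with a drawing in
  the plane: every vertex is placed at a point and every edge is drawn as a curve.
\<close>

record 'a drawn_graph =
  vertices :: "'a set"
  edges :: "'a set set"
  point :: "'a \<Rightarrow> complex"
  curve :: "'a set \<Rightarrow> real \<Rightarrow> complex"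

definition simple_graph :: "'a drawn_graph \<Rightarrow> bool" where
  "simple_graph G \<longleftrightarrow>
     finite (vertices G) \<and>
     (\<forall>e\<in>edges G. \<exists>u\<in>vertices G. \<exists>v\<in>vertices G. u \<noteq> v \<and> e = {u, v})"

definition plane_graph :: "'a drawn_graph \<Rightarrow> bool" where
  "plane_graph G \<longleftrightarrow>
     simple_graph G \<and>
     inj_on (point G) (vertices G) \<and>
     (\<forall>e\<in>edges G. arc (curve G e) \<and>
        {pathstart (curve G e), pathfinish (curve G e)} = point G ` e) \<and>
     (\<forall>e\<in>edges G. \<forall>v\<in>vertices G. point G v \<in> path_image (curve G e) \<longrightarrow> v \<in> e) \<and>
     (\<forall>e\<in>edges G. \<forall>f\<in>edges G. e \<noteq> f \<longrightarrow>
        path_image (curve G e) \<inter> path_image (curve G f) = point G ` (e \<inter> f))"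

definition drawing :: "'a drawn_graph \<Rightarrow> 'a set \<Rightarrow> 'a set set \<Rightarrow> complex set" where
  "drawing G W F = point G ` W \<union> (\<Union>e\<in>F. path_image (curve G e))"

definition induced_drawing :: "'a drawn_graph \<Rightarrow> 'a set \<Rightarrow> complex set" where
  "induced_drawing G W = drawing G W {e \<in> edges G. e \<subseteq> W}"

text \<open>
  The faces of the subgraph induced by \<open>W\<close> are the components of the complement of its drawing.
  As the drawing is compact, exactly one of them is unbounded; it is given by \<^const>\<open>outside\<close>.
\<close>

definition faces :: "'a drawn_graph \<Rightarrow> 'a set \<Rightarrow> complex set set" where
  "faces G W = components (- induced_drawing G W)"

definition outer_face :: "'a drawn_graph \<Rightarrow> 'a set \<Rightarrow> complex set" where
  "outer_face G W = outside (induced_drawing G W)"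

definition outer_vertices :: "'a drawn_graph \<Rightarrow> 'a set \<Rightarrow> 'a set" where
  "outer_vertices G W = {v \<in> W. point G v \<in> frontier (outer_face G W)}"

text \<open>
  \<open>peel G i\<close> is the vertex set that remains after the first \<open>i\<close> layers have been removed.
  Layers are numbered from \<open>1\<close>; there is no layer \<open>0\<close>, and all layers from some index on are empty.
\<close>

primrec peel :: "'a drawn_graph \<Rightarrow> nat \<Rightarrow> 'a set" where
  "peel G 0 = vertices G"
| "peel G (Suc i) = peel G i - outer_vertices G (peel G i)"

definition layer :: "'a drawn_graph \<Rightarrow> nat \<Rightarrow> 'a set" where
  "layer G i = (if i = 0 then {} else outer_vertices G (peel G (i - 1)))"

definition at_most_layers :: "'a drawn_graph \<Rightarrow> nat \<Rightarrow> bool" where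
  "at_most_layers G r \<longleftrightarrow> vertices G = (\<Union>i\<in>{1..r}. layer G i)"

definition cycle_edges :: "'a list \<Rightarrow> 'a set set" where
  "cycle_edges xs = {{xs ! i, xs ! (Suc i mod length xs)} | i. i < length xs}"

definition is_cycle :: "'a drawn_graph \<Rightarrow> 'a list \<Rightarrow> bool" where
  "is_cycle G xs \<longleftrightarrow>
     length xs \<ge> 3 \<and> distinct xs \<and> set xs \<subseteq> vertices G \<and> cycle_edges xs \<subseteq> edges G"

definition bounded_by_cycle :: "'a drawn_graph \<Rightarrow> complex set \<Rightarrow> 'a list \<Rightarrow> bool" where
  "bounded_by_cycle G X xs \<longleftrightarrow>
     is_cycle G xs \<and> frontier X = drawing G (set xs) (cycle_edges xs)"

definition triangulated_disk :: "'a drawn_graph \<Rightarrow> bool" where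
  "triangulated_disk G \<longleftrightarrow>
     plane_graph G \<and>
     (\<exists>xs. bounded_by_cycle G (outer_face G (vertices G)) xs) \<and>
     (\<forall>X\<in>faces G (vertices G). X \<noteq> outer_face G (vertices G) \<longrightarrow>
        (\<exists>xs. length xs = 3 \<and> bounded_by_cycle G X xs))"

definition induces_path :: "'a drawn_graph \<Rightarrow> 'a set \<Rightarrow> 'a list \<Rightarrow> bool" where
  "induces_path G W xs \<longleftrightarrow>
     xs \<noteq> [] \<and> distinct xs \<and> set xs = W \<and>
     {e \<in> edges G. e \<subseteq> W} = {{xs ! i, xs ! Suc i} | i. Suc i < length xs}"

definition induces_cycle :: "'a drawn_graph \<Rightarrow> 'a set \<Rightarrow> 'a list \<Rightarrow> bool" where
  "induces_cycle G W xs \<longleftrightarrow>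
     length xs \<ge> 3 \<and> distinct xs \<and> set xs = W \<and>
     {e \<in> edges G. e \<subseteq> W} = cycle_edges xs"

text \<open>
  The triples are \<open>(A i, S i, B i)\<close> for \<open>1 \<le> i \<le> t\<close>. The vertices \<open>c\<close> and \<open>d\<close> are
  $v^*$ and $v^\dagger$; they do not depend on \<open>i\<close>, and if they coincide, the vertex is listed
  only once on the cycle. The number \<open>q\<close> is $p'$.
\<close>

definition well_formed_separator_sequence ::
  "'a drawn_graph \<Rightarrow> nat \<Rightarrow> nat \<Rightarrow>
   (nat \<Rightarrow> 'a set) \<Rightarrow> (nat \<Rightarrow> 'a set) \<Rightarrow> (nat \<Rightarrow> 'a set) \<Rightarrow> bool" where
  "well_formed_separator_sequence G t p A S B \<longleftrightarrow>
     (\<forall>i\<in>{1..t}. vertices G = A i \<union> B i) \<and>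
     (\<forall>i\<in>{1..t}. \<forall>a\<in>A i - B i. \<forall>b\<in>B i - A i. {a, b} \<notin> edges G) \<and>
     (\<forall>i\<in>{1..t}. S i = A i \<inter> B i \<and> card (S i) = p) \<and>
     (\<forall>i\<in>{1..<t}. A i \<subset> A (i + 1) \<and> B (i + 1) \<subset> B i) \<and>
     (\<exists>(q::nat) (v :: nat \<Rightarrow> nat \<Rightarrow> 'a).
        ((q = p \<and>
          (\<forall>i\<in>{1..t}. induces_path G (S i) (map (v i) [1..<q + 1]) \<and>
             v i 1 \<in> layer G 1 \<and> v i q \<in> layer G 1))
         \<or>
         (layer G 1 \<subseteq> A 1 \<and> (p = q + 1 \<or> p = q + 2) \<and>
          (\<exists>c d. \<forall>i\<in>{1..t}.
             induces_cycle G (S i)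
               (c # map (v i) [1..<q + 1] @ (if c = d then [] else [d])) \<and>
             c \<in> layer G (LEAST m. layer G m \<inter> S i \<noteq> {}) \<and>
             d \<in> layer G (LEAST m. layer G m \<inter> S i \<noteq> {})))) \<and>
        (\<forall>i\<in>{1..t}. \<forall>j\<in>{1..t}. \<forall>k\<in>{1..q}. \<forall>l\<in>{1..q}. v i k = v j l \<longrightarrow> k = l) \<and>
        (\<forall>i\<in>{1..t}. \<forall>j\<in>{1..t}. \<forall>k\<in>{1..q}. \<exists>m. v i k \<in> layer G m \<and> v j k \<in> layer G m)) \<and>
     (\<forall>i\<in>{1..t}. \<forall>m. card (S i \<inter> layer G m) \<le> 2)"

end

theory Submission
  imports Defs
begin

text \<open>
  In a triangulated disk the layer of a vertex is one more than its distance from the outer cycle,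
  so every vertex has a tree path (its leg) that meets each layer above it exactly once. For a
  non-tree edge \<open>uv\<close> the legs of \<open>u\<close> and \<open>v\<close> together with \<open>uv\<close> form either a path between outer
  vertices or, if the legs join, a cycle below the join; by the Jordan curve theorem it splits the set
  of triangles into two regions. If \<open>uvw\<close> is the triangle at \<open>uv\<close> inside a region, the rest of the
  region is the disjoint union of the regions of \<open>uw\<close> and \<open>wv\<close>. Passing to the larger one again and
  again gives a chain of about \<open>log n\<close> nested regions.

  Along the chain the layer of the join is monotone, hence constant on a long interval. The separators
  need not be induced: there may be chords between the two legs. A chord of one member of the interval
  that is itself the edge of another member has a smaller sum of layers, and every other chord is
  shared by all members to the right, or all members to the left: otherwise it would hang off the chain
  and force two legs to join further down. So one looks for a subinterval in which the minimal sum of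
  layers is attained often. The members attaining it either have no chord, or many of them have the
  same lowest chord, which closes them to induced cycles.
\<close>

section \<open>Walks and arcs\<close>

text \<open>Topology serves only to verify the hypotheses of the locale \<open>leveled_disk\<close>;
  from there on the argument deals with finite sets of triangles and their boundaries modulo 2. This
  calculus is strong because the forest carries no boundary: up to complement, a set of triangles is
  determined by the non-tree edges on its boundary, so a region is identified by naming one or two
  edges. The labelling of the separators comes from levels: once the levels of the two ends are
  fixed, a position on the separator determines a leg and a level. Inducedness is what costs length.
  The members that attain the minimum are divided into at most \<open>4 * r\<^sup>2\<close> classes,
  so the minimum has to be attained \<open>s = 4 * r\<^sup>2 * t\<close> times. The sum of levels
  has \<open>2 * r - 1\<close> possible values, and each costs a factor \<open>s\<close> in the
  length of the interval; the join level has \<open>r\<close> possible values. This gives a chain of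
  length \<open>N = r * s ^ (2 * r - 1)\<close>, for which about \<open>2 ^ N\<close> triangles are
  needed: hence the logarithm and the root of order \<open>2 * r\<close>.\<close>

lemma interior_arc_image:
  fixes g :: "real \<Rightarrow> complex"
  assumes "arc g"
  shows "interior (path_image g) = {}"
proof (rule ccontr)
  assume "interior (path_image g) \<noteq> {}"
  then obtain x e where e: "e > 0" "ball x e \<subseteq> path_image g"
    by (metis ex_in_conv mem_interior)
  obtain h where h: "homeomorphism {0..1} (path_image g) g h"
    using homeomorphism_arc[OF assms] .
  define y where "y = x + of_real (e/2)"
  have y: "y \<in> ball x e" "y \<noteq> x" using e by (auto simp: y_def dist_norm)
  have xi: "x \<in> ball x e" using e by simp
  have conth: "continuous_on (ball x e) h"
    using h e continuous_on_subset unfolding homeomorphism_def by blast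
  have inj: "inj_on h (ball x e)"
    using h e unfolding homeomorphism_def by (metis inj_on_def subsetD)
  have hne: "h x \<noteq> h y" using inj_on_eq_iff[OF inj xi y(1)] y(2) by simp
  obtain a b where ab: "a \<in> ball x e" "b \<in> ball x e" "h a < h b"
    using hne xi y(1) by (meson linorder_neqE)
  define s where "s = (h a + h b) / 2"
  have sb: "s \<in> {h a..h b}" "s \<noteq> h a" "s \<noteq> h b" using ab(3) by (simp_all add: s_def)
  have "connected (h ` ball x e)" by (intro connected_continuous_image conth) simp
  then have "{h a..h b} \<subseteq> h ` ball x e"
    using connected_contains_Icc ab(1,2) by blast
  then obtain p where p: "p \<in> ball x e" "h p = s" using sb(1) by blast
  \<comment> \<open>A disc stays connected when one point is deleted, an interval does not when an
    inner value is deleted; \<open>h\<close> would map the one into the other.\<close>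
  have "connected (ball x e - {p})"
    by (rule connected_open_delete) auto
  then have c: "connected (h ` (ball x e - {p}))"
    by (intro connected_continuous_image continuous_on_subset[OF conth]) auto
  have "a \<in> ball x e - {p}" "b \<in> ball x e - {p}"
    using ab p sb by blast+
  then have "{h a..h b} \<subseteq> h ` (ball x e - {p})"
    using connected_contains_Icc[OF c] by blast
  then have "s \<in> h ` (ball x e - {p})" using sb(1) by blast
  then show False using p inj_onD[OF inj] by blast
qed

section \<open>Edges of walks and cycles given as vertex lists\<close>

fun walk_edges :: "'a list \<Rightarrow> 'a set set" where
  "walk_edges (x # y # zs) = insert {x, y} (walk_edges (y # zs))"
| "walk_edges _ = {}"

lemma walk_edges_nth: "walk_edges xs = {{xs ! i, xs ! Suc i} | i. Suc i < length xs}"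
proof (induction xs rule: walk_edges.induct)
  case (1 x y zs)
  have "{{(x # y # zs) ! i, (x # y # zs) ! Suc i} | i. Suc i < length (x # y # zs)}
      = insert {x, y} {{(y # zs) ! i, (y # zs) ! Suc i} | i. Suc i < length (y # zs)}" (is "?L = ?R")
  proof
    show "?L \<subseteq> ?R"
    proof
      fix f assume "f \<in> ?L"
      then obtain i where i: "f = {(x # y # zs) ! i, (x # y # zs) ! Suc i}" "Suc i < length (x # y # zs)"
        by auto
      show "f \<in> ?R" using i by (cases i) auto
    qed
    show "?R \<subseteq> ?L"
    proof
      fix f assume f: "f \<in> ?R"
      show "f \<in> ?L"
      proof (cases "f = {x, y}")
        case True then show ?thesis by (auto intro!: exI[of _ 0])
      next
        case False
        then obtain i where "f = {(y # zs) ! i, (y # zs) ! Suc i}" "Suc i < length (y # zs)"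
          using f by auto
        then show ?thesis by (auto intro!: exI[of _ "Suc i"])
      qed
    qed
  qed
  then show ?case using 1 by simp
qed auto

lemma cycle_edges_walk_edges:
  assumes "xs \<noteq> []"
  shows "cycle_edges xs = insert {last xs, hd xs} (walk_edges xs)"
proof
  show "cycle_edges xs \<subseteq> insert {last xs, hd xs} (walk_edges xs)"
  proof
    fix f assume "f \<in> cycle_edges xs"
    then obtain i where i: "i < length xs" "f = {xs ! i, xs ! (Suc i mod length xs)}"
      by (auto simp: cycle_edges_def)
    show "f \<in> insert {last xs, hd xs} (walk_edges xs)"
    proof (cases "Suc i = length xs")
      case True
      then have "i = length xs - 1" by simp
      then show ?thesis using i True assms by (simp add: last_conv_nth hd_conv_nth)
    next
      case False
      then show ?thesis using i by (auto simp: walk_edges_nth)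
    qed
  qed
  show "insert {last xs, hd xs} (walk_edges xs) \<subseteq> cycle_edges xs"
  proof
    fix f assume "f \<in> insert {last xs, hd xs} (walk_edges xs)"
    then show "f \<in> cycle_edges xs"
    proof
      assume "f = {last xs, hd xs}"
      then show ?thesis using assms unfolding cycle_edges_def
        by (auto intro!: exI[of _ "length xs - 1"] simp: last_conv_nth hd_conv_nth)
    next
      assume "f \<in> walk_edges xs"
      then obtain i where "Suc i < length xs" "f = {xs ! i, xs ! Suc i}" by (auto simp: walk_edges_nth)
      then show ?thesis unfolding cycle_edges_def by (auto intro!: exI[of _ i])
    qed
  qed
qed

lemma walk_edges_subset: "f \<in> walk_edges xs \<Longrightarrow> f \<subseteq> set xs"
  by (induction xs rule: walk_edges.induct) auto

lemma cycle_edges_subset: "f \<in> cycle_edges xs \<Longrightarrow> f \<subseteq> set xs"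
  by (cases "xs = []") (auto simp: cycle_edges_walk_edges dest: walk_edges_subset, auto simp: cycle_edges_def)

text \<open>On two vertices the closing edge would be the edge of the walk itself. Excluding this is
  what makes the curve of a cycle simple.\<close>

lemma closing_edge_notin_walk_edges:
  assumes "distinct xs" "length xs \<ge> 3"
  shows "{last xs, hd xs} \<notin> walk_edges xs"
proof
  assume "{last xs, hd xs} \<in> walk_edges xs"
  then obtain i where i: "Suc i < length xs" "{last xs, hd xs} = {xs ! i, xs ! Suc i}"
    by (auto simp: walk_edges_nth)
  have ne: "xs \<noteq> []" using assms by auto
  have "{xs ! (length xs - 1), xs ! 0} = {xs ! i, xs ! Suc i}"
    using i(2) ne by (simp add: last_conv_nth hd_conv_nth)
  moreover have "length xs - 1 < length xs" "0 < length xs" using ne by auto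
  ultimately show False using i(1) assms nth_eq_iff_index_eq[OF assms(1)]
    by (auto simp: doubleton_eq_iff)
qed

text \<open>A connected set that meets both \<open>X\<close> and its complement meets the frontier
  of \<open>X\<close>.\<close>

lemma components_eqI_frontier:
  fixes X :: "'a :: topological_space set"
  assumes "open X" "X \<noteq> {}" "connected K" "X \<subseteq> K" "frontier X \<inter> K = {}"
  shows "X = K"
proof (rule ccontr)
  assume "X \<noteq> K"
  then have "K - X \<noteq> {}" using assms by auto
  then have "K \<inter> frontier X \<noteq> {}"
    using connected_Int_frontier[of K X] assms by auto
  then show False using assms by auto
qed

lemma subset_outsideI:
  assumes "connected K" "K \<inter> S = {}" "x \<in> K" "x \<in> outside S"
  shows "K \<subseteq> outside S"
proof
  fix y assume "y \<in> K"
  then have "connected_component (- S) x y"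
    using assms by (auto simp: connected_component_def intro!: exI[of _ K])
  then show "y \<in> outside S" using assms(4) outside_same_component by metis
qed

lemma walk_edges_append:
  assumes "xs \<noteq> []" "ys \<noteq> []"
  shows "walk_edges (xs @ ys) = insert {last xs, hd ys} (walk_edges xs \<union> walk_edges ys)"
  using assms
proof (induction xs rule: walk_edges.induct)
  case ("2_2" x)
  then show ?case by (cases ys) auto
qed auto

lemma walk_edges_rev: "walk_edges (rev xs) = walk_edges xs"
proof (induction xs rule: walk_edges.induct)
  case (1 x y zs)
  have "walk_edges (rev (x # y # zs)) = insert {y, x} (walk_edges (rev (y # zs)))"
    using walk_edges_append[of "rev (y # zs)" "[x]"] by simp
  then show ?case using 1 by (auto simp: insert_commute)
qed auto

lemma walk_edges_map_upt:
  "a \<le> n \<Longrightarrow> walk_edges (map f [a..<Suc n]) = {{f l, f (Suc l)} | l. a \<le> l \<and> l < n}"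
proof (induction n rule: nat_induct_at_least)
  case base
  then show ?case by simp
next
  case (Suc n)
  have "map f [a..<Suc (Suc n)] = map f [a..<Suc n] @ [f (Suc n)]" using Suc by simp
  moreover have "walk_edges (map f [a..<Suc n] @ [f (Suc n)])
      = insert {f n, f (Suc n)} (walk_edges (map f [a..<Suc n]))"
    using walk_edges_append[of "map f [a..<Suc n]" "[f (Suc n)]"] Suc by (simp add: last_map)
  ultimately have "walk_edges (map f [a..<Suc (Suc n)]) = insert {f n, f (Suc n)} {{f l, f (Suc l)} | l. a \<le> l \<and> l < n}"
    using Suc by simp
  also have "\<dots> = {{f l, f (Suc l)} | l. a \<le> l \<and> l < Suc n}" using Suc by (auto simp: less_Suc_eq)
  finally show ?case .
qed

lemma cycle_edges_rotate: "cycle_edges (xs @ ys) = cycle_edges (ys @ xs)"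
proof (cases "xs = [] \<or> ys = []")
  case False
  then show ?thesis by (simp add: cycle_edges_walk_edges walk_edges_append) (auto simp: insert_commute)
qed auto

lemma walk_edges_cover:
  assumes "length xs \<ge> 2" "x \<in> set xs"
  obtains e where "e \<in> walk_edges xs" "x \<in> e"
proof -
  obtain i where i: "i < length xs" "x = xs ! i" using assms(2) by (metis in_set_conv_nth)
  show ?thesis
  proof (cases "Suc i < length xs")
    case True
    then show ?thesis using that[of "{xs ! i, xs ! Suc i}"] i by (auto simp: walk_edges_nth)
  next
    case False
    then obtain j where "i = Suc j" using i assms by (cases i) auto
    then show ?thesis using that[of "{xs ! j, xs ! Suc j}"] i by (auto simp: walk_edges_nth)
  qed
qed

lemma cycle_edges_cover:
  assumes "x \<in> set xs"
  obtains e where "e \<in> cycle_edges xs" "x \<in> e"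
proof -
  obtain i where "i < length xs" "x = xs ! i" using assms by (metis in_set_conv_nth)
  then show ?thesis using that[of "{xs ! i, xs ! (Suc i mod length xs)}"] by (auto simp: cycle_edges_def)
qed

section \<open>Arcs and Jordan curves in a plane drawing\<close>

locale plane_drawing =
  fixes G :: "'a drawn_graph"
  assumes plane: "plane_graph G"
begin

abbreviation "V \<equiv> vertices G"
abbreviation "E \<equiv> edges G"
abbreviation "pt \<equiv> point G"
abbreviation "im e \<equiv> path_image (curve G e)"

definition open_curve :: "'a set \<Rightarrow> complex set" where
  "open_curve e = im e - pt ` e"

lemma finite_V: "finite V"
  using plane by (auto simp: plane_graph_def simple_graph_def)

lemma edgeE:
  assumes "e \<in> E"
  obtains u v where "u \<in> V" "v \<in> V" "u \<noteq> v" "e = {u, v}"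
  using plane assms unfolding plane_graph_def simple_graph_def by meson

lemma edge_sub: "e \<in> E \<Longrightarrow> e \<subseteq> V"
  by (erule edgeE) auto

lemma finite_E: "finite E"
  by (rule finite_subset[of _ "Pow V"]) (use finite_V edge_sub in auto)

lemma pt_inj: "u \<in> V \<Longrightarrow> v \<in> V \<Longrightarrow> pt u = pt v \<Longrightarrow> u = v"
  using plane unfolding plane_graph_def by (meson inj_onD)

lemma arc_curve: "e \<in> E \<Longrightarrow> arc (curve G e)"
  using plane by (simp add: plane_graph_def)

lemma ends_curve: "e \<in> E \<Longrightarrow> {pathstart (curve G e), pathfinish (curve G e)} = pt ` e"
  using plane by (simp add: plane_graph_def)

lemma ends_in_im: "e \<in> E \<Longrightarrow> v \<in> e \<Longrightarrow> pt v \<in> im e"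
  using ends_curve[of e] by (metis image_eqI insertE pathfinish_in_path_image pathstart_in_path_image singletonD)

lemma vertex_on_curve: "e \<in> E \<Longrightarrow> v \<in> V \<Longrightarrow> pt v \<in> im e \<Longrightarrow> v \<in> e"
  using plane by (simp add: plane_graph_def)

lemma im_Int: "e \<in> E \<Longrightarrow> f \<in> E \<Longrightarrow> e \<noteq> f \<Longrightarrow> im e \<inter> im f = pt ` (e \<inter> f)"
  using plane by (simp add: plane_graph_def)

lemma open_curve_eq: "e \<in> E \<Longrightarrow> open_curve e = im e - {pathstart (curve G e), pathfinish (curve G e)}"
  by (simp add: open_curve_def ends_curve)

lemma connected_open_curve: "e \<in> E \<Longrightarrow> connected (open_curve e)"
  using arc_curve arc_imp_simple_path by (metis connected_simple_path_endless open_curve_eq)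

lemma open_curve_nonempty: "e \<in> E \<Longrightarrow> open_curve e \<noteq> {}"
  using arc_curve arc_imp_simple_path by (metis nonempty_simple_path_endless open_curve_eq)

lemma open_curve_not_vertex: "e \<in> E \<Longrightarrow> p \<in> open_curve e \<Longrightarrow> v \<in> V \<Longrightarrow> p \<noteq> pt v"
  unfolding open_curve_def using vertex_on_curve by blast

lemma open_curve_im: "e \<in> E \<Longrightarrow> f \<in> E \<Longrightarrow> p \<in> open_curve e \<Longrightarrow> p \<in> im f \<Longrightarrow> e = f"
  unfolding open_curve_def using im_Int by blast

lemma open_curve_in_drawing:
  assumes "e \<in> E" "p \<in> open_curve e" "W \<subseteq> V" "F \<subseteq> E" "p \<in> drawing G W F"
  shows "e \<in> F"
  using assms open_curve_not_vertex open_curve_im unfolding drawing_def by blast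

lemma vertex_in_drawing:
  assumes "v \<in> V" "W \<subseteq> V" "F \<subseteq> E" "\<Union>F \<subseteq> W" "pt v \<in> drawing G W F"
  shows "v \<in> W"
  using assms vertex_on_curve pt_inj unfolding drawing_def by blast

lemma drawing_cases:
  assumes "F \<subseteq> E" "\<Union>F \<subseteq> W" "p \<in> drawing G W F"
  obtains v where "v \<in> W" "p = pt v" | e where "e \<in> F" "p \<in> open_curve e"
  using assms unfolding drawing_def open_curve_def by blast

lemma compact_drawing: "F \<subseteq> E \<Longrightarrow> W \<subseteq> V \<Longrightarrow> compact (drawing G W F)"
  unfolding drawing_def
  by (intro compact_Un compact_UN finite_imp_compact finite_imageI compact_path_image arc_imp_path)
     (auto intro: finite_subset[OF _ finite_V] finite_subset[OF _ finite_E] arc_curve)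

lemma drawing_mono: "W \<subseteq> W' \<Longrightarrow> F \<subseteq> F' \<Longrightarrow> drawing G W F \<subseteq> drawing G W' F'"
  unfolding drawing_def by blast

text \<open>A finite union of closed sets without interior points has no interior points either. It
  follows that the faces are dense in the plane.\<close>

lemma interior_drawing:
  assumes "F \<subseteq> E" "W \<subseteq> V"
  shows "interior (drawing G W F) = {}"
proof -
  have fin: "finite F" "finite W" using assms finite_subset finite_E finite_V by blast+
  have "finite F \<Longrightarrow> F \<subseteq> E \<Longrightarrow> closed (\<Union>e\<in>F. im e) \<and> interior (pt ` W \<union> (\<Union>e\<in>F. im e)) = {}"
  proof (induction F rule: finite_induct)
    case empty
    then show ?case using fin by (simp add: empty_interior_finite)
  next
    case (insert e F)
    have cl: "closed (im e)" using insert arc_curve by (simp add: closed_arc_image)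
    have 1: "interior (im e) = {}" using insert arc_curve interior_arc_image by auto
    have "interior ((pt ` W \<union> (\<Union>e\<in>F. im e)) \<union> im e) = interior (pt ` W \<union> (\<Union>e\<in>F. im e))"
      by (rule interior_closed_Un_empty_interior)
         (use insert 1 fin in \<open>simp_all add: closed_Un finite_imp_closed\<close>)
    then have "interior (pt ` W \<union> (\<Union>e\<in>insert e F. im e)) = {}"
      using insert by (simp add: Un_commute Un_left_commute)
    then show ?case using insert cl by auto
  qed
  then show ?thesis using fin assms by (simp add: drawing_def)
qed

lemma oriented_edge_arc:
  assumes "{u, v} \<in> E"
  obtains g where "arc g" "pathstart g = pt u" "pathfinish g = pt v" "path_image g = im {u, v}"
proof -
  have uv: "u \<noteq> v" "u \<in> V" "v \<in> V" using assms edgeE by (metis doubleton_eq_iff)+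
  have "{pathstart (curve G {u,v}), pathfinish (curve G {u,v})} = {pt u, pt v}"
    using ends_curve[OF assms] by simp
  then consider "pathstart (curve G {u,v}) = pt u" "pathfinish (curve G {u,v}) = pt v"
    | "pathstart (curve G {u,v}) = pt v" "pathfinish (curve G {u,v}) = pt u"
    by (auto simp: doubleton_eq_iff)
  then show ?thesis
  proof cases
    case 1 then show ?thesis using that arc_curve assms by blast
  next
    case 2 then show ?thesis
      using that[of "reversepath (curve G {u,v})"] arc_curve[OF assms] by (simp add: arc_reversepath)
  qed
qed

text \<open>By induction from the head: the curve of the first edge can meet the rest of the walk
  only at vertices, and distinctness leaves only the shared vertex \<open>y\<close>, so the arcs can
  be joined.\<close>

lemma walk_arc:
  assumes "distinct xs" "length xs \<ge> 2" "set xs \<subseteq> V" "walk_edges xs \<subseteq> E"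
  shows "\<exists>g. arc g \<and> pathstart g = pt (hd xs) \<and> pathfinish g = pt (last xs) \<and>
             path_image g = drawing G (set xs) (walk_edges xs)"
  using assms
proof (induction xs rule: walk_edges.induct)
  case (1 x y zs)
  have xy: "{x, y} \<in> E" using 1 by simp
  obtain g0 where g0: "arc g0" "pathstart g0 = pt x" "pathfinish g0 = pt y" "path_image g0 = im {x, y}"
    using oriented_edge_arc[OF xy] .
  show ?case
  proof (cases "zs = []")
    case True
    have "drawing G {x, y} {{x, y}} = im {x, y}"
      unfolding drawing_def using ends_in_im[OF xy] by auto
    then show ?thesis using g0 True by auto
  next
    case False
    then have "\<exists>g. arc g \<and> pathstart g = pt (hd (y # zs)) \<and> pathfinish g = pt (last (y # zs)) \<and>
             path_image g = drawing G (set (y # zs)) (walk_edges (y # zs))"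
      using 1 by (intro "1.IH") (auto simp: Suc_le_eq)
    then obtain g where g: "arc g" "pathstart g = pt y" "pathfinish g = pt (last zs)"
      "path_image g = drawing G (set (y # zs)) (walk_edges (y # zs))" using False by auto
    have int: "path_image g0 \<inter> path_image g \<subseteq> {pt y}"
    proof
      fix p assume p: "p \<in> path_image g0 \<inter> path_image g"
      then have px: "p \<in> im {x, y}" using g0 by simp
      from p consider w where "w \<in> set (y # zs)" "p = pt w" | f where "f \<in> walk_edges (y # zs)" "p \<in> im f"
        using g(4) unfolding drawing_def by blast
      then show "p \<in> {pt y}"
      proof cases
        case 1
        then have "w \<in> {x, y}" using vertex_on_curve[OF xy] "1.prems" px by auto
        then show ?thesis using 1 "1.prems"(1) by auto
      next
        case 2
        then have fs: "f \<subseteq> set (y # zs)" by (metis walk_edges_subset)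
        then have "f \<noteq> {x, y}" using "1.prems"(1) by auto
        moreover have "f \<in> E" using 2 "1.prems"(4) by auto
        ultimately have "p \<in> pt ` ({x, y} \<inter> f)" using im_Int[OF xy, of f] 2 px by auto
        then show ?thesis using fs "1.prems"(1) by auto
      qed
    qed
    have "arc (g0 +++ g)" using arc_join[OF g0(1) g(1)] g0 g int by simp
    moreover have "path_image (g0 +++ g) = drawing G (set (x # y # zs)) (walk_edges (x # y # zs))"
      using g0 g ends_in_im[OF xy] by (subst path_image_join) (auto simp: drawing_def)
    ultimately show ?thesis using g0 g False by (intro exI[of _ "g0 +++ g"]) auto
  qed
qed auto

definition cycle_trace :: "'a list \<Rightarrow> complex set" where
  "cycle_trace xs = drawing G (set xs) (cycle_edges xs)"

text \<open>The arc of the walk and the curve of the closing edge meet only at their common ends.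
  This makes the Jordan curve theorem available for cycles of the graph.\<close>

lemma cycle_simple_path:
  assumes "is_cycle G xs"
  obtains g where "simple_path g" "pathfinish g = pathstart g" "path_image g = cycle_trace xs"
proof -
  have xs: "length xs \<ge> 3" "distinct xs" "set xs \<subseteq> V" "cycle_edges xs \<subseteq> E" "xs \<noteq> []"
    using assms unfolding is_cycle_def by auto
  have ce: "cycle_edges xs = insert {last xs, hd xs} (walk_edges xs)"
    using cycle_edges_walk_edges xs by blast
  obtain g where g: "arc g" "pathstart g = pt (hd xs)" "pathfinish g = pt (last xs)"
       "path_image g = drawing G (set xs) (walk_edges xs)"
  proof -
    have "walk_edges xs \<subseteq> E" "length xs \<ge> 2" using xs(1,4) ce by auto
    then show ?thesis using walk_arc[OF xs(2) _ xs(3)] that by blast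
  qed
  have lh: "{last xs, hd xs} \<in> E" using ce xs(4) by blast
  obtain h where h: "arc h" "pathstart h = pt (last xs)" "pathfinish h = pt (hd xs)"
      "path_image h = im {last xs, hd xs}"
    using oriented_edge_arc[OF lh] .
  have int: "path_image g \<inter> path_image h \<subseteq> {pathstart g, pathstart h}"
  proof
    fix p assume p: "p \<in> path_image g \<inter> path_image h"
    then have ph: "p \<in> im {last xs, hd xs}" using h by simp
    from p consider w where "w \<in> set xs" "p = pt w" | f where "f \<in> walk_edges xs" "p \<in> im f"
      using g(4) unfolding drawing_def by blast
    then have "p \<in> pt ` {last xs, hd xs}"
    proof cases
      case 1
      then show ?thesis using vertex_on_curve[OF lh] ph xs(3) by blast
    next
      case 2
      then have "f \<noteq> {last xs, hd xs}" using closing_edge_notin_walk_edges[OF xs(2,1)] by auto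
      moreover have "f \<in> E" using 2 xs(4) ce by blast
      ultimately show ?thesis using im_Int[OF lh, of f] 2 ph by auto
    qed
    then show "p \<in> {pathstart g, pathstart h}" using g h by auto
  qed
  have "simple_path (g +++ h)" using simple_path_join_loop[OF g(1) h(1)] g h int by simp
  moreover have "path_image (g +++ h) = cycle_trace xs"
    using g h ends_in_im[OF lh] unfolding cycle_trace_def ce by (subst path_image_join) (auto simp: drawing_def)
  ultimately show ?thesis using that[of "g +++ h"] g h by simp
qed

lemma Jordan_cycle_trace:
  assumes "is_cycle G xs"
  shows "inside (cycle_trace xs) \<noteq> {}" "open (inside (cycle_trace xs))" "connected (inside (cycle_trace xs))"
    "outside (cycle_trace xs) \<noteq> {}" "open (outside (cycle_trace xs))" "connected (outside (cycle_trace xs))"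
    "bounded (inside (cycle_trace xs))" "\<not> bounded (outside (cycle_trace xs))"
    "inside (cycle_trace xs) \<inter> outside (cycle_trace xs) = {}"
    "inside (cycle_trace xs) \<union> outside (cycle_trace xs) = - cycle_trace xs"
    "frontier (inside (cycle_trace xs)) = cycle_trace xs" "frontier (outside (cycle_trace xs)) = cycle_trace xs"
    "closed (cycle_trace xs)" "compact (cycle_trace xs)"
proof -
  obtain g where "simple_path g" "pathfinish g = pathstart g" "path_image g = cycle_trace xs"
    using cycle_simple_path[OF assms] .
  then show "inside (cycle_trace xs) \<noteq> {}" "open (inside (cycle_trace xs))" "connected (inside (cycle_trace xs))"
    "outside (cycle_trace xs) \<noteq> {}" "open (outside (cycle_trace xs))" "connected (outside (cycle_trace xs))"
    "bounded (inside (cycle_trace xs))" "\<not> bounded (outside (cycle_trace xs))"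
    "inside (cycle_trace xs) \<inter> outside (cycle_trace xs) = {}"
    "inside (cycle_trace xs) \<union> outside (cycle_trace xs) = - cycle_trace xs"
    "frontier (inside (cycle_trace xs)) = cycle_trace xs" "frontier (outside (cycle_trace xs)) = cycle_trace xs"
    "closed (cycle_trace xs)" "compact (cycle_trace xs)"
    using Jordan_inside_outside[of g] closed_simple_path_image[of g] compact_simple_path_image[of g]
    by auto
qed

text \<open>\<open>X\<close> misses the curve and so lies on one side of it. Its frontier is the
  curve and does not meet that side, so \<open>X\<close> fills the side.\<close>

lemma face_inside_or_outside:
  assumes "is_cycle G xs" "open X" "connected X" "X \<noteq> {}" "frontier X = cycle_trace xs"
  shows "X = inside (cycle_trace xs) \<or> X = outside (cycle_trace xs)"
proof -
  note J = Jordan_cycle_trace[OF assms(1)]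
  have "X \<inter> cycle_trace xs = {}" using assms by (metis frontier_disjoint_eq inf_commute)
  then have sub: "X \<subseteq> inside (cycle_trace xs) \<union> outside (cycle_trace xs)" using J by auto
  have "X \<subseteq> inside (cycle_trace xs) \<or> X \<subseteq> outside (cycle_trace xs)"
    using connectedD[OF assms(3) J(2) J(5)] J(9) sub by blast
  moreover have "frontier X \<inter> inside (cycle_trace xs) = {}" "frontier X \<inter> outside (cycle_trace xs) = {}"
    using assms(5) inside_no_overlap[of "cycle_trace xs"] outside_no_overlap[of "cycle_trace xs"] by blast+
  ultimately show ?thesis
    using components_eqI_frontier[OF assms(2,4) J(3)] components_eqI_frontier[OF assms(2,4) J(6)] by blast
qed

end

section \<open>Faces of a triangulated disk\<close>

text \<open>
  The mod-2 boundary of a set of triangles, relative to the outer cycle: \<open>I\<close> is the set of inner edges, so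
  a path between two outer vertices can be a boundary as well.
\<close>

definition boundary :: "'a set set \<Rightarrow> 'a set set \<Rightarrow> 'a set set \<Rightarrow> 'a set set" where
  "boundary I T X = {e \<in> I. (\<exists>t\<in>X. e \<subseteq> t) \<and> (\<exists>t\<in>T - X. e \<subseteq> t)}"lemma closure_finite_UN: "finite I \<Longrightarrow> closure (\<Union>i\<in>I. A i) = (\<Union>i\<in>I. closure (A i))"
  by (induction I rule: finite_induct) auto

lemma cycle_edges_three: "cycle_edges [a, b, c] = {{a, b}, {b, c}, {c, a}}"
  by (auto simp: cycle_edges_walk_edges)

locale disk_drawing =
  fixes G :: "'a drawn_graph" and C :: "'a list"
  assumes disk: "triangulated_disk G"
    and outer: "bounded_by_cycle G (outer_face G (vertices G)) C"

sublocale disk_drawing \<subseteq> plane_drawing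
  using disk by unfold_locales (simp add: triangulated_disk_def)

context disk_drawing
begin

abbreviation "D \<equiv> drawing G V E"

lemma induced_drawing_V: "induced_drawing G V = D"
proof -
  have "{e \<in> E. e \<subseteq> V} = E" using edge_sub by auto
  then show ?thesis by (simp add: induced_drawing_def)
qed

lemma is_cycle_C: "is_cycle G C" using outer by (simp add: bounded_by_cycle_def)

lemma compact_D: "compact D" using compact_drawing by simp
lemma closed_D: "closed D" using compact_D compact_imp_closed by blast

lemma cycle_trace_subset: "is_cycle G xs \<Longrightarrow> cycle_trace xs \<subseteq> D"
  unfolding cycle_trace_def by (rule drawing_mono) (auto simp: is_cycle_def)

text \<open>The outer face has the trace of \<open>C\<close> as its frontier, so it is one of the
  two sides of \<open>C\<close>; being unbounded, it is the outer one.\<close>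

lemma outside_D: "outside D = outside (cycle_trace C)"
proof -
  have b: "bounded D" using compact_D compact_imp_bounded by blast
  have "frontier (outside D) = cycle_trace C"
    using outer by (simp add: bounded_by_cycle_def outer_face_def induced_drawing_V cycle_trace_def)
  moreover have "open (outside D)" using closed_D open_outside by blast
  moreover have "connected (outside D)" using connected_outside[OF b] by simp
  moreover have "\<not> bounded (outside D)" using b unbounded_outside by blast
  moreover have "outside D \<noteq> {}" using b outside_bounded_nonempty by blast
  ultimately show ?thesis
    using face_inside_or_outside[OF is_cycle_C, of "outside D"] Jordan_cycle_trace(7)[OF is_cycle_C] by metis
qed

text \<open>A triangle is recorded by its vertex set alone: in a simple graph this set determines
  the three edges and hence the face they bound. That face is required to be the inside, so the
  outer face is not counted even if \<open>C\<close> has length three.\<close>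

definition Tri :: "'a set set" where
  "Tri = {set xs | xs. length xs = 3 \<and> is_cycle G xs \<and> inside (cycle_trace xs) \<in> components (- D)}"

text \<open>
  Faces are indexed by their triangles; \<open>None\<close> stands for the outer face.
\<close>

primrec face_verts :: "'a set option \<Rightarrow> 'a set" where
  "face_verts None = set C"
| "face_verts (Some t) = t"

primrec face_edges :: "'a set option \<Rightarrow> 'a set set" where
  "face_edges None = cycle_edges C"
| "face_edges (Some t) = {e \<in> E. e \<subseteq> t}"

primrec face_region :: "'a set option \<Rightarrow> complex set" where
  "face_region None = outside (cycle_trace C)"
| "face_region (Some t) = inside (drawing G t {e \<in> E. e \<subseteq> t})"

definition face_ids :: "'a set option set" where
  "face_ids = insert None (Some ` Tri)"

lemma cycle_edges_triangle:
  assumes "is_cycle G xs" "length xs = 3"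
  shows "cycle_edges xs = {e \<in> E. e \<subseteq> set xs}"
proof -
  obtain a b c where abc: "xs = [a, b, c]"
    using assms(2) by (auto simp: numeral_3_eq_3 length_Suc_conv)
  have ce: "cycle_edges xs \<subseteq> E" using assms(1) by (simp add: is_cycle_def)
  have "e \<in> cycle_edges xs" if e: "e \<in> E" "e \<subseteq> set xs" for e
  proof -
    obtain u v where "u \<noteq> v" "e = {u, v}" using edgeE[OF e(1)] by metis
    then show ?thesis using e(2) unfolding abc cycle_edges_three by auto
  qed
  then show ?thesis using ce cycle_edges_subset by blast
qed

lemma TriE:
  assumes "t \<in> Tri"
  obtains xs where "length xs = 3" "is_cycle G xs" "set xs = t" "cycle_edges xs = {e \<in> E. e \<subseteq> t}"
    "face_region (Some t) = inside (cycle_trace xs)" "inside (cycle_trace xs) \<in> components (- D)"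
  using assms cycle_edges_triangle unfolding Tri_def by (fastforce simp: cycle_trace_def)

lemma face_ids_cycle:
  assumes "f \<in> face_ids"
  obtains xs where "is_cycle G xs" "set xs = face_verts f" "cycle_edges xs = face_edges f"
    "face_region f = inside (cycle_trace xs) \<or> face_region f = outside (cycle_trace xs)"
proof (cases f)
  case None
  then show ?thesis using that[of C] is_cycle_C by simp
next
  case (Some t)
  then have "t \<in> Tri" using assms by (auto simp: face_ids_def)
  then show ?thesis using that Some by (metis TriE face_verts.simps(2) face_edges.simps(2))
qed

lemma face_ids_component: "f \<in> face_ids \<Longrightarrow> face_region f \<in> components (- D)"
proof (cases f)
  case None
  have "outside D \<in> components (- D)"
    using outside_in_components[of D] compact_D compact_imp_bounded connected_outside[of D] outside_bounded_nonempty
    by (metis DIM_complex closed_D order_refl)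
  then show ?thesis using None outside_D by simp
next
  case (Some t)
  assume "f \<in> face_ids"
  then have "t \<in> Tri" using Some by (auto simp: face_ids_def)
  then show ?thesis using Some by (metis TriE)
qed

lemma frontier_face_region: "f \<in> face_ids \<Longrightarrow> frontier (face_region f) = drawing G (face_verts f) (face_edges f)"
  by (metis face_ids_cycle Jordan_cycle_trace(11,12) cycle_trace_def)

lemma face_edges_sub: "f \<in> face_ids \<Longrightarrow> face_edges f \<subseteq> E"
  by (metis face_ids_cycle is_cycle_def)
lemma face_verts_sub: "f \<in> face_ids \<Longrightarrow> face_verts f \<subseteq> V"
  by (metis face_ids_cycle is_cycle_def)
lemma Union_face_edges: "f \<in> face_ids \<Longrightarrow> \<Union>(face_edges f) \<subseteq> face_verts f"
  by (metis face_ids_cycle Sup_least cycle_edges_subset)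

lemma face_region_facts:
  assumes "f \<in> face_ids"
  shows "open (face_region f)" "connected (face_region f)" "face_region f \<noteq> {}" "face_region f \<inter> D = {}"
  using face_ids_component[OF assms] closed_D open_components[of "- D"] in_components_connected
    in_components_nonempty in_components_subset by blast+

lemma finite_Tri: "finite Tri"
  by (rule finite_subset[of _ "Pow V"]) (auto simp: Tri_def is_cycle_def finite_V)

lemma finite_face_ids: "finite face_ids" using finite_Tri by (simp add: face_ids_def)

lemma faces_cover: "- D = (\<Union>f\<in>face_ids. face_region f)"
proof
  show "(\<Union>f\<in>face_ids. face_region f) \<subseteq> - D" using face_region_facts(4) by blast
  show "- D \<subseteq> (\<Union>f\<in>face_ids. face_region f)"
  proof
    fix p assume "p \<in> - D"
    then obtain X where X: "X \<in> components (- D)" "p \<in> X"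
      by (metis Union_components UnionE)
    show "p \<in> (\<Union>f\<in>face_ids. face_region f)"
    proof (cases "X = outside D")
      case True
      then show ?thesis using X outside_D by (auto simp: face_ids_def)
    next
      case False
      then obtain xs where xs: "length xs = 3" "bounded_by_cycle G X xs"
        using disk X by (auto simp: triangulated_disk_def faces_def outer_face_def induced_drawing_V)
      then have cyc: "is_cycle G xs" and fr: "frontier X = cycle_trace xs"
        by (auto simp: bounded_by_cycle_def cycle_trace_def)
      have op: "open X" "connected X" "X \<noteq> {}"
        using X open_components[of "- D"] closed_D in_components_connected in_components_nonempty by blast+
      \<comment> \<open>The hypothesis on inner faces only says that \<open>X\<close> is one of the
        two sides of a triangle; boundedness decides that it is the inside.\<close>
      have bX: "bounded X"
      proof (rule ccontr)
        assume nb: "\<not> bounded X"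
        have "X = connected_component_set (- D) p"
          using X by (metis componentsE connected_component_eq)
        then have "p \<in> outside D" using nb X \<open>p \<in> - D\<close> by (simp add: outside)
        then have "X \<subseteq> outside D"
          using subset_outsideI[of X D p] op X in_components_subset by blast
        moreover have "outside D \<in> components (- D)"
          using face_ids_component[of None] outside_D by (simp add: face_ids_def)
        ultimately have "X = outside D" using X components_nonoverlap[of X "- D" "outside D"] op by blast
        then show False using False by simp
      qed
      then have "X = inside (cycle_trace xs)"
        using face_inside_or_outside[OF cyc op fr] Jordan_cycle_trace(8)[OF cyc] by metis
      then have "set xs \<in> Tri" "face_region (Some (set xs)) = X"
        using xs X cyc cycle_edges_triangle[OF cyc xs(1)] by (auto simp: Tri_def cycle_trace_def)
      then show ?thesis using X by (auto simp: face_ids_def)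
    qed
  qed
qed

text \<open>Equal faces have equal frontiers and hence equal vertex sets, which identifies two
  triangles. A triangle and \<open>None\<close> are told apart by boundedness, even if
  \<open>C\<close> has the same vertices.\<close>

lemma faces_disjoint:
  assumes "f \<in> face_ids" "g \<in> face_ids" "f \<noteq> g"
  shows "face_region f \<inter> face_region g = {}"
proof (rule ccontr)
  assume "face_region f \<inter> face_region g \<noteq> {}"
  then have eq: "face_region f = face_region g"
    using face_ids_component assms components_nonoverlap by metis
  have sub: "face_verts h \<subseteq> face_verts h'" if "h \<in> face_ids" "h' \<in> face_ids" "face_region h = face_region h'" for h h'
  proof
    fix v assume v: "v \<in> face_verts h"
    then have "pt v \<in> drawing G (face_verts h) (face_edges h)" by (simp add: drawing_def)
    then have "pt v \<in> drawing G (face_verts h') (face_edges h')" using frontier_face_region that by metis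
    then show "v \<in> face_verts h'"
      using vertex_in_drawing v that face_verts_sub face_edges_sub Union_face_edges by (metis subsetD)
  qed
  have fv: "face_verts f = face_verts g" using sub assms eq by blast
  have bd: "bounded (face_region (Some t))" if "Some t \<in> face_ids" for t
  proof -
    have "t \<in> Tri" using that by (auto simp: face_ids_def)
    then obtain xs where "is_cycle G xs" "face_region (Some t) = inside (cycle_trace xs)" by (metis TriE)
    then show ?thesis using Jordan_cycle_trace(7) by simp
  qed
  have "\<not> bounded (face_region None)" using Jordan_cycle_trace(8)[OF is_cycle_C] by simp
  then show False using bd assms eq fv by (metis face_verts.simps(2) option.exhaust)
qed

text \<open>The faces are dense and finite in number, so the closure of \<open>W\<close> is the
  union of the closures of the parts of \<open>W\<close> in the faces. This is the way to find a
  face at a given edge or vertex, on a prescribed side of a cycle.\<close>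

lemma face_near:
  assumes "open W" "p \<in> closure W"
  obtains f where "f \<in> face_ids" "p \<in> closure (W \<inter> face_region f)"
proof -
  have "closure (- D) = UNIV" using interior_drawing[of E V] by (simp add: closure_complement)
  then have "closure (W \<inter> - D) = closure W"
    using closure_open_Int_superset[OF assms(1), of "- D"] by simp
  moreover have "W \<inter> - D = (\<Union>f\<in>face_ids. W \<inter> face_region f)" using faces_cover by auto
  ultimately have "p \<in> (\<Union>f\<in>face_ids. closure (W \<inter> face_region f))"
    using assms by (metis closure_finite_UN finite_face_ids)
  then show ?thesis using that by auto
qed

lemma closure_face_frontier:
  assumes "f \<in> face_ids" "p \<in> D" "p \<in> closure (face_region f)"
  shows "p \<in> drawing G (face_verts f) (face_edges f)"
  using assms frontier_face_region[OF assms(1)] face_region_facts[OF assms(1)]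
  by (auto simp: frontier_def interior_open)

lemma open_curve_D: "e \<in> E \<Longrightarrow> p \<in> open_curve e \<Longrightarrow> p \<in> D"
  unfolding drawing_def open_curve_def by blast

lemma vertex_D: "v \<in> V \<Longrightarrow> pt v \<in> D"
  unfolding drawing_def by blast

lemma closure_face_edge:
  assumes "f \<in> face_ids" "e \<in> E" "p \<in> open_curve e" "p \<in> closure (face_region f)"
  shows "e \<in> face_edges f"
  using closure_face_frontier open_curve_in_drawing assms open_curve_D face_verts_sub face_edges_sub by metis

lemma closure_face_vertex:
  assumes "f \<in> face_ids" "v \<in> V" "pt v \<in> closure (face_region f)"
  shows "v \<in> face_verts f"
  using closure_face_frontier vertex_in_drawing assms vertex_D face_verts_sub face_edges_sub Union_face_edges by metis

lemma face_edge_closure: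
  assumes "f \<in> face_ids" "e \<in> face_edges f" "p \<in> im e"
  shows "p \<in> closure (face_region f)"
proof -
  have "p \<in> drawing G (face_verts f) (face_edges f)" using assms unfolding drawing_def by blast
  then show ?thesis using frontier_face_region[OF assms(1)] by (auto simp: frontier_def)
qed

lemma face_vertex_closure:
  assumes "f \<in> face_ids" "v \<in> face_verts f"
  shows "pt v \<in> closure (face_region f)"
proof -
  have "pt v \<in> drawing G (face_verts f) (face_edges f)" using assms unfolding drawing_def by blast
  then show ?thesis using frontier_face_region[OF assms(1)] by (auto simp: frontier_def)
qed

lemma connected_side:
  assumes "is_cycle G xs" "connected X" "X \<inter> cycle_trace xs = {}"
  shows "X \<subseteq> inside (cycle_trace xs) \<or> X \<subseteq> outside (cycle_trace xs)"
proof -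
  note J = Jordan_cycle_trace[OF assms(1)]
  have "X \<subseteq> inside (cycle_trace xs) \<union> outside (cycle_trace xs)" using J(10) assms(3) by blast
  then show ?thesis using connectedD[OF assms(2) J(2) J(5)] J(9) by blast
qed

lemma face_side:
  assumes "is_cycle G xs" "f \<in> face_ids"
  shows "face_region f \<subseteq> inside (cycle_trace xs) \<or> face_region f \<subseteq> outside (cycle_trace xs)"
  using connected_side[OF assms(1) face_region_facts(2)[OF assms(2)]] face_region_facts(4)[OF assms(2)]
    cycle_trace_subset[OF assms(1)] by blast

lemma face_side_excl:
  assumes "is_cycle G xs" "f \<in> face_ids"
  shows "\<not> (face_region f \<subseteq> inside (cycle_trace xs) \<and> face_region f \<subseteq> outside (cycle_trace xs))"
  using Jordan_cycle_trace(9)[OF assms(1)] face_region_facts(3)[OF assms(2)] by blast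

text \<open>Both sides of a cycle accumulate at every inner point of its edges, so each side
  contributes a face there.\<close>

lemma edge_sides:
  assumes "is_cycle G xs" "e \<in> cycle_edges xs"
  obtains f g where "f \<in> face_ids" "e \<in> face_edges f" "face_region f \<subseteq> inside (cycle_trace xs)"
     "g \<in> face_ids" "e \<in> face_edges g" "face_region g \<subseteq> outside (cycle_trace xs)"
proof -
  note J = Jordan_cycle_trace[OF assms(1)]
  have eE: "e \<in> E" using assms by (auto simp: is_cycle_def)
  obtain p where p: "p \<in> open_curve e" using open_curve_nonempty[OF eE] by auto
  have "p \<in> cycle_trace xs" using p assms(2) unfolding cycle_trace_def drawing_def open_curve_def by blast
  then have pc: "p \<in> closure (inside (cycle_trace xs))" "p \<in> closure (outside (cycle_trace xs))"
    using J(11,12) by (auto simp: frontier_def)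
  obtain f where f: "f \<in> face_ids" "p \<in> closure (inside (cycle_trace xs) \<inter> face_region f)"
    using face_near[OF J(2) pc(1)] .
  obtain g where g: "g \<in> face_ids" "p \<in> closure (outside (cycle_trace xs) \<inter> face_region g)"
    using face_near[OF J(5) pc(2)] .
  have "inside (cycle_trace xs) \<inter> face_region f \<noteq> {}" using f by auto
  then have fi: "face_region f \<subseteq> inside (cycle_trace xs)" using face_side[OF assms(1) f(1)] J(9) by blast
  have "outside (cycle_trace xs) \<inter> face_region g \<noteq> {}" using g by auto
  then have gi: "face_region g \<subseteq> outside (cycle_trace xs)" using face_side[OF assms(1) g(1)] J(9) by blast
  have "p \<in> closure (face_region f)" "p \<in> closure (face_region g)"
    using f g closure_mono[of "inside (cycle_trace xs) \<inter> face_region f" "face_region f"]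
      closure_mono[of "outside (cycle_trace xs) \<inter> face_region g" "face_region g"] by auto
  then show ?thesis using that f g fi gi closure_face_edge[OF _ eE p] by blast
qed

text \<open>A point off the cycle has a neighbourhood within one side, and this neighbourhood meets
  both faces.\<close>

lemma same_side:
  assumes "is_cycle G xs" "p \<notin> cycle_trace xs" "f \<in> face_ids" "g \<in> face_ids"
    "p \<in> closure (face_region f)" "p \<in> closure (face_region g)"
  shows "face_region f \<subseteq> inside (cycle_trace xs) \<longleftrightarrow> face_region g \<subseteq> inside (cycle_trace xs)"
proof -
  note J = Jordan_cycle_trace[OF assms(1)]
  have *: "face_region h \<subseteq> M" if "open M" "p \<in> M" "h \<in> face_ids" "p \<in> closure (face_region h)"
    "M = inside (cycle_trace xs) \<or> M = outside (cycle_trace xs)" for h M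
  proof -
    have "M \<inter> face_region h \<noteq> {}" using that(1,2,4) open_Int_closure_eq_empty by blast
    then show ?thesis using face_side[OF assms(1) that(3)] J(9) that(5) by blast
  qed
  consider "p \<in> inside (cycle_trace xs)" | "p \<in> outside (cycle_trace xs)" using J(10) assms(2) by blast
  then show ?thesis
  proof cases
    case 1 then show ?thesis using *[OF J(2)] assms by blast
  next
    case 2 then show ?thesis using *[OF J(5)] assms face_side_excl by metis
  qed
qed

lemma drawing_induced_Int:
  assumes "W \<subseteq> V" "W' \<subseteq> V"
  shows "induced_drawing G W \<inter> induced_drawing G W' = induced_drawing G (W \<inter> W')"
proof
  show "induced_drawing G W \<inter> induced_drawing G W' \<subseteq> induced_drawing G (W \<inter> W')"
  proof
    fix p assume p: "p \<in> induced_drawing G W \<inter> induced_drawing G W'"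
    then have "p \<in> drawing G W {e \<in> E. e \<subseteq> W}" by (simp add: induced_drawing_def)
    then show "p \<in> induced_drawing G (W \<inter> W')"
    proof (rule drawing_cases[rotated 2])
      fix v assume v: "v \<in> W" "p = pt v"
      then have "v \<in> W'"
        using p assms vertex_in_drawing[of v W' "{e \<in> E. e \<subseteq> W'}"] by (auto simp: induced_drawing_def)
      then show ?thesis using v by (auto simp: induced_drawing_def drawing_def)
    next
      fix e assume e: "e \<in> {e \<in> E. e \<subseteq> W}" "p \<in> open_curve e"
      then have "e \<in> {e \<in> E. e \<subseteq> W'}"
        using p assms open_curve_in_drawing[of e p W' "{e \<in> E. e \<subseteq> W'}"] by (auto simp: induced_drawing_def)
      then have "e \<in> {e \<in> E. e \<subseteq> W \<inter> W'}" "p \<in> im e" using e by (auto simp: open_curve_def)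
      then show ?thesis unfolding induced_drawing_def drawing_def by blast
    qed auto
  qed
  show "induced_drawing G (W \<inter> W') \<subseteq> induced_drawing G W \<inter> induced_drawing G W'"
    unfolding induced_drawing_def by (intro Int_greatest drawing_mono) auto
qed

section \<open>The faces at an edge\<close>

lemma edge_ne: "{u, v} \<in> E \<Longrightarrow> u \<noteq> v"
  by (metis doubleton_eq_iff edgeE)

lemma Tri_third:
  assumes "t \<in> Tri" "{u, v} \<in> E" "{u, v} \<subseteq> t"
  obtains w where "t = {u, v, w}" "w \<noteq> u" "w \<noteq> v" "{u, w} \<in> E" "{v, w} \<in> E" "w \<in> V"
proof -
  obtain xs where xs: "length xs = 3" "is_cycle G xs" "set xs = t" "cycle_edges xs = {e \<in> E. e \<subseteq> t}"
    using TriE[OF assms(1)] by metis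
  obtain a b c where abc: "xs = [a, b, c]"
    using xs(1) by (auto simp: numeral_3_eq_3 length_Suc_conv)
  have d: "a \<noteq> b" "b \<noteq> c" "a \<noteq> c" "{a,b,c} \<subseteq> V" "t = {a, b, c}"
    "{a, b} \<in> E" "{b, c} \<in> E" "{c, a} \<in> E"
    using xs(2,3) unfolding abc is_cycle_def cycle_edges_three by auto
  have uv: "u \<noteq> v" using assms edge_ne by blast
  have "\<exists>w. t = {u, v, w} \<and> w \<noteq> u \<and> w \<noteq> v \<and> {u, w} \<in> E \<and> {v, w} \<in> E \<and> w \<in> V"
  proof -
    have "u \<in> {a,b,c}" "v \<in> {a,b,c}" using assms(3) d by auto
    then consider "u = a" "v = b" | "u = a" "v = c" | "u = b" "v = a" | "u = b" "v = c" | "u = c" "v = a" | "u = c" "v = b"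
      using uv by auto
    then show ?thesis
    proof cases
      case 1 then show ?thesis using d by (intro exI[of _ c]) (auto simp: insert_commute)
    next
      case 2 then show ?thesis using d by (intro exI[of _ b]) (auto simp: insert_commute)
    next
      case 3 then show ?thesis using d by (intro exI[of _ c]) (auto simp: insert_commute)
    next
      case 4 then show ?thesis using d by (intro exI[of _ a]) (auto simp: insert_commute)
    next
      case 5 then show ?thesis using d by (intro exI[of _ b]) (auto simp: insert_commute)
    next
      case 6 then show ?thesis using d by (intro exI[of _ a]) (auto simp: insert_commute)
    qed
  qed
  then show ?thesis using that by blast
qed

text \<open>Some face has the edge on its bounding cycle, and then each of the two sides of that
  cycle contributes a face.\<close>

lemma edge_at_least_two:
  assumes "e \<in> E"
  obtains f g where "f \<in> face_ids" "g \<in> face_ids" "f \<noteq> g" "e \<in> face_edges f" "e \<in> face_edges g"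
proof -
  obtain p where p: "p \<in> open_curve e" using open_curve_nonempty[OF assms] by auto
  obtain f where f: "f \<in> face_ids" "p \<in> closure (UNIV \<inter> face_region f)"
    by (rule face_near[OF open_UNIV, of p]) simp
  then have "e \<in> face_edges f" using closure_face_edge[OF f(1) assms p] by simp
  then obtain xs where xs: "is_cycle G xs" "e \<in> cycle_edges xs" using face_ids_cycle[OF f(1)] by metis
  obtain f' g' where "f' \<in> face_ids" "e \<in> face_edges f'" "face_region f' \<subseteq> inside (cycle_trace xs)"
     "g' \<in> face_ids" "e \<in> face_edges g'" "face_region g' \<subseteq> outside (cycle_trace xs)"
    using edge_sides[OF xs] .
  then show ?thesis using that face_side_excl[OF xs(1)] by metis
qed

text \<open>
  The triangles \<open>t1\<close> and \<open>t2\<close> share only \<open>e\<close>, and the remaining four edges form a closed curve. By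
  Janiszewski's theorem a third face at \<open>e\<close> could be joined to the far side of that curve without
  meeting the two triangles.
\<close>

lemma edge_at_most_two:
  assumes e: "e \<in> E" and t: "t1 \<in> Tri" "t2 \<in> Tri" "t1 \<noteq> t2" "e \<subseteq> t1" "e \<subseteq> t2"
    and h: "h \<in> face_ids" "e \<in> face_edges h" "h \<noteq> Some t1" "h \<noteq> Some t2"
  shows False
proof -
  obtain u v where uv: "u \<in> V" "v \<in> V" "u \<noteq> v" "e = {u, v}" using edgeE[OF e] .
  obtain w1 where w1: "t1 = {u, v, w1}" "w1 \<noteq> u" "w1 \<noteq> v" "{u, w1} \<in> E" "{v, w1} \<in> E" "w1 \<in> V"
    using Tri_third[OF t(1), of u v] e t(4) uv(4) by metis
  obtain w2 where w2: "t2 = {u, v, w2}" "w2 \<noteq> u" "w2 \<noteq> v" "{u, w2} \<in> E" "{v, w2} \<in> E" "w2 \<in> V"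
    using Tri_third[OF t(2), of u v] e t(5) uv(4) by metis
  have w12: "w1 \<noteq> w2" using w1 w2 t(3) by auto
  define ys where "ys = [u, w1, v, w2]"
  have ce: "cycle_edges ys = {{u, w1}, {w1, v}, {v, w2}, {w2, u}}"
    by (auto simp: ys_def cycle_edges_walk_edges)
  have cyc: "is_cycle G ys"
    using uv w1 w2 w12 ce by (auto simp: is_cycle_def ys_def insert_commute)
  note J = Jordan_cycle_trace[OF cyc]
  define S where "S = induced_drawing G t1"
  define T where "T = induced_drawing G t2"
  have tV: "t1 \<subseteq> V" "t2 \<subseteq> V" using w1 w2 uv by auto
  have F: "Some t1 \<in> face_ids" "Some t2 \<in> face_ids" using t by (auto simp: face_ids_def)
  have reg: "face_region (Some t1) = inside S" "face_region (Some t2) = inside T"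
    by (auto simp: S_def T_def induced_drawing_def)
  have E1: "{e \<in> E. e \<subseteq> t1} \<subseteq> {{u,v},{u,w1},{v,w1}}"
  proof
    fix e' assume "e' \<in> {e \<in> E. e \<subseteq> t1}"
    then obtain a b where "a \<noteq> b" "e' = {a, b}" "{a, b} \<subseteq> {u, v, w1}" using w1(1) edgeE by (metis mem_Collect_eq)
    then show "e' \<in> {{u,v},{u,w1},{v,w1}}" by auto
  qed
  have E2: "{e \<in> E. e \<subseteq> t2} \<subseteq> {{u,v},{u,w2},{v,w2}}"
  proof
    fix e' assume "e' \<in> {e \<in> E. e \<subseteq> t2}"
    then obtain a b where "a \<noteq> b" "e' = {a, b}" "{a, b} \<subseteq> {u, v, w2}" using w2(1) edgeE by (metis mem_Collect_eq)
    then show "e' \<in> {{u,v},{u,w2},{v,w2}}" by auto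
  qed
  have "t1 \<inter> t2 = {u, v}" using w1 w2 w12 by auto
  then have "S \<inter> T = induced_drawing G {u, v}" using drawing_induced_Int[OF tV] by (simp add: S_def T_def)
  also have "\<dots> = im e"
  proof -
    have "{e' \<in> E. e' \<subseteq> {u, v}} = {e}"
    proof -
      have "e' = e" if "e' \<in> E" "e' \<subseteq> {u, v}" for e'
        using that edgeE[OF that(1)] uv(4) by (metis doubleton_eq_iff insertE insert_subset singletonD)
      then show ?thesis using e uv by auto
    qed
    then show ?thesis using ends_in_im[OF e] uv by (auto simp: induced_drawing_def drawing_def)
  qed
  finally have ST: "S \<inter> T = im e" .
  have STsub: "S \<union> T \<subseteq> cycle_trace ys \<union> im e"
  proof -
    have "S \<subseteq> drawing G {u,v,w1} {{u,v},{u,w1},{v,w1}}" unfolding S_def induced_drawing_def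
      by (rule drawing_mono) (use w1(1) E1 in auto)
    moreover have "T \<subseteq> drawing G {u,v,w2} {{u,v},{u,w2},{v,w2}}" unfolding T_def induced_drawing_def
      by (rule drawing_mono) (use w2(1) E2 in auto)
    moreover have "drawing G {u,v,w1} {{u,v},{u,w1},{v,w1}} \<subseteq> cycle_trace ys \<union> im e"
      "drawing G {u,v,w2} {{u,v},{u,w2},{v,w2}} \<subseteq> cycle_trace ys \<union> im e"
      unfolding cycle_trace_def ce drawing_def uv(4) by (auto simp: ys_def insert_commute)
    ultimately show ?thesis by blast
  qed
  have ys_sub: "cycle_trace ys \<subseteq> S \<union> T"
    unfolding cycle_trace_def ce drawing_def S_def T_def induced_drawing_def
    using w1 w2 by (auto simp: ys_def insert_commute)
  obtain p where p: "p \<in> open_curve e" using open_curve_nonempty[OF e] by auto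
  have oc: "open_curve e \<inter> cycle_trace ys = {}"
  proof (rule ccontr)
    assume "open_curve e \<inter> cycle_trace ys \<noteq> {}"
    then obtain q where "q \<in> open_curve e" "q \<in> cycle_trace ys" by auto
    then have "e \<in> cycle_edges ys"
      using open_curve_in_drawing[OF e, of q "set ys" "cycle_edges ys"] cyc
      by (auto simp: cycle_trace_def is_cycle_def)
    then show False using uv w1 w2 unfolding ce by (auto simp: doubleton_eq_iff)
  qed
  \<comment> \<open>\<open>M\<close> is whichever side of the quadrilateral contains the inner
    points of \<open>e\<close>; it may be the unbounded one, and the rest of the argument is the
    same for both.\<close>
  obtain M M' where M: "open M" "p \<in> M" "M' \<noteq> {}" "M \<inter> M' = {}" "M \<union> M' = - cycle_trace ys"
    and sides: "\<And>X. connected X \<Longrightarrow> X \<inter> cycle_trace ys = {} \<Longrightarrow> X \<subseteq> M \<or> X \<subseteq> M'"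
  proof -
    have "p \<notin> cycle_trace ys" using oc p by auto
    then consider "p \<in> inside (cycle_trace ys)" | "p \<in> outside (cycle_trace ys)" using J(10) by blast
    then show ?thesis
    proof cases
      case 1
      show ?thesis
        by (rule that[of "inside (cycle_trace ys)" "outside (cycle_trace ys)"]) (use 1 J connected_side[OF cyc] in auto)
    next
      case 2
      show ?thesis
      proof (rule that[of "outside (cycle_trace ys)" "inside (cycle_trace ys)"])
        show "outside (cycle_trace ys) \<inter> inside (cycle_trace ys) = {}" using J(9) by blast
        show "outside (cycle_trace ys) \<union> inside (cycle_trace ys) = - cycle_trace ys" using J(10) by blast
        show "X \<subseteq> outside (cycle_trace ys) \<or> X \<subseteq> inside (cycle_trace ys)"
          if "connected X" "X \<inter> cycle_trace ys = {}" for X using connected_side[OF cyc that] by blast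
      qed (use 2 J(1,5) in auto)
    qed
  qed
  have inM: "face_region f \<subseteq> M" if f: "f \<in> face_ids" "e \<in> face_edges f" for f
  proof -
    have "p \<in> closure (face_region f)" using face_edge_closure[OF f] p by (auto simp: open_curve_def)
    then have "M \<inter> face_region f \<noteq> {}" using M(1,2) open_Int_closure_eq_empty by blast
    moreover have "face_region f \<inter> cycle_trace ys = {}" using face_region_facts(4)[OF f(1)] cycle_trace_subset[OF cyc] by blast
    ultimately show ?thesis using sides[OF face_region_facts(2)[OF f(1)]] M(4) by blast
  qed
  have ocM: "open_curve e \<subseteq> M"
    using sides[OF connected_open_curve[OF e] oc] p M(2,4) by blast
  obtain b where b: "b \<in> M'" using M(3) by auto
  obtain a where a: "a \<in> face_region h" using face_region_facts(3)[OF h(1)] by auto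
  have aM: "a \<in> M" using inM[OF h(1,2)] a by blast
  have bys: "b \<notin> cycle_trace ys" using b M(5) by blast
  have "b \<notin> im e"
  proof
    assume "b \<in> im e"
    moreover have "b \<notin> open_curve e" using ocM b M(4) by blast
    ultimately have "b \<in> pt ` e" by (auto simp: open_curve_def)
    then have "b \<in> cycle_trace ys" unfolding cycle_trace_def drawing_def uv(4) by (auto simp: ys_def)
    then show False using bys by simp
  qed
  then have bST: "b \<notin> S \<union> T" using bys STsub by blast
  have STD: "S \<subseteq> D" "T \<subseteq> D"
    unfolding S_def T_def induced_drawing_def using drawing_mono[of t1 V "{e \<in> E. e \<subseteq> t1}" E]
      drawing_mono[of t2 V "{e \<in> E. e \<subseteq> t2}" E] tV by blast+
  have aST: "a \<notin> S \<union> T" using a face_region_facts(4)[OF h(1)] STD by blast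
  have ed: "e \<in> face_edges (Some t1)" "e \<in> face_edges (Some t2)" using e t by auto
  \<comment> \<open>The point \<open>b\<close> is outside either triangle because both triangular
    faces have \<open>e\<close> as an edge and so lie in \<open>M\<close>, while \<open>a\<close>
    belongs to the third face.\<close>
  have cc: "connected_component (- K) a b"
    if K: "K = induced_drawing G t" "Some t \<in> face_ids" "e \<in> face_edges (Some t)" "h \<noteq> Some t" "a \<notin> K" "b \<notin> K" "t \<in> Tri" for K t
  proof -
    have r: "face_region (Some t) = inside K" by (simp add: K induced_drawing_def)
    obtain xs where xs: "is_cycle G xs" "set xs = t" "cycle_edges xs = {e \<in> E. e \<subseteq> t}"
      using TriE[OF K(7)] by metis
    have Kt: "K = cycle_trace xs" by (simp add: K(1) induced_drawing_def cycle_trace_def xs)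
    have "a \<notin> inside K" using faces_disjoint[OF h(1) K(2) K(4)] a r by blast
    moreover have "b \<notin> inside K" using inM[OF K(2,3)] r b M(4) by blast
    ultimately have "a \<in> outside K" "b \<in> outside K" using K(5,6) by (auto simp: outside_inside)
    moreover have "outside K \<subseteq> - K" using outside_no_overlap by blast
    ultimately show ?thesis
      using Jordan_cycle_trace(6)[OF xs(1)] Kt unfolding connected_component_def by blast
  qed
  have 1: "connected_component (- S) a b" using cc[of S t1] F ed h aST bST t S_def by blast
  have 2: "connected_component (- T) a b" using cc[of T t2] F ed h aST bST t T_def by blast
  have "compact S" "compact T" unfolding S_def T_def induced_drawing_def
    using compact_drawing[of "{e \<in> E. e \<subseteq> t1}" t1] compact_drawing[of "{e \<in> E. e \<subseteq> t2}" t2] tV by auto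
  then have "compact S" "closed T" using compact_imp_closed by blast+
  moreover have "connected (S \<inter> T)" unfolding ST using arc_curve[OF e] by (simp add: arc_imp_path connected_path_image)
  ultimately have "connected_component (- (S \<union> T)) a b" using Janiszewski 1 2 by blast
  then obtain K where K: "connected K" "K \<subseteq> - (S \<union> T)" "a \<in> K" "b \<in> K"
    unfolding connected_component_def by blast
  then have "K \<subseteq> M \<or> K \<subseteq> M'" using sides ys_sub by blast
  then show False using K aM b M(4) by blast
qed

text \<open>Only one face is not indexed by a triangle, so three faces at an edge would include two
  triangles, and \<open>edge_at_most_two\<close> excludes the third.\<close>

lemma edge_two_faces:
  assumes "e \<in> E"
  shows "card {f \<in> face_ids. e \<in> face_edges f} = 2"
proof -
  obtain f g where fg: "f \<in> face_ids" "g \<in> face_ids" "f \<noteq> g" "e \<in> face_edges f" "e \<in> face_edges g"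
    using edge_at_least_two[OF assms] .
  have "h = f \<or> h = g" if h: "h \<in> face_ids" "e \<in> face_edges h" for h
  proof (rule ccontr)
    assume neg: "\<not> (h = f \<or> h = g)"
    have T: "\<exists>t. k = Some t \<and> t \<in> Tri \<and> e \<subseteq> t" if "k \<in> face_ids" "k \<noteq> None" "e \<in> face_edges k" for k
      using that by (auto simp: face_ids_def)
    consider "f \<noteq> None" "g \<noteq> None" | "f \<noteq> None" "h \<noteq> None" | "g \<noteq> None" "h \<noteq> None"
      using neg fg by metis
    then show False
    proof cases
      case 1 then show ?thesis using T[OF fg(1) _ fg(4)] T[OF fg(2) _ fg(5)] edge_at_most_two[OF assms] h neg fg by metis
    next
      case 2 then show ?thesis using T[OF fg(1) _ fg(4)] T[OF h(1) _ h(2)] edge_at_most_two[OF assms] h neg fg by metis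
    next
      case 3 then show ?thesis using T[OF h(1) _ h(2)] T[OF fg(2) _ fg(5)] edge_at_most_two[OF assms] h neg fg by metis
    qed
  qed
  then have "{f \<in> face_ids. e \<in> face_edges f} = {f, g}" using fg by blast
  then show ?thesis using fg by simp
qed

lemma inner_edge_two:
  assumes "e \<in> E" "e \<notin> cycle_edges C"
  shows "card {t \<in> Tri. e \<subseteq> t} = 2"
proof -
  have "{f \<in> face_ids. e \<in> face_edges f} = Some ` {t \<in> Tri. e \<subseteq> t}" using assms by (auto simp: face_ids_def)
  then show ?thesis using edge_two_faces[OF assms(1)] by (simp add: card_image)
qed

text \<open>The outer face accounts for one of the two faces at the edge.\<close>

lemma outer_edge_one:
  assumes "e \<in> cycle_edges C"
  shows "card {t \<in> Tri. e \<subseteq> t} = 1"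
proof -
  have e: "e \<in> E" using assms is_cycle_C by (auto simp: is_cycle_def)
  have "{f \<in> face_ids. e \<in> face_edges f} = insert None (Some ` {t \<in> Tri. e \<subseteq> t})" using assms e by (auto simp: face_ids_def)
  then have "Suc (card (Some ` {t \<in> Tri. e \<subseteq> t})) = 2"
    using edge_two_faces[OF e] finite_Tri by (simp add: card_insert_if)
  then show ?thesis by (simp add: card_image)
qed

lemma vertex_in_Tri:
  assumes "v \<in> V"
  obtains t where "t \<in> Tri" "v \<in> t"
proof -
  obtain f where f: "f \<in> face_ids" "pt v \<in> closure (UNIV \<inter> face_region f)"
    by (rule face_near[OF open_UNIV, of "pt v"]) simp
  then have vf: "v \<in> face_verts f" using closure_face_vertex[OF f(1) assms] by simp
  show ?thesis
  proof (cases f)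
    case None
    then have "v \<in> set C" using vf by simp
    then obtain i where "i < length C" "v = C ! i" by (metis in_set_conv_nth)
    then obtain e where e: "e \<in> cycle_edges C" "v \<in> e" unfolding cycle_edges_def by blast
    have "{t \<in> Tri. e \<subseteq> t} \<noteq> {}" using outer_edge_one[OF e(1)] by fastforce
    then show ?thesis using that e by auto
  next
    case (Some t)
    then show ?thesis using that vf f by (auto simp: face_ids_def)
  qed
qed

section \<open>Boundaries of sets of triangles in the drawing\<close>

abbreviation bd :: "'a set set \<Rightarrow> 'a set set" where
  "bd \<equiv> boundary (E - cycle_edges C) Tri"

text \<open>If both \<open>X\<close> and its complement were nonempty, the closures of their faces
  would form two closed sets that cover the inside of \<open>C\<close> with the vertex points
  deleted, which is connected. A common point would be an inner point of an inner edge with a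
  triangle of either kind, that is, of a boundary edge.\<close>

lemma bd_empty:
  assumes "X \<subseteq> Tri" "bd X = {}"
  shows "X = {} \<or> X = Tri"
proof (rule ccontr)
  assume neg: "\<not> (X = {} \<or> X = Tri)"
  note J = Jordan_cycle_trace[OF is_cycle_C]
  define Om where "Om = inside (cycle_trace C)"
  \<comment> \<open>Vertex points have to go because triangles of both kinds may meet at a vertex
    without sharing an edge; deleting finitely many points does not disconnect an open connected set
    in the plane.\<close>
  define K where "K = Om - pt ` V"
  have K: "connected K" unfolding K_def Om_def
    by (rule connected_open_delete_finite) (use J finite_V in auto)
  define U where "U = (\<lambda>X. \<Union>t\<in>X. closure (face_region (Some t)))"
  have SF: "Some t \<in> face_ids" if "t \<in> Tri" for t using that by (simp add: face_ids_def)
  have NF: "None \<in> face_ids" by (simp add: face_ids_def)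
  have closed_U: "closed (U Y)" if "Y \<subseteq> Tri" for Y
    unfolding U_def using finite_subset[OF that finite_Tri] by auto
  have meet: "U Y \<inter> K \<noteq> {}" if Y: "Y \<noteq> {}" "Y \<subseteq> Tri" for Y
  proof -
    obtain t where t: "t \<in> Y" using Y by auto
    then have tF: "Some t \<in> face_ids" using SF Y by auto
    obtain q where q: "q \<in> face_region (Some t)" using face_region_facts(3)[OF tF] by auto
    have "q \<notin> D" using q face_region_facts(4)[OF tF] by blast
    moreover have "q \<notin> face_region None" using faces_disjoint[OF tF NF] q by auto
    ultimately have "q \<in> Om" using J(10) cycle_trace_subset[OF is_cycle_C] unfolding Om_def face_region.simps by blast
    moreover have "q \<notin> pt ` V" using \<open>q \<notin> D\<close> vertex_D by blast
    moreover have "q \<in> U Y" using q t closure_subset unfolding U_def by blast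
    ultimately show ?thesis by (auto simp: K_def)
  qed
  have cover: "K \<subseteq> U X \<union> U (Tri - X)"
  proof
    fix q assume "q \<in> K"
    then have q: "q \<in> Om" by (simp add: K_def)
    then have "q \<in> closure Om" using closure_subset by blast
    then obtain f where f: "f \<in> face_ids" "q \<in> closure (Om \<inter> face_region f)"
      using face_near[of Om q] J(2) by (auto simp: Om_def)
    have "f \<noteq> None"
    proof
      assume "f = None"
      then have "Om \<inter> face_region f = {}" using J(9) by (simp add: Om_def)
      then show False using f by simp
    qed
    then obtain t where t: "f = Some t" "t \<in> Tri" using f by (auto simp: face_ids_def)
    have "q \<in> closure (face_region (Some t))" using f t closure_mono[of "Om \<inter> face_region f" "face_region f"] by auto
    then show "q \<in> U X \<union> U (Tri - X)" using t by (auto simp: U_def)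
  qed
  have "U X \<inter> U (Tri - X) \<inter> K = {}"
  proof (rule ccontr)
    assume "U X \<inter> U (Tri - X) \<inter> K \<noteq> {}"
    then obtain q t t' where q: "q \<in> K" "t \<in> X" "t' \<in> Tri - X" "q \<in> closure (face_region (Some t))"
       "q \<in> closure (face_region (Some t'))"
      by (auto simp: U_def)
    then have tF: "Some t \<in> face_ids" "Some t' \<in> face_ids" "Some t \<noteq> Some t'" using SF assms(1) by auto
    have "q \<notin> face_region (Some t)"
      using faces_disjoint[OF tF] open_Int_closure_eq_empty face_region_facts(1)[OF tF(1)] q(5) by blast
    then have "q \<in> frontier (face_region (Some t))"
      using q(4) face_region_facts(1)[OF tF(1)] by (simp add: frontier_def interior_open)
    then have qd: "q \<in> drawing G t {e \<in> E. e \<subseteq> t}" using frontier_face_region[OF tF(1)] by simp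
    have tV: "t \<subseteq> V" using face_verts_sub[OF tF(1)] by simp
    obtain e where e: "e \<in> E" "e \<subseteq> t" "q \<in> open_curve e"
    proof (rule drawing_cases[OF _ _ qd])
      fix v assume "v \<in> t" "q = pt v"
      then show thesis using q(1) tV unfolding K_def by blast
    qed (use that in auto)
    have "e \<subseteq> t'" using closure_face_edge[OF tF(2) e(1,3) q(5)] by simp
    moreover have "e \<notin> cycle_edges C"
    proof
      assume "e \<in> cycle_edges C"
      then have "q \<in> cycle_trace C" using e(3) unfolding cycle_trace_def drawing_def open_curve_def by blast
      then show False using q(1) inside_no_overlap[of "cycle_trace C"] unfolding K_def Om_def by blast
    qed
    ultimately have "e \<in> bd X" using e q unfolding boundary_def by blast
    then show False using assms by simp
  qed
  moreover have "closed (U X)" "closed (U (Tri - X))" using closed_U assms(1) by auto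
  moreover have "U X \<inter> K \<noteq> {}" "U (Tri - X) \<inter> K \<noteq> {}" using meet[of X] meet[of "Tri - X"] neg assms(1) by blast+
  ultimately show False using K[unfolded connected_closed] cover by blast
qed

text \<open>\<open>X\<close> consists of the triangles inside the cycle. An edge or vertex off the
  cycle lies on one side together with all faces at it, whereas the two faces at a cycle edge lie on
  different sides. At an edge of \<open>C\<close> one of the two faces is the outer one, which is
  never inside; this gives the last clause.\<close>

lemma cycle_bounds:
  assumes "is_cycle G xs"
  shows "\<exists>X\<subseteq>Tri. bd X = cycle_edges xs - cycle_edges C \<and>
    (\<forall>v\<in>V - set xs. \<forall>t\<in>Tri. \<forall>t'\<in>Tri. v \<in> t \<longrightarrow> v \<in> t' \<longrightarrow> t \<in> X \<longrightarrow> t' \<in> X) \<and>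
    (\<forall>e\<in>cycle_edges C. \<forall>t\<in>Tri. e \<subseteq> t \<longrightarrow> t \<in> X \<longleftrightarrow> e \<in> cycle_edges xs)"
proof -
  note J = Jordan_cycle_trace[OF assms]
  have xsE: "cycle_edges xs \<subseteq> E" "set xs \<subseteq> V" using assms by (auto simp: is_cycle_def)
  have CE: "cycle_edges C \<subseteq> E" using is_cycle_C by (auto simp: is_cycle_def)
  define X where "X = {t \<in> Tri. face_region (Some t) \<subseteq> inside (cycle_trace xs)}"
  have SF: "Some t \<in> face_ids" if "t \<in> Tri" for t using that by (simp add: face_ids_def)
  have NF: "None \<in> face_ids" by (simp add: face_ids_def)
  have None_out: "\<not> face_region None \<subseteq> inside (cycle_trace xs)"
    using J(7) Jordan_cycle_trace(8)[OF is_cycle_C] bounded_subset by auto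
  have Xiff: "t \<in> X \<longleftrightarrow> face_region (Some t) \<subseteq> inside (cycle_trace xs)" if "t \<in> Tri" for t
    using that by (simp add: X_def)
  have off: "face_region f \<subseteq> inside (cycle_trace xs) \<longleftrightarrow> face_region g \<subseteq> inside (cycle_trace xs)"
    if h: "e \<in> E" "e \<notin> cycle_edges xs" "f \<in> face_ids" "g \<in> face_ids" "e \<in> face_edges f" "e \<in> face_edges g" for e f g
  proof -
    obtain p where p: "p \<in> open_curve e" using open_curve_nonempty[OF h(1)] by auto
    have "p \<notin> cycle_trace xs"
      using open_curve_in_drawing[OF h(1) p xsE(2,1)] h(2) by (auto simp: cycle_trace_def)
    moreover have "p \<in> im e" using p by (simp add: open_curve_def)
    ultimately show ?thesis using same_side[OF assms _ h(3,4)] face_edge_closure h by blast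
  qed
  have X2: "bd X = cycle_edges xs - cycle_edges C"
  proof
    show "bd X \<subseteq> cycle_edges xs - cycle_edges C"
    proof
      fix e assume "e \<in> bd X"
      then obtain t t' where e: "e \<in> E" "e \<notin> cycle_edges C" "t \<in> X" "e \<subseteq> t" "t' \<in> Tri - X" "e \<subseteq> t'"
        by (auto simp: boundary_def)
      then have "t \<in> Tri" by (auto simp: X_def)
      then have "e \<in> cycle_edges xs" using off[OF e(1), of "Some t" "Some t'"] e SF Xiff by auto
      then show "e \<in> cycle_edges xs - cycle_edges C" using e by auto
    qed
    show "cycle_edges xs - cycle_edges C \<subseteq> bd X"
    proof
      fix e assume e: "e \<in> cycle_edges xs - cycle_edges C"
      then have eE: "e \<in> E" using xsE by auto
      obtain f g where fg: "f \<in> face_ids" "e \<in> face_edges f" "face_region f \<subseteq> inside (cycle_trace xs)"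
         "g \<in> face_ids" "e \<in> face_edges g" "face_region g \<subseteq> outside (cycle_trace xs)"
        using edge_sides[OF assms] e by blast
      have "f \<noteq> None" "g \<noteq> None" using fg(2,5) e face_edges.simps(1) by (metis DiffD2)+
      then obtain t t' where t: "f = Some t" "g = Some t'" by blast
      then have tT: "t \<in> Tri" "t' \<in> Tri" using fg by (auto simp: face_ids_def)
      have "t \<in> X" using Xiff fg t tT by simp
      moreover have "t' \<notin> X" using Xiff fg t tT face_side_excl[OF assms fg(4)] by auto
      ultimately show "e \<in> bd X" using e eE tT t fg by (auto simp: boundary_def)
    qed
  qed
  have X3: "t \<in> X \<longleftrightarrow> t' \<in> X"
    if h: "v \<in> V" "v \<notin> set xs" "t \<in> Tri" "t' \<in> Tri" "v \<in> t" "v \<in> t'" for v t t'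
  proof -
    have "\<Union>(cycle_edges xs) \<subseteq> set xs" using cycle_edges_subset by blast
    then have "pt v \<notin> cycle_trace xs"
      using vertex_in_drawing[OF h(1) xsE(2,1)] h(2) by (auto simp: cycle_trace_def)
    moreover have "pt v \<in> closure (face_region (Some t))" "pt v \<in> closure (face_region (Some t'))"
      using face_vertex_closure[OF SF[OF h(3)], of v] face_vertex_closure[OF SF[OF h(4)], of v] h(5,6)
      by auto
    ultimately have "face_region (Some t) \<subseteq> inside (cycle_trace xs) \<longleftrightarrow> face_region (Some t') \<subseteq> inside (cycle_trace xs)"
      using same_side[OF assms _ SF[OF h(3)] SF[OF h(4)]] by blast
    then show ?thesis using Xiff[OF h(3)] Xiff[OF h(4)] by blast
  qed
  have X4: "t \<in> X \<longleftrightarrow> e \<in> cycle_edges xs" if h: "e \<in> cycle_edges C" "t \<in> Tri" "e \<subseteq> t" for e t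
  proof
    assume "t \<in> X"
    then show "e \<in> cycle_edges xs"
      using off[of e "Some t" None] SF NF h CE Xiff None_out by auto
  next
    assume "e \<in> cycle_edges xs"
    then obtain f where f: "f \<in> face_ids" "e \<in> face_edges f" "face_region f \<subseteq> inside (cycle_trace xs)"
      using edge_sides[OF assms] by blast
    then have "f \<noteq> None" using None_out by auto
    then obtain t' where t': "f = Some t'" "t' \<in> Tri" "e \<subseteq> t'" using f by (auto simp: face_ids_def)
    have "t' = t"
      using outer_edge_one[OF h(1)] h t' by (metis (mono_tags, lifting) card_1_singletonE mem_Collect_eq singletonD)
    then show "t \<in> X" using f t' Xiff by auto
  qed
  have X1: "X \<subseteq> Tri" by (auto simp: X_def)
  show ?thesis
  proof (intro exI[of _ X] conjI ballI impI)
    show "X \<subseteq> Tri" "bd X = cycle_edges xs - cycle_edges C" by (rule X1, rule X2)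
    show "t' \<in> X" if "v \<in> V - set xs" "t \<in> Tri" "t' \<in> Tri" "v \<in> t" "v \<in> t'" "t \<in> X" for v t t'
      using X3[of v t t'] that by simp
    show "t \<in> X \<longleftrightarrow> e \<in> cycle_edges xs" if "e \<in> cycle_edges C" "t \<in> Tri" "e \<subseteq> t" for e t
      by (rule X4[OF that])
  qed
qed

text \<open>
  \<open>reach i\<close> consists of the vertices at distance less than \<open>i\<close> from the outer cycle; it turns out to be
  the union of the first \<open>i\<close> layers.
\<close>

primrec reach :: "nat \<Rightarrow> 'a set" where
  "reach 0 = {}"
| "reach (Suc i) = (if i = 0 then set C else reach i \<union> {v \<in> V. \<exists>u\<in>reach i. {u, v} \<in> E})"

lemma reach_sub_V: "reach i \<subseteq> V"
  using is_cycle_C by (induction i) (auto simp: is_cycle_def)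

lemma reach_mono: "i \<le> j \<Longrightarrow> reach i \<subseteq> reach j"
  by (rule lift_Suc_mono_le) auto

lemma C_sub_reach: "i \<ge> 1 \<Longrightarrow> set C \<subseteq> reach i"
  using reach_mono[of 1 i] by simp

lemma im_Int_induced:
  assumes "e \<in> E" "W \<subseteq> V" "\<not> e \<subseteq> W" "p \<in> im e" "p \<in> induced_drawing G W"
  obtains v where "v \<in> e" "v \<in> W" "p = pt v"
proof -
  have "p \<in> drawing G W {e \<in> E. e \<subseteq> W}" using assms by (simp add: induced_drawing_def)
  then show ?thesis
  proof (rule drawing_cases[rotated 2])
    fix v assume v: "v \<in> W" "p = pt v"
    then have "v \<in> e" using vertex_on_curve assms by blast
    then show ?thesis using that v by blast
  next
    fix f assume f: "f \<in> {e \<in> E. e \<subseteq> W}" "p \<in> open_curve f"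
    then have "f = e" using open_curve_im assms by blast
    then show ?thesis using f assms by blast
  qed auto
qed

lemma im_subset_closure_open_curve:
  assumes "e \<in> E"
  shows "im e \<subseteq> closure (open_curve e)"
proof -
  let ?g = "curve G e"
  have arc: "arc ?g" using arc_curve[OF assms] .
  then have cont: "continuous_on {0..1} ?g" and inj: "inj_on ?g {0..1}"
    by (auto simp: arc_def path_def)
  have "?g ` {0<..<1} \<subseteq> open_curve e"
  proof
    fix x assume "x \<in> ?g ` {0<..<1}"
    then obtain t where t: "0 < t" "t < 1" "x = ?g t" by auto
    have "?g t \<noteq> ?g 0" "?g t \<noteq> ?g 1" using inj_on_eq_iff[OF inj, of t] t by auto
    then show "x \<in> open_curve e" using t
      by (auto simp: open_curve_eq[OF assms] path_image_def pathstart_def pathfinish_def)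
  qed
  moreover have "?g ` closure {0<..<1} \<subseteq> closure (?g ` {0<..<1})"
    by (rule image_closure_subset[where S = "{0<..<1::real}"])
       (use cont closure_subset[of "?g ` {0<..<1}"] in auto)
  ultimately show ?thesis using closure_mono[of "?g ` {0<..<1}" "open_curve e"] by (auto simp: path_image_def)
qed

text \<open>The closed outer face is connected and avoids the remaining drawing, which settles the
  vertices of \<open>C\<close>. Every further vertex is tied to an earlier one by an edge with both
  ends in \<open>reach i\<close>, and such an edge avoids the remaining drawing too. The drawing is
  fixed by \<open>i\<close> while the induction runs over \<open>k\<close>.\<close>

lemma reach_outside:
  assumes "i \<ge> 1" "k \<le> i" "z \<in> reach k"
  shows "pt z \<in> outside (induced_drawing G (V - reach i))"
proof -
  define W where "W = V - reach i"
  have WV: "W \<subseteq> V" by (auto simp: W_def)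
  have sub: "induced_drawing G W \<subseteq> D"
    unfolding induced_drawing_def by (rule drawing_mono) (auto simp: W_def)
  have CW: "set C \<inter> W = {}" using C_sub_reach[OF assms(1)] by (auto simp: W_def)
  have CV: "set C \<subseteq> V" "cycle_edges C \<subseteq> E" using is_cycle_C by (auto simp: is_cycle_def)
  have disj: "cycle_trace C \<inter> induced_drawing G W = {}"
  proof (rule ccontr)
    assume "cycle_trace C \<inter> induced_drawing G W \<noteq> {}"
    then obtain p where p: "p \<in> cycle_trace C" "p \<in> induced_drawing G W" by auto
    then consider v where "v \<in> set C" "p = pt v" | e where "e \<in> cycle_edges C" "p \<in> im e"
      by (auto simp: cycle_trace_def drawing_def)
    then show False
    proof cases
      case 1
      then have "v \<in> W" using vertex_in_drawing[of v W "{e \<in> E. e \<subseteq> W}"] p CV WV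
        by (auto simp: induced_drawing_def)
      then show ?thesis using 1 CW by auto
    next
      case 2
      then have "e \<subseteq> set C" "e \<in> E" using cycle_edges_subset CV by blast+
      moreover obtain a where "a \<in> e" using edgeE[OF \<open>e \<in> E\<close>] by blast
      ultimately have "\<not> e \<subseteq> W" "e \<inter> W = {}" using CW by auto
      then show ?thesis using im_Int_induced[OF \<open>e \<in> E\<close> WV _ 2(2) p(2)] by blast
    qed
  qed
  note J = Jordan_cycle_trace[OF is_cycle_C]
  have o: "outside (cycle_trace C) \<subseteq> outside (induced_drawing G W)"
    using outside_mono[OF sub] outside_D by simp
  obtain x where x: "x \<in> outside (cycle_trace C)" using J(4) by auto
  have cl: "closure (outside (cycle_trace C)) = outside (cycle_trace C) \<union> cycle_trace C"
    using J(12) closure_Un_frontier by metis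
  have "closure (outside (cycle_trace C)) \<subseteq> outside (induced_drawing G W)"
  proof (rule subset_outsideI[of _ _ x])
    show "connected (closure (outside (cycle_trace C)))" using J(6) connected_imp_connected_closure by blast
    show "closure (outside (cycle_trace C)) \<inter> induced_drawing G W = {}"
      unfolding cl using disj o outside_no_overlap[of "induced_drawing G W"] by blast
  qed (use x o closure_subset in auto)
  moreover have "pt v \<in> cycle_trace C" if "v \<in> set C" for v
    using that by (simp add: cycle_trace_def drawing_def)
  ultimately have base: "pt v \<in> outside (induced_drawing G W)" if "v \<in> set C" for v
    using that unfolding cl by blast
  have "k \<le> i \<Longrightarrow> z \<in> reach k \<Longrightarrow> pt z \<in> outside (induced_drawing G W)" for k z
  proof (induction k arbitrary: z)
    case 0 then show ?case by simp
  next
    case (Suc k)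
    show ?case
    proof (cases "k = 0 \<or> z \<in> reach k")
      case True
      then show ?thesis using Suc base by auto
    next
      case False
      then obtain u where u: "u \<in> reach k" "{u, z} \<in> E" using Suc by auto
      have out: "u \<notin> W" "z \<notin> W" using u Suc reach_mono[of k i] reach_mono[of "Suc k" i] by (auto simp: W_def)
      have "im {u, z} \<inter> induced_drawing G W = {}"
        using im_Int_induced[OF u(2) WV] out by blast
      then have "im {u, z} \<subseteq> outside (induced_drawing G W)"
        using subset_outsideI[of "im {u, z}" "induced_drawing G W" "pt u"] arc_curve[OF u(2)]
          ends_in_im[OF u(2), of u] Suc u by (auto simp: arc_imp_path connected_path_image)
      then show ?thesis using ends_in_im[OF u(2), of z] by auto
    qed
  qed
  then show ?thesis using assms by (auto simp: W_def)
qed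

text \<open>If \<open>v\<close> has no neighbour in \<open>reach i\<close>, all triangles at
  \<open>v\<close> survive the peeling and their faces are cut off from the new outer face; it
  matters here that inner faces are triangles, so that the other vertices of a face at
  \<open>v\<close> are neighbours of \<open>v\<close>. Conversely, an edge from
  \<open>reach i\<close> to \<open>v\<close> runs through the new outer face up to
  \<open>v\<close>.\<close>

lemma outer_vertices_reach:
  assumes "i \<ge> 1"
  shows "outer_vertices G (V - reach i) = {v \<in> V - reach i. \<exists>u\<in>reach i. {u, v} \<in> E}"
proof -
  define W where "W = V - reach i"
  define DW where "DW = induced_drawing G W"
  have WV: "W \<subseteq> V" by (auto simp: W_def)
  have cDW: "closed DW" unfolding DW_def induced_drawing_def
    using compact_drawing[of "{e \<in> E. e \<subseteq> W}" W] WV compact_imp_closed by auto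
  then have op: "open (outside DW)" using open_outside by blast
  have "pt v \<in> frontier (outside DW) \<longleftrightarrow> (\<exists>u\<in>reach i. {u, v} \<in> E)" if v: "v \<in> W" for v
  proof
    assume fr: "pt v \<in> frontier (outside DW)"
    show "\<exists>u\<in>reach i. {u, v} \<in> E"
    proof (rule ccontr)
      assume no: "\<not> (\<exists>u\<in>reach i. {u, v} \<in> E)"
      have "pt v \<in> closure (outside DW)" using fr by (simp add: frontier_def)
      then obtain f where f: "f \<in> face_ids" "pt v \<in> closure (outside DW \<inter> face_region f)"
        using face_near[OF op] by blast
      then have "pt v \<in> closure (face_region f)" using closure_mono[of "outside DW \<inter> face_region f" "face_region f"] by auto
      then have vf: "v \<in> face_verts f" using closure_face_vertex f v WV by blast
      show False
      proof (cases f)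
        case None
        then show ?thesis using vf v C_sub_reach[OF assms] by (auto simp: W_def)
      next
        case (Some t)
        then have tT: "t \<in> Tri" using f by (auto simp: face_ids_def)
        obtain xs where xs: "length xs = 3" "is_cycle G xs" "set xs = t" using TriE[OF tT] by metis
        have "t \<subseteq> W"
        proof
          fix a assume a: "a \<in> t"
          show "a \<in> W"
          proof (cases "a = v")
            case False
            obtain p q r where "xs = [p, q, r]" using xs(1) by (auto simp: numeral_3_eq_3 length_Suc_conv)
            then have "{a, v} \<in> E" using xs(2,3) a vf Some False
              by (auto simp: is_cycle_def cycle_edges_three insert_commute)
            then have "a \<notin> reach i" using no by auto
            moreover have "a \<in> V" using a xs by (auto simp: is_cycle_def)
            ultimately show ?thesis by (simp add: W_def)
          qed (use v in simp)
        qed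
        then have "drawing G t {e \<in> E. e \<subseteq> t} \<subseteq> DW"
          unfolding DW_def induced_drawing_def by (intro drawing_mono) auto
        then have "outside DW \<subseteq> outside (drawing G t {e \<in> E. e \<subseteq> t})" by (rule outside_mono)
        then have "outside DW \<inter> face_region f = {}"
          using Some inside_Int_outside[of "drawing G t {e \<in> E. e \<subseteq> t}"] unfolding face_region.simps by fastforce
        then show ?thesis using f by simp
      qed
    qed
  next
    assume "\<exists>u\<in>reach i. {u, v} \<in> E"
    then obtain u where u: "u \<in> reach i" "{u, v} \<in> E" by auto
    have pu: "pt u \<in> outside DW" using reach_outside[OF assms order_refl u(1)] by (simp add: DW_def W_def)
    have "u \<notin> W" using u by (simp add: W_def)
    have oc: "open_curve {u, v} \<inter> DW = {}"
    proof (rule ccontr)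
      assume "open_curve {u, v} \<inter> DW \<noteq> {}"
      then obtain p where p: "p \<in> open_curve {u, v}" "p \<in> DW" by auto
      then have "p \<in> im {u, v}" by (simp add: open_curve_def)
      then obtain a where "a \<in> {u, v}" "p = pt a"
        using im_Int_induced[OF u(2) WV] p \<open>u \<notin> W\<close> unfolding DW_def by blast
      then show False using p unfolding open_curve_def by auto
    qed
    have "outside DW \<inter> open_curve {u, v} \<noteq> {}"
      using im_subset_closure_open_curve[OF u(2)] ends_in_im[OF u(2), of u] pu op
        open_Int_closure_eq_empty[OF op, of "open_curve {u, v}"] by blast
    then obtain x where "x \<in> open_curve {u, v}" "x \<in> outside DW" by auto
    then have "open_curve {u, v} \<subseteq> outside DW"
      using subset_outsideI[OF connected_open_curve[OF u(2)] oc] by blast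
    then have "pt v \<in> closure (outside DW)"
      using closure_mono im_subset_closure_open_curve[OF u(2)] ends_in_im[OF u(2), of v] by blast
    moreover have "pt v \<in> DW" using v by (auto simp: DW_def induced_drawing_def drawing_def)
    then have "pt v \<notin> outside DW" using outside_no_overlap by blast
    ultimately show "pt v \<in> frontier (outside DW)" using op by (simp add: frontier_def interior_open)
  qed
  then show ?thesis unfolding outer_vertices_def outer_face_def DW_def[symmetric] W_def[symmetric] by blast
qed

lemma outer_vertices_V: "outer_vertices G V = set C"
proof -
  have fr: "frontier (outer_face G V) = cycle_trace C"
    using outer by (simp add: bounded_by_cycle_def cycle_trace_def)
  have CV: "set C \<subseteq> V" "cycle_edges C \<subseteq> E" "\<Union>(cycle_edges C) \<subseteq> set C"
    using is_cycle_C cycle_edges_subset by (auto simp: is_cycle_def)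
  have "pt v \<in> cycle_trace C \<longleftrightarrow> v \<in> set C" if "v \<in> V" for v
    using vertex_in_drawing[OF that CV] by (auto simp: cycle_trace_def drawing_def)
  then show ?thesis using CV by (auto simp: outer_vertices_def fr)
qed

lemma peel_reach: "peel G i = V - reach i"
proof (induction i)
  case (Suc i)
  show ?case
  proof (cases "i = 0")
    case True then show ?thesis using outer_vertices_V by simp
  next
    case False
    then show ?thesis using Suc outer_vertices_reach[of i] by auto
  qed
qed simp

lemma layer_reach: "layer G (Suc i) = reach (Suc i) - reach i"
proof (cases "i = 0")
  case True then show ?thesis using outer_vertices_V by (simp add: layer_def)
next
  case False
  then show ?thesis using peel_reach[of i] outer_vertices_reach[of i] by (auto simp: layer_def)
qed

lemma reach_step: "i \<ge> 1 \<Longrightarrow> u \<in> reach i \<Longrightarrow> {u, v} \<in> E \<Longrightarrow> v \<in> reach (Suc i)"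
  using edge_sub by auto

definition lev :: "'a \<Rightarrow> nat" where
  "lev v = (LEAST i. v \<in> reach i)"

text \<open>The value of \<open>LEAST\<close> is unspecified for a vertex that no
  \<open>reach\<close> contains, so membership in \<open>reach m\<close> is recorded along with the
  value of \<open>lev\<close>.\<close>

lemma lev_eq: "v \<in> layer G m \<longleftrightarrow> m \<ge> 1 \<and> v \<in> reach m \<and> lev v = m"
proof (cases m)
  case 0 then show ?thesis by (simp add: layer_def)
next
  case (Suc k)
  have "v \<in> reach m - reach k \<longleftrightarrow> v \<in> reach m \<and> lev v = m"
  proof
    assume h: "v \<in> reach m - reach k"
    have "lev v = m" unfolding lev_def
    proof (rule Least_equality)
      fix j assume "v \<in> reach j"
      then show "m \<le> j" using h reach_mono[of j k] Suc by (metis Diff_iff not_less_eq_eq subsetD)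
    qed (use h in simp)
    then show "v \<in> reach m \<and> lev v = m" using h by simp
  next
    assume h: "v \<in> reach m \<and> lev v = m"
    then have "v \<notin> reach k" using Suc not_less_Least[of k "\<lambda>i. v \<in> reach i"] by (simp add: lev_def)
    then show "v \<in> reach m - reach k" using h by simp
  qed
  then show ?thesis using layer_reach[of k] Suc by auto
qed

lemma lev_facts:
  assumes "at_most_layers G r"
  shows "v \<in> V \<Longrightarrow> v \<in> layer G m \<longleftrightarrow> lev v = m"
    and "v \<in> V \<Longrightarrow> 1 \<le> lev v \<and> lev v \<le> r"
    and "v \<in> V \<Longrightarrow> lev v = 1 \<longleftrightarrow> v \<in> set C"
    and "{u, v} \<in> E \<Longrightarrow> lev v \<le> Suc (lev u)"
    and "v \<in> V \<Longrightarrow> lev v \<ge> 2 \<Longrightarrow> \<exists>u. {u, v} \<in> E \<and> Suc (lev u) = lev v"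
proof -
  have ex: "\<exists>m\<in>{1..r}. v \<in> layer G m" if "v \<in> V" for v
    using assms that unfolding at_most_layers_def by blast
  show bnd: "1 \<le> lev v \<and> lev v \<le> r" if "v \<in> V" for v
    using ex[OF that] lev_eq by auto
  have inr: "v \<in> reach (lev v)" if "v \<in> V" for v
    using ex[OF that] lev_eq by metis
  show lay: "v \<in> layer G m \<longleftrightarrow> lev v = m" if "v \<in> V" for v m
    using lev_eq[of v m] inr[OF that] bnd[OF that] by auto
  show "lev v = 1 \<longleftrightarrow> v \<in> set C" if "v \<in> V" for v
    using lay[OF that, of 1] layer_reach[of 0] by simp
  have le: "lev v \<le> i" if "v \<in> reach i" for v i
    using that by (simp add: lev_def Least_le)
  show "lev v \<le> Suc (lev u)" if "{u, v} \<in> E" for u v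
  proof -
    have "u \<in> V" using edge_sub[OF that] by auto
    then have "v \<in> reach (Suc (lev u))" using reach_step[OF _ inr that] bnd by blast
    then show ?thesis using le by blast
  qed
  then have ed: "lev v \<le> Suc (lev u)" if "{u, v} \<in> E" for u v using that by blast
  show "\<exists>u. {u, v} \<in> E \<and> Suc (lev u) = lev v" if h: "v \<in> V" "lev v \<ge> 2" for v
  proof -
    obtain k where k: "lev v = Suc k" "k \<ge> 1" using h(2) by (cases "lev v") auto
    have "v \<in> reach (Suc k)" using inr[OF h(1)] k by simp
    moreover have "v \<notin> reach k" using le[of v k] k by auto
    ultimately obtain u where u: "u \<in> reach k" "{u, v} \<in> E" using k by auto
    have "lev u \<le> k" using le[OF u(1)] .
    then show ?thesis using u(2) ed[OF u(2)] k by (intro exI[of _ u]) auto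
  qed
qed

end

section \<open>Breadth-first trees in a triangulated disk\<close>

text \<open>What remains of the drawing once the topology is done. Planarity survives in the numbers
  of triangles at edges, in the connectedness expressed by \<open>boundary_empty\<close>, and in the
  Jordan curve theorem expressed by \<open>cycle_boundary\<close>: its second clause says that
  triangles are separated only at edges and vertices of the cycle, its third singles out the inner
  side. The layers survive as a distance from the outer cycle, shifted by one.\<close>

locale leveled_disk =
  fixes V :: "'a set" and E Tri :: "'a set set" and C :: "'a list" and lev :: "'a \<Rightarrow> nat" and r :: nat
  assumes finite_V: "finite V"
    and edge_ends: "e \<in> E \<Longrightarrow> \<exists>u\<in>V. \<exists>v\<in>V. u \<noteq> v \<and> e = {u, v}"
    and C_cycle: "length C \<ge> 3" "distinct C" "set C \<subseteq> V" "cycle_edges C \<subseteq> E"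
    and Tri_form: "t \<in> Tri \<Longrightarrow> \<exists>a b c. t = {a, b, c} \<and> a \<noteq> b \<and> b \<noteq> c \<and> a \<noteq> c \<and>
        {a, b} \<in> E \<and> {b, c} \<in> E \<and> {a, c} \<in> E"
    and inner_two: "e \<in> E - cycle_edges C \<Longrightarrow> card {t \<in> Tri. e \<subseteq> t} = 2"
    and outer_one: "e \<in> cycle_edges C \<Longrightarrow> card {t \<in> Tri. e \<subseteq> t} = 1"
    and vertex_Tri: "v \<in> V \<Longrightarrow> \<exists>t\<in>Tri. v \<in> t"
    and boundary_empty: "X \<subseteq> Tri \<Longrightarrow> boundary (E - cycle_edges C) Tri X = {} \<Longrightarrow> X = {} \<or> X = Tri"
    and cycle_boundary: "length xs \<ge> 3 \<Longrightarrow> distinct xs \<Longrightarrow> set xs \<subseteq> V \<Longrightarrow> cycle_edges xs \<subseteq> E \<Longrightarrow>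
        \<exists>X\<subseteq>Tri. boundary (E - cycle_edges C) Tri X = cycle_edges xs - cycle_edges C \<and>
          (\<forall>v\<in>V - set xs. \<forall>t\<in>Tri. \<forall>t'\<in>Tri. v \<in> t \<longrightarrow> v \<in> t' \<longrightarrow> t \<in> X \<longrightarrow> t' \<in> X) \<and>
          (\<forall>e\<in>cycle_edges C. \<forall>t\<in>Tri. e \<subseteq> t \<longrightarrow> t \<in> X \<longleftrightarrow> e \<in> cycle_edges xs)"
    and lev_bounds: "v \<in> V \<Longrightarrow> 1 \<le> lev v \<and> lev v \<le> r"
    and lev_one: "v \<in> V \<Longrightarrow> lev v = 1 \<longleftrightarrow> v \<in> set C"
    and lev_edge: "{u, v} \<in> E \<Longrightarrow> lev v \<le> Suc (lev u)"
    and lev_parent: "v \<in> V \<Longrightarrow> lev v \<ge> 2 \<Longrightarrow> \<exists>u. {u, v} \<in> E \<and> Suc (lev u) = lev v"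
begin

abbreviation outer_edges :: "'a set set" where "outer_edges \<equiv> cycle_edges C"
abbreviation inner_edges :: "'a set set" where "inner_edges \<equiv> E - cycle_edges C"
abbreviation bd :: "'a set set \<Rightarrow> 'a set set" where "bd \<equiv> boundary (E - cycle_edges C) Tri"

lemma edge_in_V: "{u, v} \<in> E \<Longrightarrow> u \<in> V \<and> v \<in> V \<and> u \<noteq> v"
  using edge_ends[of "{u, v}"] by (auto simp: doubleton_eq_iff)

lemma edge_sub_V: "e \<in> E \<Longrightarrow> e \<subseteq> V"
  using edge_ends[of e] by auto

lemma finite_E: "finite E"
  by (rule finite_subset[of _ "Pow V"]) (use finite_V edge_sub_V in auto)

lemma Tri_sub_V: "t \<in> Tri \<Longrightarrow> t \<subseteq> V"
  using Tri_form edge_in_V by blast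

lemma finite_Tri: "finite Tri"
  by (rule finite_subset[of _ "Pow V"]) (use finite_V Tri_sub_V in auto)

lemma edge_Tri: "e \<in> E \<Longrightarrow> \<exists>t\<in>Tri. e \<subseteq> t"
proof -
  assume "e \<in> E"
  then have "card {t \<in> Tri. e \<subseteq> t} \<noteq> 0" using inner_two[of e] outer_one[of e] by (cases "e \<in> outer_edges") auto
  then have "{t \<in> Tri. e \<subseteq> t} \<noteq> {}" by (metis card.empty)
  then show ?thesis by auto
qed

lemma outer_unique: "e \<in> outer_edges \<Longrightarrow> t \<in> Tri \<Longrightarrow> t' \<in> Tri \<Longrightarrow> e \<subseteq> t \<Longrightarrow> e \<subseteq> t' \<Longrightarrow> t = t'"
  using outer_one[of e] by (metis (mono_tags, lifting) card_1_singletonE mem_Collect_eq singletonD)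

text \<open>The last clause turns membership in a boundary into a parity over two triangles, so that
  boundary identities can be checked edge by edge.\<close>

lemma inner_pair:
  assumes "e \<in> inner_edges"
  obtains t1 t2 where "t1 \<noteq> t2" "t1 \<in> Tri" "t2 \<in> Tri" "e \<subseteq> t1" "e \<subseteq> t2"
    "\<And>t. t \<in> Tri \<Longrightarrow> e \<subseteq> t \<Longrightarrow> t = t1 \<or> t = t2"
    "\<And>X. X \<subseteq> Tri \<Longrightarrow> e \<in> bd X \<longleftrightarrow> (t1 \<in> X \<longleftrightarrow> t2 \<notin> X)"
proof -
  obtain t1 t2 where t: "{t \<in> Tri. e \<subseteq> t} = {t1, t2}" "t1 \<noteq> t2"
    using inner_two[OF assms] by (auto simp: card_2_iff)
  then have *: "t1 \<in> Tri" "t2 \<in> Tri" "e \<subseteq> t1" "e \<subseteq> t2" "\<And>t. t \<in> Tri \<Longrightarrow> e \<subseteq> t \<Longrightarrow> t = t1 \<or> t = t2"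
    by blast+
  have **: "e \<in> bd X \<longleftrightarrow> (t1 \<in> X \<longleftrightarrow> t2 \<notin> X)" if "X \<subseteq> Tri" for X
  proof
    assume "e \<in> bd X"
    then obtain s s' where "s \<in> X" "e \<subseteq> s" "s' \<in> Tri - X" "e \<subseteq> s'" unfolding boundary_def by blast
    then show "t1 \<in> X \<longleftrightarrow> t2 \<notin> X" using *(5)[of s] *(5)[of s'] that by blast
  next
    assume "t1 \<in> X \<longleftrightarrow> t2 \<notin> X"
    then show "e \<in> bd X" using * assms unfolding boundary_def by blast
  qed
  show ?thesis by (rule that[OF t(2) *(1,2,3,4) *(5) **])
qed

lemma bd_inner_edges: "bd X \<subseteq> inner_edges" by (auto simp: boundary_def)

text \<open>The boundary is linear over the field with two elements.\<close>

lemma bd_sym_diff: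
  assumes "X \<subseteq> Tri" "Y \<subseteq> Tri"
  shows "bd (sym_diff X Y) = sym_diff (bd X) (bd Y)"
proof -
  have "e \<in> bd (sym_diff X Y) \<longleftrightarrow> e \<in> sym_diff (bd X) (bd Y)" if "e \<in> inner_edges" for e
  proof -
    from that obtain t1 t2 where t: "\<And>X. X \<subseteq> Tri \<Longrightarrow> e \<in> bd X \<longleftrightarrow> (t1 \<in> X \<longleftrightarrow> t2 \<notin> X)"
      by (rule inner_pair) blast
    have "sym_diff X Y \<subseteq> Tri" using assms by blast
    then show ?thesis using t[of X] t[of Y] t[of "sym_diff X Y"] assms by blast
  qed
  then show ?thesis using bd_inner_edges by blast
qed

lemma bd_compl: "X \<subseteq> Tri \<Longrightarrow> bd (Tri - X) = bd X"
  unfolding boundary_def by blast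

text \<open>Double counting of pairs of an edge at \<open>v\<close> and a triangle of
  \<open>X\<close> containing it: each triangle at \<open>v\<close> contributes two edges, and the
  number of triangles at an edge is odd exactly for boundary edges. At a vertex of \<open>C\<close>
  the parity may fail, since outer edges never count as boundary; this is how a path can be a
  boundary.\<close>

lemma bd_parity:
  assumes "X \<subseteq> Tri" "v \<in> V" "v \<notin> set C"
  shows "even (card {e \<in> bd X. v \<in> e})"
proof -
  define Ev where "Ev = {e \<in> E. v \<in> e}"
  define Xv where "Xv = {t \<in> X. v \<in> t}"
  have fin: "finite Ev" "finite Xv" "finite X"
    using finite_E finite_subset[OF assms(1) finite_Tri] by (auto simp: Ev_def Xv_def)
  have EvI: "e \<in> inner_edges" if "e \<in> Ev" for e
    using that assms(3) cycle_edges_subset unfolding Ev_def by blast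
  have two: "card {e \<in> Ev. e \<subseteq> t} = 2" if "t \<in> Xv" for t
  proof -
    have tT: "t \<in> Tri" "v \<in> t" using that assms by (auto simp: Xv_def)
    then obtain a b where ab: "t = {v, a, b}" "a \<noteq> b" "v \<noteq> a" "v \<noteq> b" "{v, a} \<in> E" "{v, b} \<in> E"
    proof -
      obtain p q s where pqs: "t = {p, q, s}" "p \<noteq> q" "q \<noteq> s" "p \<noteq> s" "{p, q} \<in> E" "{q, s} \<in> E" "{p, s} \<in> E"
        using Tri_form[OF tT(1)] by metis
      consider "v = p" | "v = q" | "v = s" using tT(2) pqs(1) by blast
      then show ?thesis
      proof cases
        case 1 then show ?thesis using that[of q s] pqs by auto
      next
        case 2 then show ?thesis using that[of p s] pqs by (auto simp: insert_commute)
      next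
        case 3 then show ?thesis using that[of p q] pqs by (auto simp: insert_commute)
      qed
    qed
    have "{e \<in> Ev. e \<subseteq> t} = {{v, a}, {v, b}}"
    proof
      show "{e \<in> Ev. e \<subseteq> t} \<subseteq> {{v, a}, {v, b}}"
      proof
        fix e assume e: "e \<in> {e \<in> Ev. e \<subseteq> t}"
        then obtain x y where "x \<noteq> y" "e = {x, y}" using edge_ends[of e] by (auto simp: Ev_def)
        then show "e \<in> {{v, a}, {v, b}}" using e ab(1) by (auto simp: Ev_def)
      qed
    qed (use ab in \<open>auto simp: Ev_def\<close>)
    then show ?thesis using ab by (simp add: doubleton_eq_iff)
  qed
  have "(\<Sum>e\<in>Ev. card {t \<in> Xv. e \<subseteq> t}) = (\<Sum>t\<in>Xv. card {e \<in> Ev. e \<subseteq> t})"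
  proof -
    have "(\<Sum>e\<in>Ev. card {t \<in> Xv. e \<subseteq> t}) = (\<Sum>e\<in>Ev. \<Sum>t\<in>Xv. if e \<subseteq> t then 1 else 0)"
      using fin by (intro sum.cong) (auto simp: sum.If_cases Int_def)
    also have "\<dots> = (\<Sum>t\<in>Xv. \<Sum>e\<in>Ev. if e \<subseteq> t then 1 else 0)" by (rule sum.swap)
    also have "\<dots> = (\<Sum>t\<in>Xv. card {e \<in> Ev. e \<subseteq> t})"
      using fin by (intro sum.cong) (auto simp: sum.If_cases Int_def)
    finally show ?thesis .
  qed
  also have "\<dots> = 2 * card Xv" using two by simp
  finally have ev: "even (\<Sum>e\<in>Ev. card {t \<in> Xv. e \<subseteq> t})" by simp
  have odd: "odd (card {t \<in> Xv. e \<subseteq> t}) \<longleftrightarrow> e \<in> bd X" if e: "e \<in> Ev" for e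
  proof -
    obtain t1 t2 where t: "t1 \<noteq> t2" "t1 \<in> Tri" "t2 \<in> Tri" "e \<subseteq> t1" "e \<subseteq> t2"
      "\<And>t. t \<in> Tri \<Longrightarrow> e \<subseteq> t \<Longrightarrow> t = t1 \<or> t = t2"
      "\<And>X. X \<subseteq> Tri \<Longrightarrow> e \<in> bd X \<longleftrightarrow> (t1 \<in> X \<longleftrightarrow> t2 \<notin> X)"
      by (rule inner_pair[OF EvI[OF e]]) blast
    have "v \<in> e" using e by (simp add: Ev_def)
    then have eq: "{t \<in> Xv. e \<subseteq> t} = {t1, t2} \<inter> X" using t(2-6) assms(1) unfolding Xv_def by blast
    show ?thesis using t(1) t(7)[OF assms(1)] unfolding eq
      by (cases "t1 \<in> X"; cases "t2 \<in> X") auto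
  qed
  have "{e \<in> bd X. v \<in> e} = {e \<in> Ev. odd (card {t \<in> Xv. e \<subseteq> t})}"
    using odd bd_inner_edges[of X] unfolding Ev_def by blast
  then show ?thesis using ev even_sum_iff[OF fin(1), of "\<lambda>e. card {t \<in> Xv. e \<subseteq> t}"] by simp
qed

section \<open>Legs in the breadth-first forest\<close>

definition parent :: "'a \<Rightarrow> 'a" where
  "parent v = (SOME u. {u, v} \<in> E \<and> Suc (lev u) = lev v)"

lemma parent:
  assumes "v \<in> V" "lev v \<ge> 2"
  shows "{parent v, v} \<in> E" "Suc (lev (parent v)) = lev v" "parent v \<in> V"
proof -
  show *: "{parent v, v} \<in> E" "Suc (lev (parent v)) = lev v"
    using someI_ex[OF lev_parent[OF assms]] by (auto simp: parent_def)
  show "parent v \<in> V" using edge_in_V[OF *(1)] by blast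
qed

definition tree_edges :: "'a set set" where
  "tree_edges = {{parent v, v} | v. v \<in> V \<and> lev v \<ge> 2}"

text \<open>
  A vertex of a forest that is deepest among the lower ends of boundary edges meets exactly one of them,
  contradicting parity.
\<close>

lemma bd_in_tree_edges:
  assumes "X \<subseteq> Tri" "bd X \<subseteq> tree_edges"
  shows "X = {} \<or> X = Tri"
proof -
  have "bd X = {}"
  proof (rule ccontr)
    assume ne: "bd X \<noteq> {}"
    define Z where "Z = {z \<in> V. lev z \<ge> 2 \<and> {parent z, z} \<in> bd X}"
    have "finite Z" "Z \<noteq> {}" using finite_V ne assms(2) by (auto simp: Z_def tree_edges_def)
    then obtain z where z: "z \<in> Z" "\<And>y. y \<in> Z \<Longrightarrow> lev y \<le> lev z"
    proof -
      have "Max (lev ` Z) \<in> lev ` Z" using \<open>finite Z\<close> \<open>Z \<noteq> {}\<close> by simp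
      then obtain z where "z \<in> Z" "lev z = Max (lev ` Z)" by auto
      moreover have "lev y \<le> Max (lev ` Z)" if "y \<in> Z" for y using that \<open>finite Z\<close> by simp
      ultimately show ?thesis using that by metis
    qed
    then have zV: "z \<in> V" "lev z \<ge> 2" "{parent z, z} \<in> bd X" by (auto simp: Z_def)
    have "z \<notin> set C" using lev_one zV by fastforce
    moreover have "{e \<in> bd X. z \<in> e} = {{parent z, z}}"
    proof -
      have "e = {parent z, z}" if e: "e \<in> bd X" "z \<in> e" for e
      proof -
        obtain y where y: "y \<in> V" "lev y \<ge> 2" "e = {parent y, y}" using e assms(2) by (auto simp: tree_edges_def)
        then have "y \<in> Z" using e by (simp add: Z_def)
        then have "lev y \<le> lev z" using z by blast
        then have "z \<noteq> parent y" using parent(2)[OF y(1,2)] by auto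
        then show ?thesis using e y by auto
      qed
      then show ?thesis using zV by blast
    qed
    ultimately show False using bd_parity[OF assms(1) zV(1)] by simp
  qed
  then show ?thesis using boundary_empty assms by blast
qed

lemma tree_edges_inner: "tree_edges \<subseteq> inner_edges"
proof
  fix e assume "e \<in> tree_edges"
  then obtain v where v: "v \<in> V" "lev v \<ge> 2" "e = {parent v, v}" by (auto simp: tree_edges_def)
  have "v \<notin> set C" using lev_one[OF v(1)] v(2) by auto
  then show "e \<in> inner_edges" using parent[OF v(1,2)] v(3) cycle_edges_subset by blast
qed

text \<open>The ancestor of \<open>v\<close> on level \<open>l\<close>. Indexing by level and not by
  the distance from \<open>v\<close> lets two legs be compared level by level. For \<open>l\<close>
  above \<open>lev v\<close> the truncated subtraction gives \<open>v\<close> itself, and level 0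
  lies beyond the root; this is why facts about legs restrict \<open>l\<close> to the range from 1
  to \<open>lev v\<close>.\<close>

definition leg :: "'a \<Rightarrow> nat \<Rightarrow> 'a" where
  "leg v l = (parent ^^ (lev v - l)) v"

lemma leg_self: "leg v (lev v) = v" by (simp add: leg_def)

lemma leg_step:
  assumes "l < lev v"
  shows "leg v l = parent (leg v (Suc l))"
proof -
  have "lev v - l = Suc (lev v - Suc l)" using assms by simp
  then show ?thesis by (simp add: leg_def)
qed

lemma leg:
  assumes "v \<in> V" "1 \<le> l" "l \<le> lev v"
  shows "leg v l \<in> V \<and> lev (leg v l) = l"
  using assms(3,2)
proof (induction l rule: inc_induct)
  case base then show ?case using assms by (simp add: leg_self)
next
  case (step l)
  then have *: "leg v (Suc l) \<in> V" "lev (leg v (Suc l)) = Suc l" by auto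
  then have "Suc (lev (parent (leg v (Suc l)))) = Suc l" "parent (leg v (Suc l)) \<in> V"
    using parent[of "leg v (Suc l)"] step by auto
  then show ?case using leg_step[of l v] step by simp
qed

lemma leg_edge:
  assumes "v \<in> V" "1 \<le> l" "l < lev v"
  shows "{leg v l, leg v (Suc l)} \<in> tree_edges"
  using leg[OF assms(1), of "Suc l"] leg_step[OF assms(3)] assms unfolding tree_edges_def by auto

lemma leg_leg:
  assumes "v \<in> V" "1 \<le> k" "k \<le> l" "l \<le> lev v"
  shows "leg (leg v l) k = leg v k"
proof -
  have lv: "lev (leg v l) = l" using leg[OF assms(1), of l] assms by simp
  have "(parent ^^ (l - k)) ((parent ^^ (lev v - l)) v) = (parent ^^ (lev v - k)) v"
    using assms by (simp flip: funpow_add comp_apply[of "parent ^^ (l - k)"] add: comp_def[symmetric])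
  then show ?thesis using lv by (simp add: leg_def)
qed

definition agree :: "'a \<Rightarrow> 'a \<Rightarrow> nat \<Rightarrow> bool" where
  "agree u v l \<longleftrightarrow> 1 \<le> l \<and> l \<le> lev u \<and> l \<le> lev v \<and> leg u l = leg v l"

text \<open>
  The level at which the legs of two vertices join, and \<open>0\<close> if they never do.
\<close>

definition join_level :: "'a \<Rightarrow> 'a \<Rightarrow> nat" where
  "join_level u v = card {l. agree u v l}"

text \<open>Legs that agree on a level agree on all smaller ones, because parents are unique. So the
  common levels form an initial segment of the positive numbers, and counting them yields the last
  one.\<close>

lemma agree_iff:
  assumes "u \<in> V" "v \<in> V"
  shows "agree u v l \<longleftrightarrow> 1 \<le> l \<and> l \<le> join_level u v"
proof -
  define A where "A = {l. agree u v l}"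
  have fin: "finite A" by (rule finite_subset[of _ "{..lev u}"]) (auto simp: A_def agree_def)
  have dc: "k \<in> A" if "l \<in> A" "1 \<le> k" "k \<le> l" for k l
    using that leg_leg[OF assms(1), of k l] leg_leg[OF assms(2), of k l] by (auto simp: A_def agree_def)
  have "A = {1..card A}"
  proof (cases "A = {}")
    case False
    have "A = {1..Max A}"
    proof
      show "A \<subseteq> {1..Max A}" using fin by (auto simp: A_def agree_def)
      show "{1..Max A} \<subseteq> A" using dc[OF Max_in[OF fin False]] by auto
    qed
    then show ?thesis by (metis card_atLeastAtMost diff_Suc_1)
  qed simp
  then show ?thesis unfolding join_level_def A_def[symmetric] by (metis A_def atLeastAtMost_iff mem_Collect_eq)
qed

lemma join_level_le: "u \<in> V \<Longrightarrow> v \<in> V \<Longrightarrow> join_level u v \<le> lev u \<and> join_level u v \<le> lev v"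
  using agree_iff[of u v "join_level u v"] by (cases "join_level u v = 0") (auto simp: agree_def)

lemma join_level_leg: "u \<in> V \<Longrightarrow> v \<in> V \<Longrightarrow> 1 \<le> l \<Longrightarrow> l \<le> join_level u v \<Longrightarrow> leg u l = leg v l"
  using agree_iff[of u v l] by (auto simp: agree_def)

lemma join_level_sep: "u \<in> V \<Longrightarrow> v \<in> V \<Longrightarrow> join_level u v < l \<Longrightarrow> l \<le> lev u \<Longrightarrow> l \<le> lev v \<Longrightarrow> leg u l \<noteq> leg v l"
  using agree_iff[of u v l] by (auto simp: agree_def)

lemma join_level_commute: "join_level u v = join_level v u"
proof -
  have "agree u v = agree v u" by (auto simp: agree_def fun_eq_iff)
  then show ?thesis by (simp add: join_level_def)
qed

text \<open>Otherwise one end would be an ancestor of the other, and since levels of adjacent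
  vertices differ by at most one, it would be the parent.\<close>

lemma join_level_less:
  assumes "{u, v} \<in> E" "{u, v} \<notin> tree_edges"
  shows "join_level u v < lev u" "join_level u v < lev v"
proof -
  have *: "join_level u v < lev u" if "{u, v} \<in> E" "{u, v} \<notin> tree_edges" for u v
  proof (rule ccontr)
    assume "\<not> join_level u v < lev u"
    have V: "u \<in> V" "v \<in> V" "u \<noteq> v" using edge_in_V[OF that(1)] by auto
    have l1: "1 \<le> lev u" using lev_bounds[OF V(1)] by blast
    have eq: "join_level u v = lev u" "lev u \<le> lev v" using join_level_le[OF V(1,2)] \<open>\<not> join_level u v < lev u\<close> by auto
    then have uv: "u = leg v (lev u)" using join_level_leg[OF V(1,2) l1] leg_self[of u] by simp
    have "lev v \<noteq> lev u" using uv leg_self[of v] V(3) by metis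
    then have lv: "lev v = Suc (lev u)" using lev_edge[OF that(1)] eq by auto
    then have "u = parent v" using uv leg_step[of "lev u" v] leg_self[of v] by simp
    then have "{u, v} \<in> tree_edges" using V lv l1 by (auto simp: tree_edges_def)
    then show False using that by blast
  qed
  show "join_level u v < lev u" using *[OF assms] .
  show "join_level u v < lev v" using *[of v u] assms by (simp add: insert_commute join_level_commute)
qed

text \<open>Listed from \<open>leg u a\<close> to \<open>u\<close>, across the edge, and from
  \<open>v\<close> back to \<open>leg v b\<close>. Separate start levels let the same list describe
  paths between outer vertices, cycles through a join, which must contain the join only once, and
  cycles closed by a chord.\<close>

definition leg_path :: "'a \<Rightarrow> 'a \<Rightarrow> nat \<Rightarrow> nat \<Rightarrow> 'a list" where
  "leg_path u v a b = map (leg u) [a..<Suc (lev u)] @ rev (map (leg v) [b..<Suc (lev v)])"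

lemma set_leg_path: "set (leg_path u v a b) = leg u ` {a..lev u} \<union> leg v ` {b..lev v}"
  unfolding leg_path_def by (simp add: atLeastLessThanSuc_atLeastAtMost del: upt_Suc)

lemma length_leg_path: "length (leg_path u v a b) = (Suc (lev u) - a) + (Suc (lev v) - b)"
  by (simp add: leg_path_def del: upt_Suc)

lemma hd_leg_path: "a \<le> lev u \<Longrightarrow> hd (leg_path u v a b) = leg u a"
  by (simp add: leg_path_def hd_append hd_map hd_upt del: upt_Suc)

lemma last_leg_path: "b \<le> lev v \<Longrightarrow> last (leg_path u v a b) = leg v b"
  by (simp add: leg_path_def last_append last_rev hd_map del: upt_Suc)

lemma inj_leg: "v \<in> V \<Longrightarrow> 1 \<le> a \<Longrightarrow> inj_on (leg v) {a..lev v}"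
  by (rule inj_onI) (metis atLeastAtMost_iff leg order_trans)

lemma distinct_leg_path:
  assumes "u \<in> V" "v \<in> V" "1 \<le> a" "1 \<le> b"
    and "\<And>l. a \<le> l \<Longrightarrow> b \<le> l \<Longrightarrow> l \<le> lev u \<Longrightarrow> l \<le> lev v \<Longrightarrow> leg u l \<noteq> leg v l"
  shows "distinct (leg_path u v a b)"
proof -
  have "leg u ` {a..lev u} \<inter> leg v ` {b..lev v} = {}"
  proof (rule ccontr)
    assume "leg u ` {a..lev u} \<inter> leg v ` {b..lev v} \<noteq> {}"
    then obtain l k where lk: "a \<le> l" "l \<le> lev u" "b \<le> k" "k \<le> lev v" "leg u l = leg v k" by auto
    then have "l = k" using leg[OF assms(1), of l] leg[OF assms(2), of k] assms(3,4) by auto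
    then show False using assms(5) lk by blast
  qed
  then show ?thesis using inj_leg[OF assms(1,3)] inj_leg[OF assms(2,4)]
    unfolding leg_path_def by (simp add: distinct_map atLeastLessThanSuc_atLeastAtMost del: upt_Suc)
qed

lemma walk_leg_path:
  assumes "a \<le> lev u" "b \<le> lev v"
  shows "walk_edges (leg_path u v a b) = insert {u, v} ({{leg u l, leg u (Suc l)} | l. a \<le> l \<and> l < lev u} \<union>
     {{leg v l, leg v (Suc l)} | l. b \<le> l \<and> l < lev v})"
proof -
  have "map (leg u) [a..<Suc (lev u)] \<noteq> []" "rev (map (leg v) [b..<Suc (lev v)]) \<noteq> []" using assms by auto
  moreover have "last (map (leg u) [a..<Suc (lev u)]) = u" using assms by (simp add: leg_self)
  moreover have "hd (rev (map (leg v) [b..<Suc (lev v)])) = v" using assms by (simp add: leg_self)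
  ultimately have "walk_edges (leg_path u v a b) = insert {u, v} (walk_edges (map (leg u) [a..<Suc (lev u)]) \<union>
      walk_edges (map (leg v) [b..<Suc (lev v)]))"
    unfolding leg_path_def using walk_edges_append[of "map (leg u) [a..<Suc (lev u)]" "rev (map (leg v) [b..<Suc (lev v)])"]
    by (simp only: walk_edges_rev not_False_eq_True simp_thms)
  then show ?thesis
    by (simp only: walk_edges_map_upt[OF assms(1)] walk_edges_map_upt[OF assms(2)])
qed

lemma walk_leg_path_sub:
  assumes "u \<in> V" "v \<in> V" "1 \<le> a" "1 \<le> b" "a \<le> lev u" "b \<le> lev v"
  shows "{u, v} \<in> walk_edges (leg_path u v a b)" "walk_edges (leg_path u v a b) \<subseteq> insert {u, v} tree_edges"
  using walk_leg_path[OF assms(5,6)] leg_edge[OF assms(1)] leg_edge[OF assms(2)] assms(3,4) by auto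

section \<open>Regions of non-tree edges\<close>

definition nontree_bd :: "'a set set \<Rightarrow> 'a set set" where
  "nontree_bd X = bd X - tree_edges"

lemma nontree_bd_sym_diff: "X \<subseteq> Tri \<Longrightarrow> Y \<subseteq> Tri \<Longrightarrow> nontree_bd (sym_diff X Y) = sym_diff (nontree_bd X) (nontree_bd Y)"
  unfolding nontree_bd_def using bd_sym_diff by blast

lemma nontree_bd_compl: "X \<subseteq> Tri \<Longrightarrow> nontree_bd (Tri - X) = nontree_bd X"
  unfolding nontree_bd_def using bd_compl by blast

lemma nontree_bd_empty: "X \<subseteq> Tri \<Longrightarrow> nontree_bd X = {} \<Longrightarrow> X = {} \<or> X = Tri"
  unfolding nontree_bd_def using bd_in_tree_edges by blast

text \<open>The symmetric difference has its whole boundary in the forest and is therefore trivial.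
  All identifications of regions rest on this.\<close>

lemma nontree_bd_eq:
  assumes "X \<subseteq> Tri" "Y \<subseteq> Tri" "nontree_bd X = nontree_bd Y"
  shows "X = Y \<or> X = Tri - Y"
proof -
  have "sym_diff X Y \<subseteq> Tri" using assms by blast
  moreover have "nontree_bd (sym_diff X Y) = {}" using nontree_bd_sym_diff[OF assms(1,2)] assms(3) by simp
  ultimately have "sym_diff X Y = {} \<or> sym_diff X Y = Tri" using nontree_bd_empty by blast
  then show ?thesis using assms by blast
qed

lemma bd_vertices: "e \<in> bd X \<Longrightarrow> x \<in> e \<Longrightarrow> x \<in> \<Union>X \<inter> \<Union>(Tri - X)"
  unfolding boundary_def by blast

text \<open>A vertex whose cycle edges are all outer may have all its triangles on one side; the
  covering hypothesis excludes this. Every cycle vertex then lies on a boundary edge and so on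
  triangles of both sides.\<close>

lemma cycle_region:
  assumes "length xs \<ge> 3" "distinct xs" "set xs \<subseteq> V" "cycle_edges xs \<subseteq> E"
    and cov: "\<And>x. x \<in> set xs \<Longrightarrow> \<exists>e\<in>cycle_edges xs - outer_edges. x \<in> e"
  obtains X where "X \<subseteq> Tri" "bd X = cycle_edges xs - outer_edges" "\<Union>X \<inter> \<Union>(Tri - X) = set xs"
    "\<And>e t. e \<in> outer_edges \<Longrightarrow> t \<in> Tri \<Longrightarrow> e \<subseteq> t \<Longrightarrow> t \<in> X \<longleftrightarrow> e \<in> cycle_edges xs"
proof -
  obtain X where X: "X \<subseteq> Tri" "bd X = cycle_edges xs - outer_edges"
    "\<forall>v\<in>V - set xs. \<forall>t\<in>Tri. \<forall>t'\<in>Tri. v \<in> t \<longrightarrow> v \<in> t' \<longrightarrow> t \<in> X \<longrightarrow> t' \<in> X"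
    "\<forall>e\<in>outer_edges. \<forall>t\<in>Tri. e \<subseteq> t \<longrightarrow> t \<in> X \<longleftrightarrow> e \<in> cycle_edges xs"
    using cycle_boundary[OF assms(1-4)] by auto
  have "\<Union>X \<inter> \<Union>(Tri - X) = set xs"
  proof
    show "\<Union>X \<inter> \<Union>(Tri - X) \<subseteq> set xs"
    proof
      fix x assume "x \<in> \<Union>X \<inter> \<Union>(Tri - X)"
      then obtain t t' where t: "t \<in> X" "x \<in> t" "t' \<in> Tri" "t' \<notin> X" "x \<in> t'" by blast
      then have "x \<in> V" "t \<in> Tri" using Tri_sub_V X(1) by blast+
      then show "x \<in> set xs" using X(3) t by blast
    qed
    show "set xs \<subseteq> \<Union>X \<inter> \<Union>(Tri - X)"
    proof
      fix x assume "x \<in> set xs"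
      then obtain e where "e \<in> bd X" "x \<in> e" using cov X(2) by blast
      then show "x \<in> \<Union>X \<inter> \<Union>(Tri - X)" by (rule bd_vertices)
    qed
  qed
  then show ?thesis using that[OF X(1,2)] X(4) by blast
qed

text \<open>The Jordan curve theorem for a leg path closed by one further edge. That edge may be a
  tree edge, an outer edge or a proper chord, and only in the last case does it contribute to the
  non-tree boundary.\<close>

lemma leg_path_region:
  assumes uv: "{u, v} \<in> inner_edges" "{u, v} \<notin> tree_edges"
    and ab: "1 \<le> a" "a \<le> lev u" "1 \<le> b" "b \<le> lev v" "a \<noteq> lev u \<or> b \<noteq> lev v"
    and sep: "\<And>l. a \<le> l \<Longrightarrow> b \<le> l \<Longrightarrow> l \<le> lev u \<Longrightarrow> l \<le> lev v \<Longrightarrow> leg u l \<noteq> leg v l"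
    and clos: "{leg u a, leg v b} \<in> E"
  obtains X where "X \<subseteq> Tri" "nontree_bd X = insert {u, v} ({{leg u a, leg v b}} - outer_edges - tree_edges)"
    "\<Union>X \<inter> \<Union>(Tri - X) = set (leg_path u v a b)"
    "\<And>e t. e \<in> outer_edges \<Longrightarrow> t \<in> Tri \<Longrightarrow> e \<subseteq> t \<Longrightarrow> t \<in> X \<longleftrightarrow> e = {leg u a, leg v b}"
proof -
  define xs where "xs = leg_path u v a b"
  have V: "u \<in> V" "v \<in> V" using edge_in_V[of u v] uv(1) by simp_all
  have len: "length xs \<ge> 3" using ab by (auto simp: xs_def length_leg_path)
  have dist: "distinct xs" unfolding xs_def by (rule distinct_leg_path[OF V ab(1,3) sep])
  have sV: "set xs \<subseteq> V" using leg[OF V(1)] leg[OF V(2)] ab by (auto simp: xs_def set_leg_path)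
  have w: "{u, v} \<in> walk_edges xs" "walk_edges xs \<subseteq> insert {u, v} tree_edges"
    using walk_leg_path_sub[OF V ab(1,3,2,4)] by (auto simp: xs_def)
  then have wI: "walk_edges xs \<subseteq> inner_edges" using tree_edges_inner uv by blast
  have chord_edge: "cycle_edges xs = insert {leg u a, leg v b} (walk_edges xs)"
  proof -
    have "xs \<noteq> []" using len by auto
    then show ?thesis using cycle_edges_walk_edges[of xs] hd_leg_path[OF ab(2), of v b] last_leg_path[OF ab(4), of u a]
      by (simp add: xs_def insert_commute)
  qed
  have cE: "cycle_edges xs \<subseteq> E" unfolding chord_edge using wI clos by auto
  have cov: "\<exists>e\<in>cycle_edges xs - outer_edges. x \<in> e" if x: "x \<in> set xs" for x
  proof -
    obtain e where "e \<in> walk_edges xs" "x \<in> e" using walk_edges_cover[of xs x] len x by auto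
    then show ?thesis using wI chord_edge by blast
  qed
  obtain X where X: "X \<subseteq> Tri" "bd X = cycle_edges xs - outer_edges" "\<Union>X \<inter> \<Union>(Tri - X) = set xs"
    "\<And>e t. e \<in> outer_edges \<Longrightarrow> t \<in> Tri \<Longrightarrow> e \<subseteq> t \<Longrightarrow> t \<in> X \<longleftrightarrow> e \<in> cycle_edges xs"
    by (rule cycle_region[OF len dist sV cE cov]) blast+
  have "nontree_bd X = insert {u, v} ({{leg u a, leg v b}} - outer_edges - tree_edges)"
    unfolding nontree_bd_def X(2) chord_edge using w wI uv by blast
  moreover have "t \<in> X \<longleftrightarrow> e = {leg u a, leg v b}" if "e \<in> outer_edges" "t \<in> Tri" "e \<subseteq> t" for e t
    using X(4)[OF that] chord_edge wI that by blast
  ultimately show ?thesis using that[OF X(1)] X(3) xs_def by blast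
qed

text \<open>\<open>max 1\<close> covers both shapes: with join level 0 the legs extend to the outer
  cycle, otherwise they end at their join.\<close>

definition leg_set :: "'a \<Rightarrow> 'a \<Rightarrow> 'a set" where
  "leg_set u v = leg u ` {max 1 (join_level u v)..lev u} \<union> leg v ` {max 1 (join_level u v)..lev v}"

text \<open>Both sides of the separator satisfy this; one of them is selected, where needed, by a
  triangle that it has to avoid.\<close>

definition Region :: "'a \<Rightarrow> 'a \<Rightarrow> 'a set set \<Rightarrow> bool" where
  "Region u v F \<longleftrightarrow> F \<subseteq> Tri \<and> nontree_bd F = {{u, v}} \<and> \<Union>F \<inter> \<Union>(Tri - F) = leg_set u v"

lemma Region_compl: "Region u v F \<Longrightarrow> Region u v (Tri - F)"
  unfolding Region_def using nontree_bd_compl by (auto simp: double_diff)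

lemma Region_eq: "Region u v F \<Longrightarrow> Y \<subseteq> Tri \<Longrightarrow> nontree_bd Y = {{u, v}} \<Longrightarrow> Y = F \<or> Y = Tri - F"
  using nontree_bd_eq[of Y F] by (simp add: Region_def)

text \<open>The leg of \<open>v\<close> starts one level after the join, so that the join occurs
  only once, in the leg of \<open>u\<close>; the cycle is then closed by the tree edge from the join
  to the leg of \<open>v\<close>. No outer edge lies on this cycle, hence the chosen side has no
  triangle at an outer edge.\<close>

lemma cycle_region_join:
  assumes uv: "{u, v} \<in> inner_edges" "{u, v} \<notin> tree_edges" and h: "join_level u v \<ge> 1"
  obtains X where "Region u v X" "\<And>e t. e \<in> outer_edges \<Longrightarrow> t \<in> Tri \<Longrightarrow> e \<subseteq> t \<Longrightarrow> t \<notin> X"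
    "set (leg_path u v (join_level u v) (Suc (join_level u v))) = leg_set u v" "{leg u (join_level u v), leg v (Suc (join_level u v))} \<in> tree_edges"
proof -
  have V: "u \<in> V" "v \<in> V" using edge_in_V[of u v] uv(1) by simp_all
  have uvE: "{u, v} \<in> E" using uv by simp
  note hl = join_level_less[OF uvE uv(2)]
  have eq: "leg u (join_level u v) = leg v (join_level u v)" using join_level_leg[OF V h] by simp
  have tr: "{leg u (join_level u v), leg v (Suc (join_level u v))} \<in> tree_edges"
    unfolding eq using leg_edge[OF V(2) h] hl by simp
  have set: "set (leg_path u v (join_level u v) (Suc (join_level u v))) = leg_set u v"
  proof -
    have "{join_level u v..lev v} = insert (join_level u v) {Suc (join_level u v)..lev v}" using hl by auto
    then have i1: "leg v ` {join_level u v..lev v} = insert (leg u (join_level u v)) (leg v ` {Suc (join_level u v)..lev v})"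
      using eq by simp
    have i2: "leg u (join_level u v) \<in> leg u ` {join_level u v..lev u}" using hl by auto
    have i3: "leg_set u v = leg u ` {join_level u v..lev u} \<union> leg v ` {join_level u v..lev v}"
      using h by (simp add: leg_set_def max_def)
    show ?thesis by (simp only: set_leg_path i1 i3 Un_insert_right) (simp only: insert_absorb UnI1 i2)
  qed
  obtain X where X: "X \<subseteq> Tri" "nontree_bd X = insert {u, v} ({{leg u (join_level u v), leg v (Suc (join_level u v))}} - outer_edges - tree_edges)"
    "\<Union>X \<inter> \<Union>(Tri - X) = set (leg_path u v (join_level u v) (Suc (join_level u v)))"
    "\<And>e t. e \<in> outer_edges \<Longrightarrow> t \<in> Tri \<Longrightarrow> e \<subseteq> t \<Longrightarrow> t \<in> X \<longleftrightarrow> e = {leg u (join_level u v), leg v (Suc (join_level u v))}"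
  proof -
    have sep: "leg u l \<noteq> leg v l" if "join_level u v \<le> l" "Suc (join_level u v) \<le> l" "l \<le> lev u" "l \<le> lev v" for l
      using join_level_sep[OF V] that by auto
    have bnd: "join_level u v \<le> lev u" "1 \<le> Suc (join_level u v)" "Suc (join_level u v) \<le> lev v" "join_level u v \<noteq> lev u \<or> Suc (join_level u v) \<noteq> lev v"
      using hl by auto
    have cl: "{leg u (join_level u v), leg v (Suc (join_level u v))} \<in> E" using tr tree_edges_inner by auto
    show ?thesis by (rule leg_path_region[OF uv h bnd sep cl], assumption+) (rule that)
  qed
  have "nontree_bd X = {{u, v}}" using X(2) tr by auto
  then have R: "Region u v X" unfolding Region_def using X(1,3) set by simp
  have "t \<notin> X" if "e \<in> outer_edges" "t \<in> Tri" "e \<subseteq> t" for e t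
    using X(4)[OF that] tr tree_edges_inner that by blast
  then show ?thesis by (rule that[OF R _ set tr])
qed

lemma outer_arcs:
  assumes "a \<in> set C" "b \<in> set C" "a \<noteq> b"
  obtains ys zs where "distinct (a # ys @ b # zs)" "set (a # ys @ b # zs) = set C"
    "cycle_edges (a # ys @ b # zs) = outer_edges"
proof -
  obtain p q where C: "C = p @ a # q" using split_list[OF assms(1)] by auto
  have "b \<in> set (q @ p)" using assms C by auto
  then obtain ys zs where qp: "q @ p = ys @ b # zs" using split_list by metis
  have "cycle_edges (a # ys @ b # zs) = outer_edges"
    using cycle_edges_rotate[of p "a # q"] C qp by simp
  moreover have "set (a # ys @ b # zs) = set C" unfolding C qp[symmetric] by auto
  moreover have "distinct (a # ys @ b # zs)" using C_cycle(2) unfolding C qp[symmetric] by auto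
  ultimately show ?thesis using that by blast
qed

definition uncut :: "'a set set \<Rightarrow> 'a set \<Rightarrow> bool" where
  "uncut X W \<longleftrightarrow> (\<forall>v\<in>V - W. \<forall>t\<in>Tri. \<forall>t'\<in>Tri. v \<in> t \<longrightarrow> v \<in> t' \<longrightarrow> t \<in> X \<longrightarrow> t' \<in> X)"

text \<open>
  The path is closed up by either of the two arcs of the outer cycle. Both choices have the same relative
  boundary, and a vertex inside one arc does not lie on the cycle through the other, so its triangles are
  not separated.
\<close>

lemma path_region:
  assumes uv: "{u, v} \<in> inner_edges" "{u, v} \<notin> tree_edges" and h: "join_level u v = 0"
  shows "\<exists>X. Region u v X"
proof -
  have V: "u \<in> V" "v \<in> V" using edge_in_V[of u v] uv(1) by simp_all
  have lu: "1 \<le> lev u" "1 \<le> lev v" using lev_bounds V by blast+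
  define P where "P = leg_path u v 1 1"
  define a where "a = leg u 1"
  define b where "b = leg v 1"
  have aC: "a \<in> set C" "b \<in> set C"
    using leg[OF V(1), of 1] leg[OF V(2), of 1] lu lev_one by (auto simp: a_def b_def)
  have sep: "leg u l \<noteq> leg v l" if "1 \<le> l" "l \<le> lev u" "l \<le> lev v" for l
    using join_level_sep[OF V] h that by auto
  have ab: "a \<noteq> b" using sep[of 1] lu by (auto simp: a_def b_def)
  have dP: "distinct P" unfolding P_def by (rule distinct_leg_path[OF V]) (use sep in auto)
  have setP: "set P = leg_set u v" by (simp add: P_def set_leg_path leg_set_def h)
  have PV: "set P \<subseteq> V" using leg[OF V(1)] leg[OF V(2)] by (auto simp: P_def set_leg_path)
  have PC: "set P \<inter> set C = {a, b}"
  proof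
    show "set P \<inter> set C \<subseteq> {a, b}"
    proof
      fix x assume x: "x \<in> set P \<inter> set C"
      then have "x \<in> V" "lev x = 1" using PV lev_one by auto
      then show "x \<in> {a, b}" using x leg[OF V(1)] leg[OF V(2)] by (auto simp: P_def set_leg_path a_def b_def)
    qed
    show "{a, b} \<subseteq> set P \<inter> set C" using aC lu by (auto simp: P_def set_leg_path a_def b_def)
  qed
  have hP: "hd P = a" "last P = b" "P \<noteq> []"
    using hd_leg_path[OF lu(1), of v 1] last_leg_path[OF lu(2), of u 1] length_leg_path[of u v 1 1] lu
    by (auto simp: P_def a_def b_def)
  have w: "{u, v} \<in> walk_edges P" "walk_edges P \<subseteq> insert {u, v} tree_edges"
    using walk_leg_path_sub[OF V] lu by (auto simp: P_def)
  then have wI: "walk_edges P \<subseteq> inner_edges" using tree_edges_inner uv by blast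
  obtain ys zs where arcs: "distinct (a # ys @ b # zs)" "set (a # ys @ b # zs) = set C"
    "cycle_edges (a # ys @ b # zs) = outer_edges"
    using outer_arcs[OF aC ab] .
  have OEeq: "outer_edges = insert {last (b # zs), a} (insert {last (a # ys), b} (walk_edges (a # ys) \<union> walk_edges (b # zs)))"
    using arcs(3) cycle_edges_walk_edges[of "a # ys @ b # zs"] walk_edges_append[of "a # ys" "b # zs"] by simp
  have lenP: "length P \<ge> 2" "length P = 2 \<Longrightarrow> {a, b} = {u, v}"
  proof -
    show "length P \<ge> 2" using lu by (auto simp: P_def length_leg_path)
    assume "length P = 2"
    then have "lev u = 1" "lev v = 1" using lu by (auto simp: P_def length_leg_path)
    then show "{a, b} = {u, v}" using leg_self[of u] leg_self[of v] by (simp add: a_def b_def)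
  qed
  have side: "\<exists>X. X \<subseteq> Tri \<and> bd X = walk_edges P \<and> uncut X (set (P @ qs))"
    if qs: "set qs \<subseteq> set C - {a, b}" "distinct qs" "cycle_edges (P @ qs) \<subseteq> walk_edges P \<union> outer_edges"
      "{last (P @ qs), a} \<in> outer_edges" for qs
  proof -
    have ne: "P @ qs \<noteq> []" using hP by simp
    have sub: "walk_edges P \<subseteq> cycle_edges (P @ qs)"
      using hP(3) cycle_edges_walk_edges[OF ne] walk_edges_append[OF hP(3), of qs] by (cases "qs = []") auto
    have len: "length (P @ qs) \<ge> 3"
    proof (rule ccontr)
      \<comment> \<open>Then the path is the single edge \<open>uv\<close> and its ends are
        consecutive on \<open>C\<close>, which would make \<open>uv\<close> an outer edge.\<close>
      assume "\<not> length (P @ qs) \<ge> 3"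
      then have "length P + length qs \<le> 2" by simp
      then have "length P = 2" "length qs = 0" using lenP(1) by linarith+
      then have "length P = 2" "qs = []" by simp_all
      then have "{u, v} = {b, a}" "{b, a} \<in> outer_edges" using lenP(2) qs(4) hP by auto
      then show False using uv by auto
    qed
    have d: "distinct (P @ qs)" using dP qs PC by auto
    have sV: "set (P @ qs) \<subseteq> V" using PV qs C_cycle(3) by auto
    have cE: "cycle_edges (P @ qs) \<subseteq> E" using qs(3) wI C_cycle(4) by blast
    have "cycle_edges (P @ qs) - outer_edges = walk_edges P" using qs(3) sub wI by blast
    then show ?thesis using cycle_boundary[OF len d sV cE] unfolding uncut_def by metis
  qed
  have d: "a \<notin> set ys" "b \<notin> set ys" "a \<notin> set zs" "b \<notin> set zs" "distinct ys" "distinct zs" "set ys \<inter> set zs = {}"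
    "set C = insert a (insert b (set ys \<union> set zs))"
    using arcs(1,2) by auto
  have "\<exists>X. X \<subseteq> Tri \<and> bd X = walk_edges P \<and> uncut X (set (P @ rev ys))"
  proof (rule side)
    show l: "{last (P @ rev ys), a} \<in> outer_edges"
    proof (cases ys)
      case Nil then show ?thesis using hP OEeq by (auto simp: insert_commute)
    next
      case (Cons y ys') then show ?thesis using OEeq by (auto simp: insert_commute)
    qed
    have "walk_edges (P @ rev ys) \<subseteq> walk_edges P \<union> outer_edges"
    proof (cases "ys = []")
      case False
      then have "walk_edges (P @ rev ys) = insert {b, last ys} (walk_edges P \<union> walk_edges ys)"
        using walk_edges_append[OF hP(3), of "rev ys"] hP by (simp add: hd_rev walk_edges_rev)
      moreover have "walk_edges ys \<subseteq> walk_edges (a # ys)" using False by (cases ys) auto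
      ultimately show ?thesis using False OEeq by (auto simp: insert_commute)
    qed simp
    then show "cycle_edges (P @ rev ys) \<subseteq> walk_edges P \<union> outer_edges"
      using cycle_edges_walk_edges[of "P @ rev ys"] hP l by auto
  qed (use d in auto)
  then obtain X1 where X1: "X1 \<subseteq> Tri" "bd X1 = walk_edges P"
    "uncut X1 (set (P @ rev ys))" by blast
  have "\<exists>X. X \<subseteq> Tri \<and> bd X = walk_edges P \<and> uncut X (set (P @ zs))"
  proof (rule side)
    show l: "{last (P @ zs), a} \<in> outer_edges"
      using hP OEeq by (cases "zs = []") auto
    have "walk_edges (P @ zs) \<subseteq> walk_edges P \<union> outer_edges"
    proof (cases zs)
      case (Cons z zs')
      then have "walk_edges (P @ zs) = insert {b, z} (walk_edges P \<union> walk_edges zs)"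
        using walk_edges_append[OF hP(3), of zs] hP by simp
      then show ?thesis using Cons OEeq by auto
    qed simp
    then show "cycle_edges (P @ zs) \<subseteq> walk_edges P \<union> outer_edges"
      using cycle_edges_walk_edges[of "P @ zs"] hP l by auto
  qed (use d in auto)
  then obtain X2 where X2: "X2 \<subseteq> Tri" "bd X2 = walk_edges P"
    "uncut X2 (set (P @ zs))" by blast
  have X12: "X2 = X1 \<or> X2 = Tri - X1" using nontree_bd_eq[OF X2(1) X1(1)] X1(2) X2(2) by (simp add: nontree_bd_def)
  have "\<Union>X1 \<inter> \<Union>(Tri - X1) = set P"
  proof
    show "\<Union>X1 \<inter> \<Union>(Tri - X1) \<subseteq> set P"
    proof (rule subsetI, rule ccontr)
      fix x assume x: "x \<in> \<Union>X1 \<inter> \<Union>(Tri - X1)" "x \<notin> set P"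
      then obtain t t' where t: "t \<in> X1" "x \<in> t" "t' \<in> Tri" "t' \<notin> X1" "x \<in> t'" by blast
      have tT: "t \<in> Tri" "x \<in> V" using t X1(1) Tri_sub_V by blast+
      have "x \<in> set ys"
      proof (rule ccontr)
        assume "x \<notin> set ys"
        then have "x \<in> V - set (P @ rev ys)" using x tT by simp
        then show False using X1(3) t tT unfolding uncut_def by blast
      qed
      then have "x \<in> V - set (P @ zs)" using x tT d by auto
      then have "t \<in> X2 \<longleftrightarrow> t' \<in> X2" using X2(3) t tT unfolding uncut_def by blast
      then show False using X12 t tT by blast
    qed
    show "set P \<subseteq> \<Union>X1 \<inter> \<Union>(Tri - X1)"
    proof
      fix x assume "x \<in> set P"
      then obtain e where "e \<in> bd X1" "x \<in> e" using walk_edges_cover[OF lenP(1)] X1(2) by metis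
      then show "x \<in> \<Union>X1 \<inter> \<Union>(Tri - X1)" by (rule bd_vertices)
    qed
  qed
  moreover have "nontree_bd X1 = {{u, v}}" unfolding nontree_bd_def X1(2) using w uv by blast
  ultimately show ?thesis unfolding Region_def setP using X1(1) by blast
qed

definition nontree_edges :: "'a set set" where
  "nontree_edges = inner_edges - tree_edges"

lemma Region_exists:
  assumes "{u, v} \<in> nontree_edges"
  shows "\<exists>X. Region u v X"
proof (cases "join_level u v = 0")
  case True
  then show ?thesis using path_region assms by (simp add: nontree_edges_def)
next
  case False
  then have h: "join_level u v \<ge> 1" by simp
  have uv: "{u, v} \<in> inner_edges" "{u, v} \<notin> tree_edges" using assms by (auto simp: nontree_edges_def)
  show ?thesis using cycle_region_join[OF uv h] by metis
qed

section \<open>The chain of nested regions\<close>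

definition sub_region :: "'a \<Rightarrow> 'a \<Rightarrow> 'a set \<Rightarrow> 'a set set \<Rightarrow> bool" where
  "sub_region a b t F \<longleftrightarrow> F \<subseteq> Tri \<and> t \<notin> F \<and> nontree_bd F = {{a, b}} \<inter> nontree_edges \<and> (F = {} \<or> {a, b} \<in> nontree_edges \<and> Region a b F)"

text \<open>For a non-tree edge the side without \<open>t\<close> is taken. An outer edge or a tree
  edge has no region of its own and gets the empty set.\<close>

lemma sub_region_exists:
  assumes "t \<in> Tri"
  shows "\<exists>F. sub_region a b t F"
proof (cases "{a, b} \<in> nontree_edges")
  case True
  then obtain X where X: "Region a b X" using Region_exists by blast
  then have "Region a b (Tri - X)" by (rule Region_compl)
  then obtain F where "Region a b F" "t \<notin> F" using X assms by blast
  then show ?thesis using True unfolding sub_region_def by (auto simp: Region_def)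
next
  case False
  then have "sub_region a b t {}" by (auto simp: sub_region_def nontree_bd_def boundary_def)
  then show ?thesis by blast
qed

lemma bd_single:
  assumes "t \<in> Tri"
  shows "bd {t} = {e \<in> inner_edges. e \<subseteq> t}"
proof -
  have "e \<in> bd {t}" if e: "e \<in> inner_edges" "e \<subseteq> t" for e
  proof -
    have "card {t \<in> Tri. e \<subseteq> t} = 2" using inner_two e by simp
    then have "{s \<in> Tri. e \<subseteq> s} \<noteq> {t}" by auto
    then obtain s where "s \<in> Tri" "e \<subseteq> s" "s \<noteq> t" using assms e(2) by blast
    then show ?thesis using e unfolding boundary_def by simp blast
  qed
  then show ?thesis unfolding boundary_def by blast
qed

lemma nontree_bd_triangle:
  assumes "t \<in> Tri" "t = {u, v, w}" "u \<noteq> v" "w \<noteq> u" "w \<noteq> v"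
  shows "nontree_bd {t} = {{u, v}, {u, w}, {w, v}} \<inter> nontree_edges"
proof -
  have "e \<in> {{u, v}, {u, w}, {w, v}}" if e: "e \<in> E" "e \<subseteq> t" for e
  proof -
    obtain x y where "x \<noteq> y" "e = {x, y}" using edge_ends[OF e(1)] by blast
    then show ?thesis using e(2) assms(2) by auto
  qed
  moreover have "e \<subseteq> t" if "e \<in> {{u, v}, {u, w}, {w, v}}" for e using that assms(2) by auto
  ultimately show ?thesis unfolding nontree_bd_def bd_single[OF assms(1)] nontree_edges_def by blast
qed

text \<open>Modulo 2, \<open>F\<close> without \<open>t\<close> and the sum of \<open>F1\<close> and
  \<open>F2\<close> have the same non-tree boundary, and both avoid \<open>t\<close>, so they are
  equal. For disjointness, a non-tree boundary edge of \<open>F1 \<inter> F2\<close> would have to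
  be \<open>uw\<close> or \<open>wv\<close>, with \<open>t\<close> as one of its triangles. Its
  other triangle would lie in both sets and \<open>t\<close> in neither, so it would be a boundary
  edge of both; but their non-tree boundaries are disjoint.\<close>

lemma triangle_split:
  assumes F: "F \<subseteq> Tri" "nontree_bd F = {{u, v}} \<inter> nontree_edges" "t \<in> F" "t = {u, v, w}" "u \<noteq> v" "w \<noteq> u" "w \<noteq> v"
    and F1: "sub_region u w t F1" and F2: "sub_region w v t F2"
  shows "F = insert t (F1 \<union> F2)" "F1 \<inter> F2 = {}"
proof -
  have tT: "t \<in> Tri" using F by blast
  have ne: "{u, v} \<noteq> {u, w}" "{u, v} \<noteq> {w, v}" "{u, w} \<noteq> {w, v}" using F(5-7) by (auto simp: doubleton_eq_iff)
  have s1: "F1 \<subseteq> Tri" "t \<notin> F1" "nontree_bd F1 = {{u, w}} \<inter> nontree_edges" using F1 by (auto simp: sub_region_def)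
  have s2: "F2 \<subseteq> Tri" "t \<notin> F2" "nontree_bd F2 = {{w, v}} \<inter> nontree_edges" using F2 by (auto simp: sub_region_def)
  define A where "A = sym_diff F {t}"
  define B where "B = sym_diff F1 F2"
  have AB: "A \<subseteq> Tri" "B \<subseteq> Tri" using F(1) tT s1 s2 by (auto simp: A_def B_def)
  have "nontree_bd A = sym_diff (nontree_bd F) (nontree_bd {t})" unfolding A_def by (rule nontree_bd_sym_diff) (use F(1) tT in auto)
  moreover have "nontree_bd B = sym_diff (nontree_bd F1) (nontree_bd F2)" unfolding B_def by (rule nontree_bd_sym_diff[OF s1(1) s2(1)])
  moreover have "sym_diff ({a} \<inter> S) ({a, b, c} \<inter> S) = sym_diff ({b} \<inter> S) ({c} \<inter> S)"
    if "a \<noteq> b" "a \<noteq> c" "b \<noteq> c" for a b c :: "'a set" and S using that by blast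
  ultimately have "nontree_bd A = nontree_bd B"
    unfolding F(2) s1(3) s2(3) nontree_bd_triangle[OF tT F(4-7)] using ne by simp
  then have "A = B \<or> A = Tri - B" using nontree_bd_eq AB by blast
  moreover have "t \<notin> A" "t \<notin> B" using F(3) s1(2) s2(2) by (auto simp: A_def B_def)
  ultimately have eq: "A = B" using tT by blast
  have "e \<notin> nontree_bd (F1 \<inter> F2)" for e
  proof
    assume e: "e \<in> nontree_bd (F1 \<inter> F2)"
    then have eI: "e \<in> inner_edges" "e \<in> bd (F1 \<inter> F2)" "e \<in> nontree_edges" using bd_inner_edges by (auto simp: nontree_bd_def nontree_edges_def)
    obtain t1 t2 where t: "t1 \<noteq> t2" "t1 \<in> Tri" "t2 \<in> Tri" "e \<subseteq> t1" "e \<subseteq> t2"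
      "\<And>t. t \<in> Tri \<Longrightarrow> e \<subseteq> t \<Longrightarrow> t = t1 \<or> t = t2"
      "\<And>X. X \<subseteq> Tri \<Longrightarrow> e \<in> bd X \<longleftrightarrow> (t1 \<in> X \<longleftrightarrow> t2 \<notin> X)"
      by (rule inner_pair[OF eI(1)]) blast
    have "F1 \<inter> F2 \<subseteq> Tri" using s1 by blast
    then have "t1 \<in> F1 \<inter> F2 \<longleftrightarrow> t2 \<notin> F1 \<inter> F2" using t(7) eI(2) by blast
    then have or: "e \<in> bd F1 \<or> e \<in> bd F2" using t(7)[OF s1(1)] t(7)[OF s2(1)] by blast
    then have "e \<in> nontree_bd F1 \<or> e \<in> nontree_bd F2" using eI(3) by (auto simp: nontree_bd_def nontree_edges_def)
    then have e12: "e = {u, w} \<or> e = {w, v}" using s1(3) s2(3) by blast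
    then have "e \<subseteq> t" using F(4) by auto
    then have tt: "t = t1 \<or> t = t2" using t(6) tT by blast
    have "e \<in> nontree_bd F1 \<longleftrightarrow> e = {u, w}" "e \<in> nontree_bd F2 \<longleftrightarrow> e = {w, v}" using s1(3) s2(3) eI(3) by blast+
    then have "\<not> (e \<in> bd F1 \<and> e \<in> bd F2)" using ne(3) eI(3) by (auto simp: nontree_bd_def nontree_edges_def)
    then show False
      using tt s1(2) s2(2) t(7)[OF s1(1)] t(7)[OF s2(1)] \<open>t1 \<in> F1 \<inter> F2 \<longleftrightarrow> t2 \<notin> F1 \<inter> F2\<close> by blast
  qed
  then have "nontree_bd (F1 \<inter> F2) = {}" by blast
  moreover have "F1 \<inter> F2 \<subseteq> Tri" using s1(1) by blast
  ultimately have "F1 \<inter> F2 = {} \<or> F1 \<inter> F2 = Tri" using nontree_bd_empty by blast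
  then show dis: "F1 \<inter> F2 = {}" using tT s1(2) by blast
  have "F - {t} = F1 \<union> F2" using eq dis F(3) unfolding A_def B_def by blast
  then show "F = insert t (F1 \<union> F2)" using F(3) by blast
qed

text \<open>The order of the ends matters: the end that is kept stays in its place and
  \<open>w\<close> takes the place of the other, so that first legs and second legs can be followed
  separately along the chain. \<open>F''\<close> is the part that is given up.\<close>

definition chain_step :: "'a \<Rightarrow> 'a \<Rightarrow> 'a set set \<Rightarrow> 'a \<Rightarrow> 'a \<Rightarrow> 'a set set \<Rightarrow> bool" where
  "chain_step u v F u' v' F' \<longleftrightarrow> (\<exists>w F''. F = insert {u, v, w} (F' \<union> F'') \<and> {u, v, w} \<notin> F' \<and> {u, v, w} \<notin> F'' \<and>
     F' \<inter> F'' = {} \<and> {u, v, w} \<in> Tri \<and> w \<in> V \<and> {u', v'} \<in> nontree_edges \<and> Region u' v' F' \<and>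
     (u' = u \<and> v' = w \<and> (F'' = {} \<or> Region w v F'') \<or> u' = w \<and> v' = v \<and> (F'' = {} \<or> Region u w F'')))"

lemma Tri_third:
  assumes "t \<in> Tri" "{u, v} \<subseteq> t" "u \<noteq> v"
  obtains w where "t = {u, v, w}" "w \<noteq> u" "w \<noteq> v" "w \<in> V" "{u, w} \<in> E" "{w, v} \<in> E"
proof -
  obtain a b c where t: "t = {a, b, c}" "a \<noteq> b" "b \<noteq> c" "a \<noteq> c" "{a, b} \<in> E" "{b, c} \<in> E" "{a, c} \<in> E"
    using Tri_form[OF assms(1)] by blast
  have V: "a \<in> V" "b \<in> V" "c \<in> V" using Tri_sub_V[OF assms(1)] t(1) by auto
  have "u \<in> {a, b, c}" "v \<in> {a, b, c}" using assms(2) t(1) by auto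
  then consider "u = a" "v = b" | "u = a" "v = c" | "u = b" "v = a" | "u = b" "v = c" | "u = c" "v = a" | "u = c" "v = b"
    using assms(3) by blast
  then show ?thesis
  proof cases
    case 1 then show ?thesis using that[of c] t V by (auto simp: insert_commute)
  next
    case 2 then show ?thesis using that[of b] t V by (auto simp: insert_commute)
  next
    case 3 then show ?thesis using that[of c] t V by (auto simp: insert_commute)
  next
    case 4 then show ?thesis using that[of a] t V by (auto simp: insert_commute)
  next
    case 5 then show ?thesis using that[of b] t V by (auto simp: insert_commute)
  next
    case 6 then show ?thesis using that[of a] t V by (auto simp: insert_commute)
  qed
qed

text \<open>The triangle accounts for one element, and the larger of the two parts for at least half
  of the rest.\<close>

lemma chain_step_exists:
  assumes F: "F \<subseteq> Tri" "nontree_bd F = {{u, v}} \<inter> nontree_edges" "u \<noteq> v" "t \<in> F" "{u, v} \<subseteq> t" "card F \<ge> 2"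
  shows "\<exists>u' v' F'. chain_step u v F u' v' F' \<and> card F \<le> Suc (2 * card F')"
proof -
  have tT: "t \<in> Tri" using F by blast
  obtain w where w: "t = {u, v, w}" "w \<noteq> u" "w \<noteq> v" "w \<in> V" "{u, w} \<in> E" "{w, v} \<in> E"
    using Tri_third[OF tT F(5,3)] .
  obtain F1 F2 where F12: "sub_region u w t F1" "sub_region w v t F2" using sub_region_exists[OF tT] by metis
  note sp = triangle_split[OF F(1,2,4) w(1) F(3) w(2,3) F12]
  have fin: "finite F1" "finite F2" using F12 finite_subset[OF _ finite_Tri] by (auto simp: sub_region_def)
  have tn: "t \<notin> F1" "t \<notin> F2" using F12 by (auto simp: sub_region_def)
  have "card F = Suc (card (F1 \<union> F2))" using sp(1) tn fin by simp
  then have card: "card F = Suc (card F1 + card F2)" using sp(2) fin by (simp add: card_Un_disjoint)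
  show ?thesis
  proof (cases "card F1 \<ge> card F2")
    case True
    then have "F1 \<noteq> {}" using card F(6) by auto
    then have R: "{u, w} \<in> nontree_edges" "Region u w F1" using F12(1) by (auto simp: sub_region_def)
    have "F2 = {} \<or> Region w v F2" using F12(2) by (auto simp: sub_region_def)
    then have "chain_step u v F u w F1" unfolding chain_step_def
      using sp tn tT R w(1,4) by (intro exI[of _ w] exI[of _ F2]) auto
    then show ?thesis using card True by (intro exI[of _ u] exI[of _ w] exI[of _ F1]) auto
  next
    case False
    then have "F2 \<noteq> {}" by auto
    then have R: "{w, v} \<in> nontree_edges" "Region w v F2" using F12(2) by (auto simp: sub_region_def)
    have "F1 = {} \<or> Region u w F1" using F12(1) by (auto simp: sub_region_def)
    then have "chain_step u v F w v F2" unfolding chain_step_def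
      using sp tn tT R w(1,4) by (intro exI[of _ w] exI[of _ F1]) auto
    then show ?thesis using card False by (intro exI[of _ w] exI[of _ v] exI[of _ F2]) auto
  qed
qed

lemma nontree_edge: "{u, v} \<in> nontree_edges \<Longrightarrow> {u, v} \<in> E \<and> u \<in> V \<and> v \<in> V \<and> u \<noteq> v"
  using edge_in_V[of u v] by (simp add: nontree_edges_def)

lemma Region_tri:
  assumes "Region u v F"
  shows "\<exists>t\<in>F. {u, v} \<subseteq> t" "\<exists>t\<in>Tri - F. {u, v} \<subseteq> t" "{u, v} \<in> nontree_edges"
proof -
  have "{u, v} \<in> nontree_bd F" using assms by (simp add: Region_def)
  then have *: "{u, v} \<in> bd F" "{u, v} \<in> nontree_edges" using bd_inner_edges by (auto simp: nontree_bd_def nontree_edges_def)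
  then show "\<exists>t\<in>F. {u, v} \<subseteq> t" "\<exists>t\<in>Tri - F. {u, v} \<subseteq> t" "{u, v} \<in> nontree_edges"
    unfolding boundary_def by blast+
qed

lemma chain_exists:
  assumes N: "2 ^ (N + 1) \<le> card Tri + 1"
  shows "\<exists>u v F. F 0 = Tri \<and> {u 0, v 0} \<in> outer_edges \<and>
     (\<forall>i<N. chain_step (u i) (v i) (F i) (u (Suc i)) (v (Suc i)) (F (Suc i)))"
proof -
  define P where "P = (\<lambda>n (u, v, F). F \<subseteq> Tri \<and> nontree_bd F = {{u, v}} \<inter> nontree_edges \<and> u \<noteq> v \<and> (\<exists>t\<in>F. {u, v} \<subseteq> t) \<and>
      (n = 0 \<longrightarrow> F = Tri \<and> {u, v} \<in> outer_edges) \<and> (n \<le> N \<longrightarrow> card Tri + 1 \<le> (card F + 1) * 2 ^ n))"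
  define Q where "Q = (\<lambda>n (u, v, F) (u', v', F'). n < N \<longrightarrow> chain_step u v F u' v' F')"
  have "\<exists>f. \<forall>n. P n (f n) \<and> Q n (f n) (f (Suc n))"
  proof (rule dependent_nat_choice)
    have "hd C \<in> set C" using C_cycle(1) by (cases C) auto
    then obtain e where e: "e \<in> outer_edges" using cycle_edges_cover by metis
    then obtain u v where uv: "u \<noteq> v" "e = {u, v}" using C_cycle(4) edge_ends[of e] by (meson subsetD)
    obtain t where t: "t \<in> Tri" "e \<subseteq> t" using edge_Tri[of e] e C_cycle(4) by (meson subsetD)
    \<comment> \<open>For an outer edge the prescribed non-tree boundary is empty, so all of
      \<open>Tri\<close> can serve as the initial region.\<close>
    have "nontree_bd Tri = {}" by (auto simp: nontree_bd_def boundary_def)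
    moreover have "{{u, v}} \<inter> nontree_edges = {}" using e uv by (auto simp: nontree_edges_def)
    ultimately have "P 0 (u, v, Tri)" using uv e t by (auto simp: P_def)
    then show "\<exists>x. P 0 x" by blast
  next
    fix x n assume Px: "P n x"
    obtain u v F where x: "x = (u, v, F)" by (cases x)
    show "\<exists>y. P (Suc n) y \<and> Q n x y"
    proof (cases "n < N")
      case False
      then have "P (Suc n) x \<and> Q n x x" using Px by (simp add: P_def Q_def x)
      then show ?thesis by blast
    next
      case True
      have p: "F \<subseteq> Tri" "nontree_bd F = {{u, v}} \<inter> nontree_edges" "u \<noteq> v" "\<exists>t\<in>F. {u, v} \<subseteq> t"
        "card Tri + 1 \<le> (card F + 1) * 2 ^ n"
        using Px True unfolding P_def x by auto
      \<comment> \<open>A step at worst halves \<open>card F + 1\<close>, so before step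
        \<open>n < N\<close> this number is still at least 4 and the region can be divided
        again.\<close>
      have "2 ^ (n + 2) \<le> (2::nat) ^ (N + 1)" using True by (intro power_increasing) auto
      moreover have "(2::nat) ^ (n + 2) = 4 * 2 ^ n" by (simp add: power_add)
      ultimately have "4 * 2 ^ n \<le> (card F + 1) * 2 ^ n" using N p(5) by linarith
      then have "4 \<le> card F + 1" by simp
      then have c2: "card F \<ge> 2" by simp
      obtain t where t: "t \<in> F" "{u, v} \<subseteq> t" using p(4) by blast
      obtain u' v' F' where s: "chain_step u v F u' v' F'" "card F \<le> Suc (2 * card F')"
        using chain_step_exists[OF p(1-3) t c2] by blast
      have R: "Region u' v' F'" "{u', v'} \<in> nontree_edges" using s(1) by (auto simp: chain_step_def)
      have "card F + 1 \<le> 2 * (card F' + 1)" using s(2) by simp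
      then have "(card F + 1) * 2 ^ n \<le> 2 * (card F' + 1) * 2 ^ n" by (rule mult_le_mono1)
      then have "card Tri + 1 \<le> (card F' + 1) * 2 ^ Suc n" using p(5) by (simp add: algebra_simps)
      then have "P (Suc n) (u', v', F')"
        using R Region_tri[OF R(1)] nontree_edge[OF R(2)] by (auto simp: P_def Region_def)
      then show ?thesis using s(1) by (intro exI[of _ "(u', v', F')"]) (simp add: Q_def x)
    qed
  qed
  then obtain f where f: "\<And>n. P n (f n)" "\<And>n. Q n (f n) (f (Suc n))" by blast
  define u where "u = (\<lambda>i. fst (f i))"
  define v where "v = (\<lambda>i. fst (snd (f i)))"
  define F where "F = (\<lambda>i. snd (snd (f i)))"
  have fe: "f i = (u i, v i, F i)" for i by (simp add: u_def v_def F_def)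
  have "F 0 = Tri \<and> {u 0, v 0} \<in> outer_edges" using f(1)[of 0] unfolding fe P_def by simp
  moreover have "chain_step (u i) (v i) (F i) (u (Suc i)) (v (Suc i)) (F (Suc i))" if "i < N" for i
    using f(2)[of i] that unfolding fe Q_def by simp
  ultimately show ?thesis by blast
qed

lemma card_Tri_ge: "card V \<le> 3 * card Tri"
proof -
  have "V \<subseteq> \<Union>Tri" using vertex_Tri by blast
  then have "card V \<le> card (\<Union>Tri)"
    using finite_Tri Tri_sub_V finite_V by (meson Sup_least card_mono finite_subset)
  also have "\<dots> \<le> (\<Sum>t\<in>Tri. card t)" by (rule card_Union_le_sum_card)
  also have "\<dots> \<le> (\<Sum>t\<in>Tri. 3)"
  proof (rule sum_mono)
    fix t assume "t \<in> Tri"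
    then obtain a b c where "t = {a, b, c}" using Tri_form by blast
    then show "card t \<le> 3" by (simp add: card_insert_if)
  qed
  finally show ?thesis by simp
qed

lemma leg_set_commute: "leg_set u v = leg_set v u"
  by (simp add: leg_set_def join_level_commute[of u v] Un_commute)

lemma Region_commute: "Region u v F \<longleftrightarrow> Region v u F"
  by (simp add: Region_def leg_set_commute[of u v] insert_commute)

lemma chain_step_commute:
  assumes "chain_step u v F u' v' F'"
  shows "chain_step v u F v' u' F'"
proof -
  obtain w F'' where s: "F = insert {u, v, w} (F' \<union> F'')" "{u, v, w} \<notin> F'" "{u, v, w} \<notin> F''"
     "F' \<inter> F'' = {}" "{u, v, w} \<in> Tri" "w \<in> V" "{u', v'} \<in> nontree_edges" "Region u' v' F'"
     "u' = u \<and> v' = w \<and> (F'' = {} \<or> Region w v F'') \<or> u' = w \<and> v' = v \<and> (F'' = {} \<or> Region u w F'')"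
    using assms unfolding chain_step_def by blast
  have "{v, u, w} = {u, v, w}" "{v', u'} = {u', v'}" by auto
  then show ?thesis unfolding chain_step_def using s Region_commute
    by (intro exI[of _ w] exI[of _ F'']) metis
qed

lemma SsetE:
  assumes "x \<in> leg_set u v" "u \<in> V" "v \<in> V"
  shows "x \<in> V" "max 1 (join_level u v) \<le> lev x"
    "lev x \<le> lev u \<and> leg u (lev x) = x \<or> lev x \<le> lev v \<and> leg v (lev x) = x"
proof -
  obtain l where l: "max 1 (join_level u v) \<le> l" "l \<le> lev u \<and> x = leg u l \<or> l \<le> lev v \<and> x = leg v l"
    using assms(1) unfolding leg_set_def by auto
  then have "lev x = l \<and> x \<in> V" using leg[OF assms(2), of l] leg[OF assms(3), of l] by auto
  then show "x \<in> V" "max 1 (join_level u v) \<le> lev x"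
    "lev x \<le> lev u \<and> leg u (lev x) = x \<or> lev x \<le> lev v \<and> leg v (lev x) = x"
    using l by auto
qed

lemma SsetI: "max 1 (join_level u v) \<le> l \<Longrightarrow> l \<le> lev u \<Longrightarrow> leg u l \<in> leg_set u v"
  by (auto simp: leg_set_def)

lemma SsetI': "max 1 (join_level u v) \<le> l \<Longrightarrow> l \<le> lev v \<Longrightarrow> leg v l \<in> leg_set u v"
  by (auto simp: leg_set_def)

text \<open>Take the vertex of smallest level on the leg among those on triangles of
  \<open>F\<close>. If it is an outer vertex, the complement covers it by hypothesis; otherwise its
  parent lies on no triangle of \<open>F\<close>, so a triangle at the edge to the parent belongs to
  the complement.\<close>

lemma leg_enters:
  assumes "F \<subseteq> Tri" "w \<in> V" "w \<in> \<Union>F" "set C \<subseteq> \<Union>(Tri - F)"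
  shows "\<exists>l. 1 \<le> l \<and> l \<le> lev w \<and> leg w l \<in> \<Union>F \<inter> \<Union>(Tri - F)"
proof -
  define P where "P = (\<lambda>l. 1 \<le> l \<and> l \<le> lev w \<and> leg w l \<in> \<Union>F)"
  have "P (lev w)" using assms lev_bounds[OF assms(2)] by (auto simp: P_def leg_self)
  then have l: "P (LEAST l. P l)" by (rule LeastI)
  have min: "\<not> P k" if "k < (LEAST l. P l)" for k using that by (rule not_less_Least)
  define l where "l = (LEAST l. P l)"
  have pl: "1 \<le> l" "l \<le> lev w" "leg w l \<in> \<Union>F" using l by (auto simp: P_def l_def)
  have "leg w l \<in> \<Union>(Tri - F)"
  proof (rule ccontr)
    assume no: "leg w l \<notin> \<Union>(Tri - F)"
    have "l \<noteq> 1"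
    proof
      assume "l = 1"
      then have "leg w l \<in> set C" using leg[OF assms(2), of 1] pl lev_one by auto
      then show False using no assms(4) by blast
    qed
    then obtain k where k: "l = Suc k" "1 \<le> k" using pl(1) by (cases l) auto
    have "{leg w k, leg w l} \<in> E"
      using leg_edge[OF assms(2), of k] k pl tree_edges_inner by auto
    then obtain t where t: "t \<in> Tri" "{leg w k, leg w l} \<subseteq> t" using edge_Tri by blast
    then have "t \<in> F" using no by blast
    then have "P k" using t k pl by (auto simp: P_def)
    then show False using min[of k] k by (simp add: l_def)
  qed
  then show ?thesis using pl by blast
qed

text \<open>
  If the chord \<open>{x, y}\<close> lies in the part of the region that is discarded when passing from \<open>{u, v}\<close> to
  \<open>{u, w}\<close>, then \<open>x\<close>, which is on the leg of \<open>u\<close>, is on the leg of \<open>w\<close> as well.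
\<close>

lemma hang:
  assumes V: "u \<in> V" "v \<in> V" "w \<in> V"
    and sep: "\<And>l. H < l \<Longrightarrow> l \<le> lev u \<Longrightarrow> l \<le> lev v \<Longrightarrow> leg u l \<noteq> leg v l"
    and a: "H < a" "a \<le> lev u" "x = leg u a" "x \<noteq> y"
    and f: "{x, y} \<noteq> {u, v}" "{x, y} \<noteq> {u, w}" "{x, y} \<subseteq> s"
    and s: "s = {u, v, w} \<or> s \<in> F'' \<and> Region w v F'' \<and> x \<in> \<Union>(Tri - F'')"
  shows "a \<le> lev w \<and> leg w a = x"
proof -
  have lx: "lev x = a" using leg[OF V(1), of a] a by simp
  have xv: "\<not> (a \<le> lev v \<and> leg v a = x)" using sep[of a] a by auto
  from s show ?thesis
  proof
    assume "s = {u, v, w}"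
    then have "x \<in> {u, v, w}" "y \<in> {u, v, w}" using f(3) by auto
    then have "x = v \<or> x = w" using f(1,2) a(4) by auto
    moreover have "x \<noteq> v" using xv lx leg_self[of v] by auto
    ultimately have "x = w" by blast
    then show ?thesis using lx leg_self[of w] by auto
  next
    assume h: "s \<in> F'' \<and> Region w v F'' \<and> x \<in> \<Union>(Tri - F'')"
    then have "x \<in> \<Union>F''" using f(3) by blast
    then have "x \<in> leg_set w v" using h by (auto simp: Region_def)
    then show ?thesis using SsetE(3)[OF _ V(3,2)] lx xv by blast
  qed
qed

end

section \<open>Separators along the chain\<close>

locale separator_chain = leveled_disk V E Tri C lev r
  for V :: "'a set" and E Tri :: "'a set set" and C :: "'a list" and lev :: "'a \<Rightarrow> nat" and r :: nat +
  fixes u v :: "nat \<Rightarrow> 'a" and F :: "nat \<Rightarrow> 'a set set" and N :: nat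
  assumes F0: "F 0 = Tri" and e0: "{u 0, v 0} \<in> cycle_edges C"
    and steps: "i < N \<Longrightarrow> chain_step (u i) (v i) (F i) (u (Suc i)) (v (Suc i)) (F (Suc i))"
begin

text \<open>The two ends play symmetric roles; a second interpretation with the ends exchanged
  supplies mirrored statements.\<close>

lemma swapped: "separator_chain V E Tri C lev r v u F N"
  by unfold_locales (use F0 e0 steps chain_step_commute in \<open>auto simp: insert_commute\<close>)

lemma stepE:
  assumes "i < N"
  obtains w F'' where "F i = insert {u i, v i, w} (F (Suc i) \<union> F'')" "{u i, v i, w} \<notin> F (Suc i)" "{u i, v i, w} \<notin> F''"
     "F (Suc i) \<inter> F'' = {}" "{u i, v i, w} \<in> Tri" "w \<in> V"
     "u (Suc i) = u i \<and> v (Suc i) = w \<and> (F'' = {} \<or> Region w (v i) F'') \<or>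
      u (Suc i) = w \<and> v (Suc i) = v i \<and> (F'' = {} \<or> Region (u i) w F'')"
  using steps[OF assms] unfolding chain_step_def by blast

lemma reg:
  assumes "1 \<le> i" "i \<le> N"
  shows "Region (u i) (v i) (F i)"
proof -
  obtain k where "i = Suc k" using assms by (cases i) auto
  then show ?thesis using steps[of k] assms by (auto simp: chain_step_def)
qed

lemma reg_nontree: "1 \<le> i \<Longrightarrow> i \<le> N \<Longrightarrow> {u i, v i} \<in> nontree_edges"
  using Region_tri(3)[OF reg] by blast

lemma uvV: "1 \<le> i \<Longrightarrow> i \<le> N \<Longrightarrow> u i \<in> V \<and> v i \<in> V"
  using nontree_edge[OF reg_nontree] by blast

lemma F_dec:
  assumes "i \<le> j" "j \<le> N"
  shows "F j \<subseteq> F i"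
  using assms
proof (induction j rule: dec_induct)
  case (step n)
  then have "F (Suc n) \<subseteq> F n" using stepE[of n] by (metis Suc_le_lessD Un_upper1 insert_subset order_trans subset_insertI sup.bounded_iff)
  then show ?case using step by auto
qed simp

lemma F_Tri: "i \<le> N \<Longrightarrow> F i \<subseteq> Tri"
  using F_dec[of 0 i] F0 by simp

text \<open>The triangle at the initial outer edge is removed in the first step. Since it lies
  outside all later regions, it tells each region from its complement, which has the same
  boundary.\<close>

lemma start_triangle:
  assumes "1 \<le> N"
  obtains t0 where "t0 \<in> Tri" "{u 0, v 0} \<subseteq> t0" "\<And>i. 1 \<le> i \<Longrightarrow> i \<le> N \<Longrightarrow> t0 \<notin> F i"
proof -
  obtain w where w: "{u 0, v 0, w} \<notin> F (Suc 0)" "{u 0, v 0, w} \<in> Tri"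
    using stepE[of 0] assms by (metis One_nat_def Suc_le_lessD)
  have "{u 0, v 0, w} \<notin> F i" if "1 \<le> i" "i \<le> N" for i
    using w(1) F_dec[of 1 i] that by auto
  then show ?thesis using that[of "{u 0, v 0, w}"] w by auto
qed

definition h :: "nat \<Rightarrow> nat" where "h i = join_level (u i) (v i)"
definition S :: "nat \<Rightarrow> 'a set" where "S i = leg_set (u i) (v i)"

lemma S_eq: "1 \<le> i \<Longrightarrow> i \<le> N \<Longrightarrow> S i = \<Union>(F i) \<inter> \<Union>(Tri - F i)"
  using reg by (simp add: Region_def S_def)

text \<open>The regions shrink and their complements grow: lying on a triangle of the region passes
  to smaller indices, lying on a triangle of the complement to larger ones.\<close>

lemma S_interval:
  assumes "1 \<le> i" "i \<le> k" "k \<le> j" "j \<le> N" "x \<in> S i" "x \<in> S j"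
  shows "x \<in> S k"
proof -
  have "x \<in> \<Union>(Tri - F i)" "x \<in> \<Union>(F j)" using S_eq[of i] S_eq[of j] assms by auto
  moreover have "F k \<subseteq> F i" "F j \<subseteq> F k" using F_dec assms by auto
  ultimately show ?thesis using S_eq[of k] assms by auto
qed

text \<open>When the legs join, one side of the separator has no triangle at an outer edge. The
  start triangle has an outer edge and is not in \<open>F i\<close>, so \<open>F i\<close> is that
  side.\<close>

lemma inside_region:
  assumes "1 \<le> i" "i \<le> N" "h i \<ge> 1" "e \<in> cycle_edges C" "t \<in> Tri" "e \<subseteq> t"
  shows "t \<notin> F i"
proof -
  have uv: "{u i, v i} \<in> E - cycle_edges C" "{u i, v i} \<notin> tree_edges" using reg_nontree[OF assms(1,2)] by (auto simp: nontree_edges_def)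
  have hi: "join_level (u i) (v i) \<ge> 1" using assms(3) by (simp add: h_def)
  obtain X where X: "Region (u i) (v i) X" "\<And>e t. e \<in> cycle_edges C \<Longrightarrow> t \<in> Tri \<Longrightarrow> e \<subseteq> t \<Longrightarrow> t \<notin> X"
    by (rule cycle_region_join[OF uv hi]) blast
  have "X = F i \<or> X = Tri - F i"
    using Region_eq[OF reg[OF assms(1,2)], of X] X(1) by (simp add: Region_def)
  moreover obtain t0 where "t0 \<in> Tri" "{u 0, v 0} \<subseteq> t0" "t0 \<notin> F i"
    using start_triangle assms(1,2) by (metis le_trans)
  ultimately have "X = F i" using X(2)[OF e0] by blast
  then show ?thesis using X(2) assms(4-6) by blast
qed

text \<open>The separator cuts the region off from the outer cycle, so the leg of the new vertex
  \<open>w\<close> passes through a vertex of \<open>S i\<close>. From there on it coincides with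
  the leg of \<open>u i\<close> or \<open>v i\<close> and so reaches the same join.\<close>

lemma join_step:
  assumes "1 \<le> i" "i < N" "h i \<ge> 1"
  shows "h i \<le> h (Suc i)" "leg (u (Suc i)) (h i) = leg (u i) (h i)"
proof -
  have iN: "i \<le> N" "1 \<le> Suc i" "Suc i \<le> N" using assms by auto
  note V = uvV[OF assms(1) iN(1)] uvV[OF iN(2,3)]
  obtain w F'' where s: "F i = insert {u i, v i, w} (F (Suc i) \<union> F'')" "w \<in> V"
     "u (Suc i) = u i \<and> v (Suc i) = w \<and> (F'' = {} \<or> Region w (v i) F'') \<or>
      u (Suc i) = w \<and> v (Suc i) = v i \<and> (F'' = {} \<or> Region (u i) w F'')"
    by (rule stepE[OF assms(2)]) blast
  define H where "H = h i"
  have H1: "1 \<le> H" using assms by (simp add: H_def)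
  have Hle: "H \<le> lev (u i)" "H \<le> lev (v i)" using join_level_le[of "u i" "v i"] V by (auto simp: H_def h_def)
  have Heq: "leg (u i) H = leg (v i) H" using join_level_leg[of "u i" "v i" H] V H1 by (simp add: H_def h_def)
  have "set C \<subseteq> \<Union>(Tri - F i)"
  proof
    fix z assume "z \<in> set C"
    then obtain e where e: "e \<in> cycle_edges C" "z \<in> e" using cycle_edges_cover by metis
    then obtain t where "t \<in> Tri" "e \<subseteq> t" using edge_Tri[of e] C_cycle(4) by (meson subsetD)
    then show "z \<in> \<Union>(Tri - F i)" using inside_region[OF assms(1) iN(1) assms(3) e(1)] e by blast
  qed
  moreover have "w \<in> \<Union>(F i)" using s(1) by blast
  ultimately obtain l where l: "1 \<le> l" "l \<le> lev w" "leg w l \<in> S i"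
    using leg_enters[OF F_Tri[OF iN(1)] s(2)] S_eq[OF assms(1) iN(1)] by blast
  have lx: "lev (leg w l) = l" using leg[OF s(2) l(1,2)] by simp
  note SE = SsetE[of "leg w l" "u i" "v i", unfolded lx]
  have Sx: "H \<le> l" "l \<le> lev (u i) \<and> leg (u i) l = leg w l \<or> l \<le> lev (v i) \<and> leg (v i) l = leg w l"
    using SE l(3) V by (auto simp: S_def H_def h_def)
  have "leg w H = leg (u i) H"
  proof -
    have "leg w H = leg (leg w l) H" using leg_leg[OF s(2) H1 Sx(1) l(2)] by simp
    moreover have "leg (leg (u i) l) H = leg (u i) H" if "l \<le> lev (u i)" using leg_leg[of "u i" H l] V H1 Sx(1) that by simp
    moreover have "leg (leg (v i) l) H = leg (v i) H" if "l \<le> lev (v i)" using leg_leg[of "v i" H l] V H1 Sx(1) that by simp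
    ultimately show ?thesis using Sx(2) Heq by metis
  qed
  moreover have "H \<le> lev w" using Sx(1) l by simp
  ultimately have "agree (u (Suc i)) (v (Suc i)) H" "leg (u (Suc i)) H = leg (u i) H"
    using s(3) H1 Hle Heq by (auto simp: agree_def)
  then show "h i \<le> h (Suc i)" "leg (u (Suc i)) (h i) = leg (u i) (h i)"
    using agree_iff[of "u (Suc i)" "v (Suc i)" H] V by (auto simp: H_def h_def)
qed

lemma h_mono:
  assumes "1 \<le> i" "i \<le> j" "j \<le> N"
  shows "h i \<le> h j"
  using assms(2,3)
proof (induction j rule: dec_induct)
  case (step n)
  then show ?case using join_step(1)[of n] assms(1) by (cases "h n = 0") auto
qed simp

end

section \<open>Chords on an interval of constant join level\<close>

locale constant_join = separator_chain +
  fixes \<alpha> \<beta> H :: nat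
  assumes \<alpha>: "1 \<le> \<alpha>" and \<beta>: "\<beta> \<le> N"
    and hH: "\<alpha> \<le> i \<Longrightarrow> i \<le> \<beta> \<Longrightarrow> h i = H"
begin

lemma swapped_const: "constant_join V E Tri C lev r v u F N \<alpha> \<beta> H"
proof -
  interpret sw: separator_chain V E Tri C lev r v u F N by (rule swapped)
  have "sw.h i = h i" for i by (simp add: sw.h_def h_def join_level_commute)
  then show ?thesis by unfold_locales (use \<alpha> \<beta> hH in auto)
qed

lemma UV: "\<alpha> \<le> i \<Longrightarrow> i \<le> \<beta> \<Longrightarrow> u i \<in> V" "\<alpha> \<le> i \<Longrightarrow> i \<le> \<beta> \<Longrightarrow> v i \<in> V"
  using uvV[of i] \<alpha> \<beta> by auto

lemma sep: "\<alpha> \<le> i \<Longrightarrow> i \<le> \<beta> \<Longrightarrow> H < l \<Longrightarrow> l \<le> lev (u i) \<Longrightarrow> l \<le> lev (v i) \<Longrightarrow> leg (u i) l \<noteq> leg (v i) l"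
  using join_level_sep[OF UV] hH[of i] by (simp add: h_def)

lemma join_const:
  assumes "\<alpha> \<le> i" "i \<le> j" "j \<le> \<beta>" "H \<ge> 1"
  shows "leg (u j) H = leg (u i) H"
  using assms(2,3)
proof (induction j rule: dec_induct)
  case (step n)
  then show ?case using join_step(2)[of n] hH[of n] assms \<alpha> \<beta> by auto
qed simp

lemma S_level:
  assumes "\<alpha> \<le> i" "i \<le> \<beta>" "x \<in> S i"
  shows "lev x \<le> lev (u i) \<and> leg (u i) (lev x) = x \<or> lev x \<le> lev (v i) \<and> leg (v i) (lev x) = x"
  using SsetE(3)[of x "u i" "v i"] assms UV by (simp add: S_def)

lemma S_memI:
  assumes "\<alpha> \<le> i" "i \<le> \<beta>" "H < l"
  shows "l \<le> lev (u i) \<Longrightarrow> leg (u i) l \<in> S i" "l \<le> lev (v i) \<Longrightarrow> leg (v i) l \<in> S i"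
  using assms hH[of i] SsetI[of "u i" "v i" l] SsetI'[of "u i" "v i" l] by (auto simp: S_def h_def)

lemma step_keeps:
  assumes "i < N"
  shows "u (Suc i) = u i \<or> v (Suc i) = v i"
  by (rule stepE[OF assms]) blast

text \<open>
  A vertex cannot change from one leg to the other: at the step where it would, only one of the two edge
  ends changes, so the vertex would be on both legs.
\<close>

lemma cross_le:
  assumes "\<alpha> \<le> i" "i \<le> j" "j \<le> \<beta>" "H < l" "l \<le> lev (u i)" "l \<le> lev (v j)"
  shows "leg (u i) l \<noteq> leg (v j) l"
proof
  assume eq: "leg (u i) l = leg (v j) l"
  define z where "z = leg (u i) l"
  have lz: "lev z = l" using leg[of "u i" l] UV(1)[of i] assms by (simp add: z_def)
  define P where "P = (\<lambda>k. i \<le> k \<and> k \<le> j \<and> l \<le> lev (v k) \<and> leg (v k) l = z)"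
  have "P j" using assms eq by (simp add: P_def z_def)
  then have Pk: "P (LEAST k. P k)" by (rule LeastI)
  have min: "\<not> P m" if "m < (LEAST k. P k)" for m using that by (rule not_less_Least)
  define k where "k = (LEAST k. P k)"
  have k: "i \<le> k" "k \<le> j" "l \<le> lev (v k)" "leg (v k) l = z" using Pk by (auto simp: P_def k_def)
  have "k \<noteq> i" using sep[of i l] assms k by (auto simp: z_def)
  then obtain m where m: "k = Suc m" "i \<le> m" using k(1) by (cases k) auto
  have zi: "z \<in> S i" using S_memI(1)[of i l] assms by (simp add: z_def)
  have zj: "z \<in> S j" using S_memI(2)[of j l] assms eq by (simp add: z_def)
  have "z \<in> S m" using S_interval[of i m j z] zi zj m k assms \<alpha> \<beta> by auto
  moreover have "\<not> (l \<le> lev (v m) \<and> leg (v m) l = z)" using min[of m] m k by (auto simp: P_def k_def)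
  ultimately have um: "l \<le> lev (u m)" "leg (u m) l = z"
    using S_level[of m z] m k assms lz by auto
  have "u k = u m \<or> v k = v m" using step_keeps[of m] m k assms \<beta> by auto
  then show False
    using um k sep[of k l] assms \<open>\<not> (l \<le> lev (v m) \<and> leg (v m) l = z)\<close> by auto
qed

lemma cross:
  assumes "\<alpha> \<le> i" "i \<le> \<beta>" "\<alpha> \<le> j" "j \<le> \<beta>" "H < l" "l \<le> lev (u i)" "l \<le> lev (v j)"
  shows "leg (u i) l \<noteq> leg (v j) l"
proof (cases "i \<le> j")
  case True then show ?thesis using cross_le assms by blast
next
  case False
  interpret sw: constant_join V E Tri C lev r v u F N \<alpha> \<beta> H by (rule swapped_const)
  show ?thesis using sw.cross_le[of j i l] assms False by auto
qed

text \<open>Only levels beyond \<open>H\<close> are considered. An edge between the join and a leg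
  can only lead to the next level, by the levels of its ends, and is then an edge of the cycle
  itself.\<close>

definition chord :: "nat \<Rightarrow> nat \<Rightarrow> nat \<Rightarrow> bool" where
  "chord i a b \<longleftrightarrow> H < a \<and> a \<le> lev (u i) \<and> H < b \<and> b \<le> lev (v i) \<and> (a \<noteq> lev (u i) \<or> b \<noteq> lev (v i)) \<and>
     {leg (u i) a, leg (v i) b} \<in> E"

definition chord_edge :: "nat \<Rightarrow> nat \<Rightarrow> nat \<Rightarrow> 'a set" where
  "chord_edge i a b = {leg (u i) a, leg (v i) b}"

lemma leg_lev:
  assumes "\<alpha> \<le> i" "i \<le> \<beta>" "H < l"
  shows "l \<le> lev (u i) \<Longrightarrow> lev (leg (u i) l) = l" "l \<le> lev (v i) \<Longrightarrow> lev (leg (v i) l) = l"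
  using leg[of "u i" l] leg[of "v i" l] UV[of i] assms by auto

text \<open>One end would be the parent of the other, and this parent would lie on both legs beyond
  level \<open>H\<close>.\<close>

lemma chord_edge_not_tree:
  assumes "\<alpha> \<le> i" "i \<le> \<beta>" "H < a" "a \<le> lev (u i)" "H < b" "b \<le> lev (v i)"
  shows "chord_edge i a b \<notin> tree_edges"
proof
  assume "chord_edge i a b \<in> tree_edges"
  then obtain z where z: "z \<in> V" "lev z \<ge> 2" "{leg (u i) a, leg (v i) b} = {parent z, z}"
    unfolding tree_edges_def chord_edge_def by blast
  note lv = leg_lev[OF assms(1,2)]
  have pz: "Suc (lev (parent z)) = lev z" using parent(2)[OF z(1,2)] .
  from z(3) consider "leg (u i) a = parent z" "leg (v i) b = z" | "leg (u i) a = z" "leg (v i) b = parent z"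
    by (auto simp: doubleton_eq_iff)
  then show False
  proof cases
    case 1
    then have ba: "b = Suc a" using lv(1)[of a] lv(2)[of b] pz assms by auto
    then have "leg (v i) a = leg (u i) a" using leg_step[of a "v i"] 1 assms by auto
    then show False using sep[OF assms(1,2), of a] assms ba by auto
  next
    case 2
    then have ba: "a = Suc b" using lv(1)[of a] lv(2)[of b] pz assms by auto
    then have "leg (u i) b = leg (v i) b" using leg_step[of b "u i"] 2 assms by auto
    then show False using sep[OF assms(1,2), of b] assms ba by auto
  qed
qed

lemma chord_edge_eq_edge:
  assumes "\<alpha> \<le> i" "i \<le> \<beta>" "H < a" "a \<le> lev (u i)" "H < b" "b \<le> lev (v i)"
  shows "chord_edge i a b = {u i, v i} \<longleftrightarrow> a = lev (u i) \<and> b = lev (v i)"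
proof
  assume eq: "chord_edge i a b = {u i, v i}"
  have "leg (u i) a \<noteq> v i"
  proof
    assume h: "leg (u i) a = v i"
    then have "a = lev (v i)" using leg_lev(1)[OF assms(1-4)] by simp
    then show False using h sep[OF assms(1,2), of a] assms leg_self[of "v i"] by auto
  qed
  then have "leg (u i) a = u i" "leg (v i) b = v i" using eq by (auto simp: chord_edge_def doubleton_eq_iff)
  then show "a = lev (u i) \<and> b = lev (v i)" using leg_lev[OF assms(1,2)] assms by metis
next
  assume "a = lev (u i) \<and> b = lev (v i)"
  then show "chord_edge i a b = {u i, v i}" by (simp add: chord_edge_def leg_self)
qed

lemma chord_ne:
  assumes "\<alpha> \<le> i" "i \<le> \<beta>" "chord i a b"
  shows "chord_edge i a b \<noteq> {u i, v i}" "chord_edge i a b \<notin> tree_edges" "chord_edge i a b \<in> E"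
  using chord_edge_eq_edge[OF assms(1,2), of a b] chord_edge_not_tree[OF assms(1,2), of a b] assms(3)
  by (auto simp: chord_def chord_edge_def)

text \<open>An outer edge has a single triangle, and an inner non-tree edge with triangles on both
  sides would be the unique non-tree boundary edge of the region.\<close>

lemma in_out:
  assumes "\<alpha> \<le> i" "i \<le> \<beta>" "f \<in> E" "f \<notin> tree_edges" "f \<noteq> {u i, v i}"
  shows "\<not> ((\<exists>t\<in>F i. f \<subseteq> t) \<and> (\<exists>t\<in>Tri - F i. f \<subseteq> t))"
proof
  assume io: "(\<exists>t\<in>F i. f \<subseteq> t) \<and> (\<exists>t\<in>Tri - F i. f \<subseteq> t)"
  have iN: "1 \<le> i" "i \<le> N" using assms \<alpha> \<beta> by auto
  show False
  proof (cases "f \<in> cycle_edges C")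
    case True
    then show ?thesis using io outer_unique F_Tri[OF iN(2)] by blast
  next
    case False
    then have "f \<in> boundary (E - cycle_edges C) Tri (F i)" using io assms(3) by (auto simp: boundary_def)
    then have "f \<in> nontree_bd (F i)" using assms(4) by (simp add: nontree_bd_def)
    then show ?thesis using reg[OF iN] assms(5) by (simp add: Region_def)
  qed
qed

text \<open>By \<open>cross\<close> vertices do not change legs along the interval, so the ends of
  the chord keep their levels and remain on different legs. The chord could only cease to be a chord
  by becoming the edge of member \<open>i\<close>.\<close>

lemma transfer:
  assumes ij: "\<alpha> \<le> i" "i \<le> \<beta>" "\<alpha> \<le> j" "j \<le> \<beta>" and ch: "chord j a b"
    and S: "leg (u j) a \<in> S i" "leg (v j) b \<in> S i" and ne: "chord_edge j a b \<noteq> {u i, v i}"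
  shows "chord i a b \<and> leg (u i) a = leg (u j) a \<and> leg (v i) b = leg (v j) b"
proof -
  have c: "H < a" "a \<le> lev (u j)" "H < b" "b \<le> lev (v j)" "chord_edge j a b \<in> E"
    using ch by (auto simp: chord_def chord_edge_def)
  have lv: "lev (leg (u j) a) = a" "lev (leg (v j) b) = b" using leg_lev[OF ij(3,4)] c by auto
  have 1: "a \<le> lev (u i) \<and> leg (u i) a = leg (u j) a"
    using S_level[OF ij(1,2) S(1)] cross[OF ij(3,4) ij(1,2) c(1,2)] lv by metis
  have 2: "b \<le> lev (v i) \<and> leg (v i) b = leg (v j) b"
    using S_level[OF ij(1,2) S(2)] cross[OF ij(1,2) ij(3,4) c(3) _ c(4)] lv by metis
  have "chord_edge i a b = chord_edge j a b" using 1 2 by (simp add: chord_edge_def)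
  then have "a \<noteq> lev (u i) \<or> b \<noteq> lev (v i)" using chord_edge_eq_edge[OF ij(1,2) c(1) _ c(3)] 1 2 ne by auto
  then show ?thesis using 1 2 c by (auto simp: chord_def chord_edge_def)
qed

text \<open>A chord that left the region would lie in the discarded part or on the removed triangle.
  By \<open>hang\<close> one of its ends would also be on the leg of the new vertex, and the two
  legs of member \<open>Suc k\<close> would meet beyond \<open>H\<close>.\<close>

lemma right_step:
  assumes k: "\<alpha> \<le> k" "Suc k \<le> \<beta>" and ch: "chord k a b" and inn: "\<exists>t\<in>F k. chord_edge k a b \<subseteq> t"
    and ne: "chord_edge k a b \<noteq> {u (Suc k), v (Suc k)}"
  shows "\<exists>t\<in>F (Suc k). chord_edge k a b \<subseteq> t"
proof (rule ccontr)
  assume no: "\<not> ?thesis"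
  have kb: "k \<le> \<beta>" "\<alpha> \<le> Suc k" "k < N" "1 \<le> k" "k \<le> N" using k \<alpha> \<beta> by auto
  note nk = chord_ne[OF k(1) kb(1) ch]
  have c: "H < a" "a \<le> lev (u k)" "H < b" "b \<le> lev (v k)" using ch by (auto simp: chord_def)
  note V = UV(1)[OF k(1) kb(1)] UV(2)[OF k(1) kb(1)]
  obtain s where s: "s \<in> F k" "chord_edge k a b \<subseteq> s" using inn by blast
  obtain w F'' where w0: "F k = insert {u k, v k, w} (F (Suc k) \<union> F'')" "{u k, v k, w} \<notin> F (Suc k)" "{u k, v k, w} \<notin> F''"
     "F (Suc k) \<inter> F'' = {}" "{u k, v k, w} \<in> Tri" "w \<in> V"
     and wc:
     "u (Suc k) = u k \<and> v (Suc k) = w \<and> (F'' = {} \<or> Region w (v k) F'') \<or>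
      u (Suc k) = w \<and> v (Suc k) = v k \<and> (F'' = {} \<or> Region (u k) w F'')"
    using stepE[OF kb(3)] .
  note w = w0(1,6) wc
  have s': "s = {u k, v k, w} \<or> s \<in> F''" using s no w(1) by blast
  have Sk: "leg (u k) a \<in> S k" "leg (v k) b \<in> S k" using S_memI[OF k(1) kb(1)] c by auto
  have "F'' \<subseteq> F k" using w(1) by blast
  then have "\<Union>(Tri - F k) \<subseteq> \<Union>(Tri - F'')" by (intro Union_mono Diff_mono) auto
  then have "S k \<subseteq> \<Union>(Tri - F'')" using S_eq[OF kb(4,5)] by (simp add: le_infI2)
  then have out: "leg (u k) a \<in> \<Union>(Tri - F'')" "leg (v k) b \<in> \<Union>(Tri - F'')"
    using Sk by (simp_all only: subset_iff)
  have xy: "leg (u k) a \<noteq> leg (v k) b" using edge_in_V nk(3) by (simp add: chord_edge_def)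
  from w(3) show False
  proof
    assume A: "u (Suc k) = u k \<and> v (Suc k) = w \<and> (F'' = {} \<or> Region w (v k) F'')"
    have "a \<le> lev w \<and> leg w a = leg (u k) a"
      by (rule hang[OF V w(2) _ c(1,2) refl xy, where s = s and F'' = F''])
         (use sep[OF k(1) kb(1)] nk(1) ne A s(2) s' out(1) in \<open>auto simp: chord_edge_def\<close>)
    then show False using sep[OF kb(2) k(2) c(1)] c A by auto
  next
    assume A: "u (Suc k) = w \<and> v (Suc k) = v k \<and> (F'' = {} \<or> Region (u k) w F'')"
    have "b \<le> lev w \<and> leg w b = leg (v k) b"
    proof (rule hang[OF V(2,1) w(2) _ c(3,4) refl xy[symmetric], where s = s and F'' = F''])
      show "leg (v k) l \<noteq> leg (u k) l" if "H < l" "l \<le> lev (v k)" "l \<le> lev (u k)" for l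
        using sep[OF k(1) kb(1)] that by metis
      show "s = {v k, u k, w} \<or> s \<in> F'' \<and> Region w (u k) F'' \<and> leg (v k) b \<in> \<Union> (Tri - F'')"
        using s' A out(2) Region_commute by (auto simp: insert_commute)
    qed (use nk(1) ne A s(2) in \<open>auto simp: chord_edge_def insert_commute\<close>)
    then show False using sep[OF kb(2) k(2) c(3)] c A by auto
  qed
qed

text \<open>Read backwards, the step passes through the same triangle, with the end dropped by the
  chain as its third vertex. By \<open>hang\<close> a chord that left the complement would make the
  two legs of member \<open>k\<close> meet beyond \<open>H\<close>.\<close>

lemma left_step:
  assumes k: "\<alpha> \<le> k" "Suc k \<le> \<beta>" and ch: "chord (Suc k) a b" and out: "\<exists>t\<in>Tri - F (Suc k). chord_edge (Suc k) a b \<subseteq> t"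
    and ne: "chord_edge (Suc k) a b \<noteq> {u k, v k}"
  shows "\<exists>t\<in>Tri - F k. chord_edge (Suc k) a b \<subseteq> t"
proof (rule ccontr)
  assume no: "\<not> ?thesis"
  have kb: "k \<le> \<beta>" "\<alpha> \<le> Suc k" "k < N" "1 \<le> Suc k" "Suc k \<le> N" using k \<alpha> \<beta> by auto
  note nk = chord_ne[OF kb(2) k(2) ch]
  have c: "H < a" "a \<le> lev (u (Suc k))" "H < b" "b \<le> lev (v (Suc k))" using ch by (auto simp: chord_def)
  note V = UV(1)[OF kb(2) k(2)] UV(2)[OF kb(2) k(2)]
  note V' = UV(1)[OF k(1) kb(1)] UV(2)[OF k(1) kb(1)]
  obtain s where s: "s \<in> Tri - F (Suc k)" "chord_edge (Suc k) a b \<subseteq> s" using out by blast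
  obtain w F'' where w0: "F k = insert {u k, v k, w} (F (Suc k) \<union> F'')" "{u k, v k, w} \<notin> F (Suc k)" "{u k, v k, w} \<notin> F''"
     "F (Suc k) \<inter> F'' = {}" "{u k, v k, w} \<in> Tri" "w \<in> V"
     and wc:
     "u (Suc k) = u k \<and> v (Suc k) = w \<and> (F'' = {} \<or> Region w (v k) F'') \<or>
      u (Suc k) = w \<and> v (Suc k) = v k \<and> (F'' = {} \<or> Region (u k) w F'')"
    using stepE[OF kb(3)] .
  note w = w0(1,4,6) wc
  have "s \<in> F k" using s no by blast
  then have s': "s = {u k, v k, w} \<or> s \<in> F''" using s(1) w(1) by blast
  have Sk: "leg (u (Suc k)) a \<in> S (Suc k)" "leg (v (Suc k)) b \<in> S (Suc k)" using S_memI[OF kb(2) k(2)] c by auto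
  have "F (Suc k) \<subseteq> Tri - F''" using w(2) F_Tri[OF kb(5)] by blast
  then have "\<Union>(F (Suc k)) \<subseteq> \<Union>(Tri - F'')" by (rule Union_mono)
  then have "S (Suc k) \<subseteq> \<Union>(Tri - F'')" using S_eq[OF kb(4,5)] by (simp add: le_infI1)
  then have out': "leg (u (Suc k)) a \<in> \<Union>(Tri - F'')" "leg (v (Suc k)) b \<in> \<Union>(Tri - F'')"
    using Sk by (simp_all only: subset_iff)
  have xy: "leg (u (Suc k)) a \<noteq> leg (v (Suc k)) b" using edge_in_V nk(3) by (simp add: chord_edge_def)
  from w(4) show False
  proof
    assume A: "u (Suc k) = u k \<and> v (Suc k) = w \<and> (F'' = {} \<or> Region w (v k) F'')"
    have "a \<le> lev (v k) \<and> leg (v k) a = leg (u (Suc k)) a"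
    proof (rule hang[OF V V'(2) _ c(1,2) refl xy, where s = s and F'' = F''])
      show "s = {u (Suc k), v (Suc k), v k} \<or> s \<in> F'' \<and> Region (v k) (v (Suc k)) F'' \<and> leg (u (Suc k)) a \<in> \<Union> (Tri - F'')"
        using s' A out'(1) Region_commute by (auto simp: insert_commute)
    qed (use sep[OF kb(2) k(2)] nk(1) ne A s(2) in \<open>auto simp: chord_edge_def\<close>)
    then show False using sep[OF k(1) kb(1) c(1)] c A by auto
  next
    assume A: "u (Suc k) = w \<and> v (Suc k) = v k \<and> (F'' = {} \<or> Region (u k) w F'')"
    have "b \<le> lev (u k) \<and> leg (u k) b = leg (v (Suc k)) b"
    proof (rule hang[OF V(2,1) V'(1) _ c(3,4) refl xy[symmetric], where s = s and F'' = F''])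
      show "leg (v (Suc k)) l \<noteq> leg (u (Suc k)) l" if "H < l" "l \<le> lev (v (Suc k))" "l \<le> lev (u (Suc k))" for l
        using sep[OF kb(2) k(2)] that by metis
      show "s = {v (Suc k), u (Suc k), u k} \<or> s \<in> F'' \<and> Region (u k) (u (Suc k)) F'' \<and> leg (v (Suc k)) b \<in> \<Union> (Tri - F'')"
        using s' A out'(2) by (auto simp: insert_commute)
    qed (use nk(1) ne A s(2) in \<open>auto simp: chord_edge_def insert_commute\<close>)
    then show False using sep[OF k(1) kb(1) c(3)] c A by auto
  qed
qed

text \<open>The triangle at the chord keeps the ends of the chord on triangles of the next region,
  and monotonicity keeps them on triangles of its complement. So they stay on the separator and the
  chord transfers.\<close>

lemma right_persist:
  assumes j: "\<alpha> \<le> j" "chord j a b" "\<exists>t\<in>F j. chord_edge j a b \<subseteq> t"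
    and i: "j \<le> i" "i \<le> \<beta>" and ne: "\<And>k. j < k \<Longrightarrow> k \<le> i \<Longrightarrow> chord_edge j a b \<noteq> {u k, v k}"
  shows "(\<exists>t\<in>F i. chord_edge j a b \<subseteq> t) \<and> chord i a b \<and> leg (u i) a = leg (u j) a \<and> leg (v i) b = leg (v j) b"
  using i ne
proof (induction i rule: dec_induct)
  case base
  then show ?case using j by simp
next
  case (step k)
  then have IH: "\<exists>t\<in>F k. chord_edge j a b \<subseteq> t" "chord k a b" "leg (u k) a = leg (u j) a" "leg (v k) b = leg (v j) b" by auto
  then have ck: "chord_edge k a b = chord_edge j a b" by (simp add: chord_edge_def)
  have b: "\<alpha> \<le> k" "Suc k \<le> \<beta>" "\<alpha> \<le> Suc k" "k \<le> \<beta>" "1 \<le> k" "k \<le> N" "1 \<le> Suc k" "Suc k \<le> N"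
    using step j \<alpha> \<beta> by auto
  have ne': "chord_edge k a b \<noteq> {u (Suc k), v (Suc k)}" using step ck by auto
  have in': "\<exists>t\<in>F (Suc k). chord_edge k a b \<subseteq> t" using right_step[OF b(1,2) IH(2) _ ne'] IH(1) ck by simp
  have c: "H < a" "a \<le> lev (u k)" "H < b" "b \<le> lev (v k)" using IH(2) by (auto simp: chord_def)
  have "\<Union>(Tri - F k) \<subseteq> \<Union>(Tri - F (Suc k))" using F_dec[of k "Suc k"] b by (intro Union_mono Diff_mono) auto
  then have "S k \<subseteq> \<Union>(Tri - F (Suc k))" using S_eq[OF b(5,6)] by (simp add: le_infI2)
  moreover have "leg (u k) a \<in> S k" "leg (v k) b \<in> S k" using S_memI[OF b(1,4)] c by auto
  moreover have "leg (u k) a \<in> \<Union>(F (Suc k))" "leg (v k) b \<in> \<Union>(F (Suc k))"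
    using in' unfolding chord_edge_def by blast+
  ultimately have "leg (u k) a \<in> S (Suc k)" "leg (v k) b \<in> S (Suc k)"
    unfolding S_eq[OF b(7,8)] by blast+
  then show ?case using transfer[OF b(3,2) b(1,4) IH(2) _ _ ne'] in' IH ck by auto
qed

text \<open>To the left the complements shrink, so region and complement exchange their roles
  compared with \<open>right_persist\<close>.\<close>

lemma left_persist:
  assumes j: "j \<le> \<beta>" "chord j a b" "\<exists>t\<in>Tri - F j. chord_edge j a b \<subseteq> t"
    and i: "i \<le> j" "\<alpha> \<le> i" and ne: "\<And>k. i \<le> k \<Longrightarrow> k < j \<Longrightarrow> chord_edge j a b \<noteq> {u k, v k}"
  shows "(\<exists>t\<in>Tri - F i. chord_edge j a b \<subseteq> t) \<and> chord i a b \<and> leg (u i) a = leg (u j) a \<and> leg (v i) b = leg (v j) b"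
  using i ne
proof (induction i rule: inc_induct)
  case base
  then show ?case using j by simp
next
  case (step k)
  then have IH: "\<exists>t\<in>Tri - F (Suc k). chord_edge j a b \<subseteq> t" "chord (Suc k) a b" "leg (u (Suc k)) a = leg (u j) a"
    "leg (v (Suc k)) b = leg (v j) b" by auto
  then have ck: "chord_edge (Suc k) a b = chord_edge j a b" by (simp add: chord_edge_def)
  have b: "\<alpha> \<le> k" "Suc k \<le> \<beta>" "\<alpha> \<le> Suc k" "k \<le> \<beta>" "1 \<le> k" "k \<le> N" "1 \<le> Suc k" "Suc k \<le> N"
    using step j \<alpha> \<beta> by auto
  have ne': "chord_edge (Suc k) a b \<noteq> {u k, v k}" using step ck by auto
  have out': "\<exists>t\<in>Tri - F k. chord_edge (Suc k) a b \<subseteq> t" using left_step[OF b(1,2) IH(2) _ ne'] IH(1) ck by simp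
  have c: "H < a" "a \<le> lev (u (Suc k))" "H < b" "b \<le> lev (v (Suc k))" using IH(2) by (auto simp: chord_def)
  have "\<Union>(F (Suc k)) \<subseteq> \<Union>(F k)" using F_dec[of k "Suc k"] b by (intro Union_mono) auto
  then have "S (Suc k) \<subseteq> \<Union>(F k)" using S_eq[OF b(7,8)] by (simp add: le_infI1)
  moreover have "leg (u (Suc k)) a \<in> S (Suc k)" "leg (v (Suc k)) b \<in> S (Suc k)" using S_memI[OF b(3,2)] c by auto
  moreover have "leg (u (Suc k)) a \<in> \<Union>(Tri - F k)" "leg (v (Suc k)) b \<in> \<Union>(Tri - F k)"
    using out' unfolding chord_edge_def by blast+
  ultimately have "leg (u (Suc k)) a \<in> S k" "leg (v (Suc k)) b \<in> S k"
    unfolding S_eq[OF b(5,6)] by blast+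
  then show ?case using transfer[OF b(1,4) b(3,2) IH(2) _ _ ne'] out' IH ck by auto
qed

end

section \<open>Selecting subsequences by counting\<close>

lemma pigeonhole_class:
  assumes "finite J" "f ` J \<subseteq> K" "finite K" "card K * t \<le> card J" "J \<noteq> {}"
  obtains y where "y \<in> K" "t \<le> card {j \<in> J. f j = y}"
proof -
  have "\<exists>y\<in>K. t \<le> card {j \<in> J. f j = y}"
  proof (rule ccontr)
    assume "\<not> ?thesis"
    then have lt: "card {j \<in> J. f j = y} < t" if "y \<in> K" for y using that by auto
    have Kne: "K \<noteq> {}" using assms(2,5) by auto
    have "J = (\<Union>y\<in>K. {j \<in> J. f j = y})" using assms(2) by auto
    then have "card J \<le> (\<Sum>y\<in>K. card {j \<in> J. f j = y})" using card_UN_le[OF assms(3)] by metis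
    also have "\<dots> < (\<Sum>y\<in>K. t)"
      by (rule sum_strict_mono[OF assms(3) Kne lt])
    finally show False using assms(4) by simp
  qed
  then show ?thesis using that by blast
qed

text \<open>
  Either the minimum is attained \<open>s\<close> times, or one of \<open>s\<close> equal blocks avoids it.
\<close>

lemma repeated_minimum:
  fixes m :: "nat \<Rightarrow> nat"
  assumes "s \<ge> 1" "s ^ q \<le> L" "\<And>i. a \<le> i \<Longrightarrow> i < a + L \<Longrightarrow> lo \<le> m i \<and> m i < lo + q"
  shows "\<exists>a' b' J c. a \<le> a' \<and> b' \<le> a + L \<and> J \<subseteq> {a'..<b'} \<and> s \<le> card J \<and>
           (\<forall>i\<in>{a'..<b'}. c \<le> m i) \<and> (\<forall>j\<in>J. m j = c)"
  using assms
proof (induction q arbitrary: a L lo)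
  case 0
  then have "a < a + L" by simp
  then show ?case using "0.prems"(3)[of a] by simp
next
  case (Suc q)
  define Z where "Z = {i \<in> {a..<a + L}. m i = lo}"
  show ?case
  proof (cases "s \<le> card Z")
    case True
    then show ?thesis using Suc.prems(3)
      by (intro exI[of _ a] exI[of _ "a + L"] exI[of _ Z] exI[of _ lo]) (auto simp: Z_def)
  next
    case False
    define w where "w = s ^ q"
    have w1: "w \<ge> 1" using Suc.prems(1) by (simp add: w_def)
    have "\<exists>k<s. \<forall>i. a + k * w \<le> i \<longrightarrow> i < a + Suc k * w \<longrightarrow> i \<notin> Z"
    proof (rule ccontr)
      assume "\<not> ?thesis"
      then have "\<forall>k<s. \<exists>i. a + k * w \<le> i \<and> i < a + Suc k * w \<and> i \<in> Z" by blast
      then obtain z where z: "\<And>k. k < s \<Longrightarrow> a + k * w \<le> z k \<and> z k < a + Suc k * w \<and> z k \<in> Z" by metis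
      \<comment> \<open>The number of the block can be recovered from an index in it, so picking one
        minimum from each of the \<open>s\<close> blocks would give \<open>s\<close> distinct
        indices.\<close>
      have dv: "(z k - a) div w = k" if "k < s" for k
        using z[OF that] by (intro div_nat_eqI) (auto simp: algebra_simps)
      have "inj_on z {..<s}" by (rule inj_onI) (metis dv lessThan_iff)
      then have "card {..<s} \<le> card Z" using z by (intro card_inj_on_le) (auto simp: Z_def)
      then show False using False by simp
    qed
    then obtain k where k: "k < s" "\<And>i. a + k * w \<le> i \<Longrightarrow> i < a + Suc k * w \<Longrightarrow> i \<notin> Z" by blast
    have "Suc k * w \<le> s * w" using k(1) by (intro mult_le_mono1) simp
    then have kw: "k * w + w \<le> L" using Suc.prems(2) by (simp add: w_def)
    have "\<exists>a' b' J c. a + k * w \<le> a' \<and> b' \<le> (a + k * w) + w \<and> J \<subseteq> {a'..<b'} \<and> s \<le> card J \<and>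
           (\<forall>i\<in>{a'..<b'}. c \<le> m i) \<and> (\<forall>j\<in>J. m j = c)"
    proof (rule Suc.IH[where lo = "Suc lo"])
      fix i assume i: "a + k * w \<le> i" "i < a + k * w + w"
      then have "i \<notin> Z" "a \<le> i" "i < a + L" using k(2)[of i] kw by (auto simp: algebra_simps)
      then show "Suc lo \<le> m i \<and> m i < Suc lo + q" using Suc.prems(3)[of i] by (auto simp: Z_def)
    qed (use Suc.prems(1) in \<open>auto simp: w_def\<close>)
    then obtain a' b' J c where *: "a + k * w \<le> a'" "b' \<le> (a + k * w) + w" "J \<subseteq> {a'..<b'}" "s \<le> card J"
           "\<forall>i\<in>{a'..<b'}. c \<le> m i" "\<forall>j\<in>J. m j = c" by blast
    moreover have "a \<le> a'" "b' \<le> a + L" using *(1,2) kw by auto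
    ultimately show ?thesis by blast
  qed
qed

text \<open>By pigeonhole some value is taken at least \<open>M\<close> times, and by monotonicity
  \<open>h\<close> is constant between the first and the last time.\<close>

lemma constant_interval:
  fixes h :: "nat \<Rightarrow> nat"
  assumes mono: "\<And>i j. 1 \<le> i \<Longrightarrow> i \<le> j \<Longrightarrow> j \<le> N \<Longrightarrow> h i \<le> h j"
    and bnd: "\<And>i. 1 \<le> i \<Longrightarrow> i \<le> N \<Longrightarrow> h i < r" and M: "M \<ge> 1" "r * M \<le> N" "r \<ge> 1"
  obtains a b H where "1 \<le> a" "b \<le> N" "a + M \<le> Suc b" "\<And>i. a \<le> i \<Longrightarrow> i \<le> b \<Longrightarrow> h i = H"
proof -
  have N1: "N \<ge> 1" using M by (metis le_trans mult_le_mono nat_mult_1)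
  obtain H where H: "M \<le> card {j \<in> {1..N}. h j = H}"
  proof (rule pigeonhole_class[of "{1..N}" h "{..<r}" M])
    show "h ` {1..N} \<subseteq> {..<r}" using bnd by auto
  qed (use M N1 in auto)
  define A where "A = {j \<in> {1..N}. h j = H}"
  have MA: "M \<le> card A" using H unfolding A_def .
  then have "card A \<noteq> 0" using M(1) by linarith
  then have fin: "finite A" "A \<noteq> {}" by (auto simp: A_def)
  have mA: "Min A \<in> A" "Max A \<in> A" using fin by auto
  have "A \<subseteq> {Min A..Max A}" using fin by auto
  then have "card A \<le> Suc (Max A) - Min A" using card_mono[of "{Min A..Max A}" A] by simp
  then have "Min A + M \<le> Suc (Max A)" using MA M(1) by linarith
  moreover have "h i = H" if "Min A \<le> i" "i \<le> Max A" for i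
    using mono[of "Min A" i] mono[of i "Max A"] mA that by (auto simp: A_def)
  moreover have "1 \<le> Min A" "Max A \<le> N" using mA unfolding A_def by simp_all
  ultimately show ?thesis by (intro that[of "Min A" "Max A" H])
qed

lemma increasing_enumeration:
  fixes J :: "nat set"
  assumes "finite J" "t \<le> card J"
  obtains \<sigma> where "\<And>i. 1 \<le> i \<Longrightarrow> i \<le> t \<Longrightarrow> \<sigma> i \<in> J" "\<And>i j. 1 \<le> i \<Longrightarrow> i < j \<Longrightarrow> j \<le> t \<Longrightarrow> \<sigma> i < \<sigma> j"
proof -
  define xs where "xs = sorted_list_of_set J"
  have xs: "set xs = J" "length xs = card J" "sorted_wrt (<) xs"
    using assms by (auto simp: xs_def)
  show ?thesis
  proof (rule that[of "\<lambda>i. xs ! (i - 1)"])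
    show "xs ! (i - 1) \<in> J" if "1 \<le> i" "i \<le> t" for i
      using nth_mem[of "i - 1" xs] xs assms that by auto
    show "xs ! (i - 1) < xs ! (j - 1)" if "1 \<le> i" "i < j" "j \<le> t" for i j
      using sorted_wrt_nth_less[OF xs(3), of "i - 1" "j - 1"] xs assms that by auto
  qed
qed

section \<open>Assembling well-formed separator sequences\<close>

context leveled_disk
begin

lemma leg_path_nth:
  assumes "k < (Suc (lev u) - m) + (Suc (lev v) - m)"
  shows "leg_path u v m m ! k = (if k < Suc (lev u) - m then leg u (m + k) else leg v (lev v - (k - (Suc (lev u) - m))))"
proof (cases "k < Suc (lev u) - m")
  case True
  then show ?thesis by (simp add: leg_path_def nth_append nth_map nth_upt del: upt_Suc)
next
  case False
  define i where "i = k - (Suc (lev u) - m)"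
  have i: "i < Suc (lev v) - m" using assms False by (simp add: i_def)
  have "leg_path u v m m ! k = rev (map (leg v) [m..<Suc (lev v)]) ! i"
    using False by (simp add: leg_path_def nth_append i_def del: upt_Suc)
  also have "\<dots> = leg v (m + (Suc (lev v) - m - Suc i))" using i by (simp add: rev_nth nth_upt del: upt_Suc)
  also have "m + (Suc (lev v) - m - Suc i) = lev v - i" using i by simp
  finally show ?thesis using False by (simp add: i_def)
qed

lemma leg_path_both:
  assumes "a \<le> lev u" "a \<le> lev v"
  shows "leg_path u v a a = leg u a # leg_path u v (Suc a) (Suc a) @ [leg v a]"
  using assms by (simp add: leg_path_def upt_conv_Cons del: upt_Suc)

lemma leg_path_left:
  assumes "a \<le> lev u"
  shows "leg_path u v a (Suc a) = leg u a # leg_path u v (Suc a) (Suc a)"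
  using assms by (simp add: leg_path_def upt_conv_Cons del: upt_Suc)

text \<open>With the levels \<open>p1\<close> and \<open>p2\<close> of the ends fixed, the position
  alone determines the leg and the level. Equal vertices have equal levels and, as first legs never
  meet second legs, the same position. These are the two conditions on labels in a well-formed
  sequence.\<close>

lemma labels:
  fixes us vs :: "nat \<Rightarrow> 'a"
  assumes V0: "\<forall>i\<in>{1..t}. us i \<in> V \<and> vs i \<in> V \<and> lev (us i) = p1 \<and> lev (vs i) = p2"
    and m: "1 \<le> m"
    and cross0: "\<forall>i\<in>{1..t}. \<forall>j\<in>{1..t}. \<forall>l. m \<le> l \<longrightarrow> l \<le> p1 \<longrightarrow> l \<le> p2 \<longrightarrow> leg (us i) l \<noteq> leg (vs j) l"
    and q: "q = (Suc p1 - m) + (Suc p2 - m)"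
  defines "vf \<equiv> \<lambda>i k. leg_path (us i) (vs i) m m ! (k - 1)"
  shows "\<forall>i\<in>{1..t}. \<forall>j\<in>{1..t}. \<forall>k\<in>{1..q}. \<forall>l\<in>{1..q}. vf i k = vf j l \<longrightarrow> k = l"
    and "\<forall>i\<in>{1..t}. \<forall>j\<in>{1..t}. \<forall>k\<in>{1..q}. lev (vf i k) = lev (vf j k) \<and> vf i k \<in> V \<and> vf j k \<in> V"
    and "\<forall>i\<in>{1..t}. map (vf i) [1..<q + 1] = leg_path (us i) (vs i) m m"
proof -
  have V: "us i \<in> V \<and> vs i \<in> V \<and> lev (us i) = p1 \<and> lev (vs i) = p2" if "i \<in> {1..t}" for i
    using V0 that by blast
  have cross: "leg (us i) l \<noteq> leg (vs j) l" if "i \<in> {1..t}" "j \<in> {1..t}" "m \<le> l" "l \<le> p1" "l \<le> p2" for i j l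
    using cross0 that by blast
  define n1 where "n1 = Suc p1 - m"
  \<comment> \<open>The level at position \<open>k\<close>: increasing from \<open>m\<close> on the
    first leg, which has \<open>n1\<close> vertices, then decreasing from \<open>p2\<close> on the
    second. Positions start at 1, hence \<open>k - 1\<close>.\<close>
  define lv where "lv = (\<lambda>k. if k - 1 < n1 then m + (k - 1) else p2 - (k - 1 - n1))"
  have vf: "vf i k = (if k - 1 < n1 then leg (us i) (lv k) else leg (vs i) (lv k)) \<and> lev (vf i k) = lv k \<and>
      vf i k \<in> V \<and> m \<le> lv k \<and> (if k - 1 < n1 then lv k \<le> p1 else lv k \<le> p2)"
    if "i \<in> {1..t}" "k \<in> {1..q}" for i k
  proof -
    have k: "k - 1 < (Suc (lev (us i)) - m) + (Suc (lev (vs i)) - m)" using that V[OF that(1)] q by auto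
    have eq: "vf i k = (if k - 1 < n1 then leg (us i) (lv k) else leg (vs i) (lv k))"
      using leg_path_nth[OF k] V[OF that(1)] by (simp add: vf_def n1_def lv_def)
    have b: "m \<le> lv k" "k - 1 < n1 \<Longrightarrow> lv k \<le> p1" "\<not> k - 1 < n1 \<Longrightarrow> lv k \<le> p2"
      using that q by (auto simp: lv_def n1_def)
    then show ?thesis using eq leg[of "us i" "lv k"] leg[of "vs i" "lv k"] V[OF that(1)] m by auto
  qed
  show "\<forall>i\<in>{1..t}. \<forall>j\<in>{1..t}. \<forall>k\<in>{1..q}. \<forall>l\<in>{1..q}. vf i k = vf j l \<longrightarrow> k = l"
  proof (intro ballI impI)
    fix i j k l assume h: "i \<in> {1..t}" "j \<in> {1..t}" "k \<in> {1..q}" "l \<in> {1..q}" "vf i k = vf j l"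
    have lvl: "lv k = lv l" using vf[OF h(1,3)] vf[OF h(2,4)] h(5) by metis
    show "k = l"
    proof (cases "k - 1 < n1 \<longleftrightarrow> l - 1 < n1")
      case True
      show ?thesis
      proof (cases "k - 1 < n1")
        case True
        then have "m + (k - 1) = m + (l - 1)" using lvl \<open>k - 1 < n1 \<longleftrightarrow> l - 1 < n1\<close> by (simp add: lv_def)
        then show ?thesis using h(3,4) by auto
      next
        case False
        then have "p2 - (k - 1 - n1) = p2 - (l - 1 - n1)" "n1 \<le> k - 1" "n1 \<le> l - 1"
          using lvl \<open>k - 1 < n1 \<longleftrightarrow> l - 1 < n1\<close> by (simp_all add: lv_def)
        moreover have "k - 1 - n1 \<le> p2" "l - 1 - n1 \<le> p2" using h(3,4) q m by (auto simp: n1_def)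
        ultimately have "k - 1 = l - 1" by linarith
        then show ?thesis using h(3,4) by auto
      qed
    next
      case False
      then show ?thesis using vf[OF h(1,3)] vf[OF h(2,4)] h(5) lvl cross[OF h(1,2), of "lv k"] cross[OF h(2,1), of "lv k"]
        by (auto split: if_splits)
    qed
  qed
  show "\<forall>i\<in>{1..t}. \<forall>j\<in>{1..t}. \<forall>k\<in>{1..q}. lev (vf i k) = lev (vf j k) \<and> vf i k \<in> V \<and> vf j k \<in> V"
  proof (intro ballI)
    fix i j k assume "i \<in> {1..t}" "j \<in> {1..t}" "k \<in> {1..q}"
    then show "lev (vf i k) = lev (vf j k) \<and> vf i k \<in> V \<and> vf j k \<in> V" using vf[of i k] vf[of j k] by metis
  qed
  have "map (vf i) [1..<q + 1] = leg_path (us i) (vs i) m m" if "i \<in> {1..t}" for i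
  proof (rule nth_equalityI)
    show "length (map (vf i) [1..<q + 1]) = length (leg_path (us i) (vs i) m m)"
      using V[OF that] by (simp add: length_leg_path q del: upt_Suc)
    show "map (vf i) [1..<q + 1] ! k = leg_path (us i) (vs i) m m ! k" if "k < length (map (vf i) [1..<q + 1])" for k
      using that by (simp add: vf_def nth_upt del: upt_Suc)
  qed
  then show "\<forall>i\<in>{1..t}. map (vf i) [1..<q + 1] = leg_path (us i) (vs i) m m" by blast
qed

text \<open>Only strictness needs an argument: the sizes of \<open>A i\<close> and
  \<open>B i\<close> add up to \<open>card V + p\<close>, so if one inclusion were an equality, the
  other would be as well, and consecutive separators would coincide.\<close>

lemma separators_common:
  fixes t :: nat
  assumes X0: "\<forall>i\<in>{1..t}. X i \<subseteq> Tri \<and> \<Union>(X i) \<inter> \<Union>(Tri - X i) = S i \<and> card (S i) = p"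
    and dec0: "\<forall>i\<in>{1..<t}. X (i + 1) \<subseteq> X i \<and> S i \<noteq> S (i + 1)"
  defines "A \<equiv> \<lambda>i. \<Union>(Tri - X i)" and "B \<equiv> \<lambda>i. \<Union>(X i)"
  shows "\<forall>i\<in>{1..t}. V = A i \<union> B i"
    and "\<forall>i\<in>{1..t}. \<forall>a\<in>A i - B i. \<forall>b\<in>B i - A i. {a, b} \<notin> E"
    and "\<forall>i\<in>{1..t}. S i = A i \<inter> B i \<and> card (S i) = p"
    and "\<forall>i\<in>{1..<t}. A i \<subset> A (i + 1) \<and> B (i + 1) \<subset> B i"
proof -
  have X: "X i \<subseteq> Tri" "\<Union>(X i) \<inter> \<Union>(Tri - X i) = S i" "card (S i) = p" if "i \<in> {1..t}" for i
    using X0 that by blast+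
  have dec: "X (i + 1) \<subseteq> X i" "S i \<noteq> S (i + 1)" if "i \<in> {1..<t}" for i using dec0 that by blast+
  show VAB: "\<forall>i\<in>{1..t}. V = A i \<union> B i"
  proof
    fix i assume i: "i \<in> {1..t}"
    have "A i \<union> B i = \<Union>Tri" using X(1)[OF i] unfolding A_def B_def by blast
    then show "V = A i \<union> B i" using vertex_Tri Tri_sub_V by auto
  qed
  show "\<forall>i\<in>{1..t}. \<forall>a\<in>A i - B i. \<forall>b\<in>B i - A i. {a, b} \<notin> E"
  proof (intro ballI notI)
    fix i a b assume h: "i \<in> {1..t}" "a \<in> A i - B i" "b \<in> B i - A i" "{a, b} \<in> E"
    then obtain t where "t \<in> Tri" "{a, b} \<subseteq> t" using edge_Tri by blast
    then show False using h(2,3) unfolding A_def B_def by blast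
  qed
  show SAB: "\<forall>i\<in>{1..t}. S i = A i \<inter> B i \<and> card (S i) = p"
  proof
    fix i assume i: "i \<in> {1..t}"
    show "S i = A i \<inter> B i \<and> card (S i) = p" using X(2,3)[OF i] unfolding A_def B_def by (simp add: Int_commute)
  qed
  have fin: "finite (A i)" "finite (B i)" if "i \<in> {1..t}" for i
    using VAB that finite_V by (metis finite_Un)+
  have sum: "card (A i) + card (B i) = card V + p" if "i \<in> {1..t}" for i
    using card_Un_Int[OF fin[OF that]] VAB SAB that by metis
  show "\<forall>i\<in>{1..<t}. A i \<subset> A (i + 1) \<and> B (i + 1) \<subset> B i"
  proof
    fix i assume i: "i \<in> {1..<t}"
    then have i1: "i \<in> {1..t}" "i + 1 \<in> {1..t}" by auto
    have sub: "A i \<subseteq> A (i + 1)" "B (i + 1) \<subseteq> B i" using dec(1)[OF i] unfolding A_def B_def by blast+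
    have "A i \<noteq> A (i + 1) \<and> B i \<noteq> B (i + 1)"
    proof (rule ccontr)
      assume "\<not> ?thesis"
      then have "card (A i) = card (A (i + 1)) \<and> card (B i) = card (B (i + 1))"
        using sum[OF i1(1)] sum[OF i1(2)] by auto
      then have "A i = A (i + 1)" "B (i + 1) = B i"
        using card_subset_eq[OF fin(1)[OF i1(2)] sub(1)] card_subset_eq[OF fin(2)[OF i1(1)] sub(2)] by auto
      then show False using SAB i1 dec(2)[OF i] by metis
    qed
    then show "A i \<subset> A (i + 1) \<and> B (i + 1) \<subset> B i" using sub by blast
  qed
qed

lemma two_per_layer:
  assumes "u \<in> V" "v \<in> V" "1 \<le> a" "1 \<le> b"
  shows "card {x \<in> set (leg_path u v a b). lev x = m} \<le> 2"
proof -
  have "{x \<in> set (leg_path u v a b). lev x = m} \<subseteq> {leg u m, leg v m}"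
    using leg[OF assms(1)] leg[OF assms(2)] assms(3,4) by (auto simp: set_leg_path)
  then have "card {x \<in> set (leg_path u v a b). lev x = m} \<le> card {leg u m, leg v m}" by (rule card_mono[rotated]) simp
  also have "\<dots> \<le> 2" by (simp add: card_insert_if)
  finally show ?thesis .
qed

text \<open>The case of join level 0, in which both legs extend to the first layer and are labelled
  as a whole.\<close>

lemma wfs_path:
  fixes us vs :: "nat \<Rightarrow> 'a" and G :: "'a drawn_graph"
  assumes G: "vertices G = V" "edges G = E" "\<And>x m. x \<in> layer G m \<longleftrightarrow> x \<in> V \<and> lev x = m"
    and V: "\<And>i. i \<in> {1..t} \<Longrightarrow> us i \<in> V \<and> vs i \<in> V \<and> lev (us i) = p1 \<and> lev (vs i) = p2"
    and cross: "\<And>i j l. i \<in> {1..t} \<Longrightarrow> j \<in> {1..t} \<Longrightarrow> 1 \<le> l \<Longrightarrow> l \<le> p1 \<Longrightarrow> l \<le> p2 \<Longrightarrow> leg (us i) l \<noteq> leg (vs j) l"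
    and X: "\<And>i. i \<in> {1..t} \<Longrightarrow> X i \<subseteq> Tri"
      "\<And>i. i \<in> {1..t} \<Longrightarrow> \<Union>(X i) \<inter> \<Union>(Tri - X i) = set (leg_path (us i) (vs i) 1 1)"
    and dec: "\<And>i. i \<in> {1..<t} \<Longrightarrow> X (i + 1) \<subseteq> X i"
    and ne: "\<And>i. i \<in> {1..<t} \<Longrightarrow> set (leg_path (us i) (vs i) 1 1) \<noteq> set (leg_path (us (i + 1)) (vs (i + 1)) 1 1)"
    and ind: "\<And>i. i \<in> {1..t} \<Longrightarrow> {e \<in> E. e \<subseteq> set (leg_path (us i) (vs i) 1 1)} = walk_edges (leg_path (us i) (vs i) 1 1)"
    and p12: "1 \<le> p1" "1 \<le> p2"
  shows "well_formed_separator_sequence G t (p1 + p2) (\<lambda>i. \<Union>(Tri - X i)) (\<lambda>i. set (leg_path (us i) (vs i) 1 1)) (\<lambda>i. \<Union>(X i))"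
proof -
  define L where "L = (\<lambda>i. leg_path (us i) (vs i) 1 1)"
  define q where "q = p1 + p2"
  define vf where "vf = (\<lambda>i k. leg_path (us i) (vs i) 1 1 ! (k - 1))"
  have qq: "q = (Suc p1 - 1) + (Suc p2 - 1)" by (simp add: q_def)
  have V0: "\<forall>i\<in>{1..t}. us i \<in> V \<and> vs i \<in> V \<and> lev (us i) = p1 \<and> lev (vs i) = p2" using V by blast
  have cross0: "\<forall>i\<in>{1..t}. \<forall>j\<in>{1..t}. \<forall>l. 1 \<le> l \<longrightarrow> l \<le> p1 \<longrightarrow> l \<le> p2 \<longrightarrow> leg (us i) l \<noteq> leg (vs j) l"
    using cross by blast
  have lab1: "\<forall>i\<in>{1..t}. \<forall>j\<in>{1..t}. \<forall>k\<in>{1..q}. \<forall>l\<in>{1..q}. vf i k = vf j l \<longrightarrow> k = l"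
    unfolding vf_def by (rule labels(1)[OF V0 order_refl cross0 qq])
  have lab2: "\<forall>i\<in>{1..t}. \<forall>j\<in>{1..t}. \<forall>k\<in>{1..q}. lev (vf i k) = lev (vf j k) \<and> vf i k \<in> V \<and> vf j k \<in> V"
    unfolding vf_def by (rule labels(2)[OF V0 order_refl cross0 qq])
  have lab3: "\<forall>i\<in>{1..t}. map (vf i) [1..<q + 1] = leg_path (us i) (vs i) 1 1"
    unfolding vf_def by (rule labels(3)[OF V0 order_refl cross0 qq])
  have dis: "distinct (L i)" if "i \<in> {1..t}" for i
    unfolding L_def by (rule distinct_leg_path) (use V[OF that] cross[OF that that] in auto)
  have len: "length (L i) = q" if "i \<in> {1..t}" for i using V[OF that] by (simp add: L_def length_leg_path q_def)
  have cS: "card (set (L i)) = q" if "i \<in> {1..t}" for i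
    using distinct_card[OF dis[OF that]] len[OF that] by simp
  have X2: "\<Union>(X i) \<inter> \<Union>(Tri - X i) = set (L i)" if "i \<in> {1..t}" for i using X(2)[OF that] by (simp add: L_def)
  have ne': "set (L i) \<noteq> set (L (i + 1))" if "i \<in> {1..<t}" for i using ne[OF that] by (simp add: L_def)
  have X0: "\<forall>i\<in>{1..t}. X i \<subseteq> Tri \<and> \<Union>(X i) \<inter> \<Union>(Tri - X i) = set (L i) \<and> card (set (L i)) = q"
    using X(1) X2 cS by simp
  have dec0: "\<forall>i\<in>{1..<t}. X (i + 1) \<subseteq> X i \<and> set (L i) \<noteq> set (L (i + 1))" using dec ne' by simp
  note sc = separators_common[OF X0 dec0]
  have path: "induces_path G (set (L i)) (map (vf i) [1..<q + 1]) \<and> vf i 1 \<in> layer G 1 \<and> vf i q \<in> layer G 1"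
    if i: "i \<in> {1..t}" for i
  proof -
    have mp: "map (vf i) [1..<q + 1] = L i" using bspec[OF lab3 i] unfolding L_def .
    have "L i \<noteq> []" using len[OF i] p12 by (auto simp: q_def)
    then have "induces_path G (set (L i)) (L i)"
      unfolding induces_path_def using dis[OF i] ind[OF i] G(2) by (simp add: L_def walk_edges_nth)
    moreover have "vf i 1 = hd (L i)" using \<open>L i \<noteq> []\<close> by (simp add: vf_def L_def hd_conv_nth)
    moreover have "vf i q = last (L i)" using \<open>L i \<noteq> []\<close> len[OF i] by (simp add: vf_def L_def last_conv_nth)
    moreover have "hd (L i) = leg (us i) 1" "last (L i) = leg (vs i) 1"
      using hd_leg_path[of 1 "us i"] last_leg_path[of 1 "vs i"] V[OF i] p12 by (auto simp: L_def)
    moreover have "leg (us i) 1 \<in> layer G 1" "leg (vs i) 1 \<in> layer G 1"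
      using leg[of "us i" 1] leg[of "vs i" 1] V[OF i] p12 G(3) by auto
    ultimately show ?thesis using mp by simp
  qed
  have ex: "\<exists>m. vf i k \<in> layer G m \<and> vf j k \<in> layer G m" if "i \<in> {1..t}" "j \<in> {1..t}" "k \<in> {1..q}" for i j k
  proof -
    have "lev (vf i k) = lev (vf j k)" "vf i k \<in> V" "vf j k \<in> V" using lab2 that by blast+
    then have "vf i k \<in> layer G (lev (vf j k)) \<and> vf j k \<in> layer G (lev (vf j k))" unfolding G(3) by blast
    then show ?thesis by blast
  qed
  have card2: "card (set (L i) \<inter> layer G m) \<le> 2" if i: "i \<in> {1..t}" for i m
  proof -
    have "set (L i) \<inter> layer G m \<subseteq> {x \<in> set (leg_path (us i) (vs i) 1 1). lev x = m}" using G(3) by (auto simp: L_def)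
    then have "card (set (L i) \<inter> layer G m) \<le> card {x \<in> set (leg_path (us i) (vs i) 1 1). lev x = m}"
      by (rule card_mono[rotated]) simp
    also have "\<dots> \<le> 2" using two_per_layer[of "us i" "vs i" 1 1 m] V[OF i] by simp
    finally show ?thesis .
  qed
  have card2': "\<forall>i\<in>{1..t}. \<forall>m. card (set (L i) \<inter> layer G m) \<le> 2" using card2 by blast
  have main: "\<exists>(q'::nat) (v :: nat \<Rightarrow> nat \<Rightarrow> 'a).
        ((q' = q \<and>
          (\<forall>i\<in>{1..t}. induces_path G (set (L i)) (map (v i) [1..<q' + 1]) \<and>
             v i 1 \<in> layer G 1 \<and> v i q' \<in> layer G 1))
         \<or>
         (layer G 1 \<subseteq> \<Union>(Tri - X 1) \<and> (q = q' + 1 \<or> q = q' + 2) \<and>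
          (\<exists>c d. \<forall>i\<in>{1..t}.
             induces_cycle G (set (L i))
               (c # map (v i) [1..<q' + 1] @ (if c = d then [] else [d])) \<and>
             c \<in> layer G (LEAST m. layer G m \<inter> set (L i) \<noteq> {}) \<and>
             d \<in> layer G (LEAST m. layer G m \<inter> set (L i) \<noteq> {})))) \<and>
        (\<forall>i\<in>{1..t}. \<forall>j\<in>{1..t}. \<forall>k\<in>{1..q'}. \<forall>l\<in>{1..q'}. v i k = v j l \<longrightarrow> k = l) \<and>
        (\<forall>i\<in>{1..t}. \<forall>j\<in>{1..t}. \<forall>k\<in>{1..q'}. \<exists>m. v i k \<in> layer G m \<and> v j k \<in> layer G m)"
    by (rule exI[of _ q], rule exI[of _ vf], intro conjI) (use path lab1 ex in blast)+
  have "well_formed_separator_sequence G t q (\<lambda>i. \<Union>(Tri - X i)) (\<lambda>i. set (L i)) (\<lambda>i. \<Union>(X i))"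
    unfolding well_formed_separator_sequence_def G(1,2) by (intro conjI sc main card2')
  then show ?thesis unfolding L_def q_def .
qed

text \<open>Serves for cycles closed at a join and for cycles closed by a chord. For
  \<open>b = a\<close> both ends of the path lie on the lowest layer and become the two
  distinguished vertices. For \<open>b = Suc a\<close> only \<open>leg u a\<close> does; the
  distinguished vertices coincide there, and the vertex on level \<open>b\<close> gets an ordinary
  label.\<close>

lemma wfs_cycle:
  fixes us vs :: "nat \<Rightarrow> 'a" and G :: "'a drawn_graph"
  assumes G: "vertices G = V" "edges G = E" "\<And>x m. x \<in> layer G m \<longleftrightarrow> x \<in> V \<and> lev x = m"
    and V: "\<And>i. i \<in> {1..t} \<Longrightarrow> us i \<in> V \<and> vs i \<in> V \<and> lev (us i) = p1 \<and> lev (vs i) = p2"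
    and ab: "1 \<le> a" "a \<le> p1" "b \<le> p2" "b = a \<or> b = Suc a" "3 \<le> (Suc p1 - a) + (Suc p2 - b)"
    and cross: "\<And>i j l. i \<in> {1..t} \<Longrightarrow> j \<in> {1..t} \<Longrightarrow> a \<le> l \<Longrightarrow> b \<le> l \<Longrightarrow> l \<le> p1 \<Longrightarrow> l \<le> p2 \<Longrightarrow> leg (us i) l \<noteq> leg (vs j) l"
    and c: "\<And>i. i \<in> {1..t} \<Longrightarrow> leg (us i) a = c" and d: "\<And>i. i \<in> {1..t} \<Longrightarrow> b = a \<Longrightarrow> leg (vs i) a = d"
    and X: "\<And>i. i \<in> {1..t} \<Longrightarrow> X i \<subseteq> Tri"
      "\<And>i. i \<in> {1..t} \<Longrightarrow> \<Union>(X i) \<inter> \<Union>(Tri - X i) = set (leg_path (us i) (vs i) a b)"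
    and dec: "\<And>i. i \<in> {1..<t} \<Longrightarrow> X (i + 1) \<subseteq> X i"
    and ne: "\<And>i. i \<in> {1..<t} \<Longrightarrow> set (leg_path (us i) (vs i) a b) \<noteq> set (leg_path (us (i + 1)) (vs (i + 1)) a b)"
    and ind: "\<And>i. i \<in> {1..t} \<Longrightarrow> {e \<in> E. e \<subseteq> set (leg_path (us i) (vs i) a b)} = cycle_edges (leg_path (us i) (vs i) a b)"
    and outer: "set C \<subseteq> \<Union>(Tri - X 1)"
  shows "\<exists>p. p \<le> p1 + p2 \<and> well_formed_separator_sequence G t p (\<lambda>i. \<Union>(Tri - X i)) (\<lambda>i. set (leg_path (us i) (vs i) a b)) (\<lambda>i. \<Union>(X i))"
proof -
  define L where "L = (\<lambda>i. leg_path (us i) (vs i) a b)"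
  define p where "p = (Suc p1 - a) + (Suc p2 - b)"
  define q where "q = (Suc p1 - Suc a) + (Suc p2 - Suc a)"
  define vf where "vf = (\<lambda>i k. leg_path (us i) (vs i) (Suc a) (Suc a) ! (k - 1))"
  define d' where "d' = (if b = a then d else c)"
  have cross': "leg (us i) l \<noteq> leg (vs j) l" if "i \<in> {1..t}" "j \<in> {1..t}" "Suc a \<le> l" "l \<le> p1" "l \<le> p2" for i j l
    using cross[OF that(1,2), of l] that ab(4) by auto
  have sa: "1 \<le> Suc a" by simp
  have V0: "\<forall>i\<in>{1..t}. us i \<in> V \<and> vs i \<in> V \<and> lev (us i) = p1 \<and> lev (vs i) = p2" using V by blast
  have cross0: "\<forall>i\<in>{1..t}. \<forall>j\<in>{1..t}. \<forall>l. Suc a \<le> l \<longrightarrow> l \<le> p1 \<longrightarrow> l \<le> p2 \<longrightarrow> leg (us i) l \<noteq> leg (vs j) l"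
    using cross' by blast
  have lab1: "\<forall>i\<in>{1..t}. \<forall>j\<in>{1..t}. \<forall>k\<in>{1..q}. \<forall>l\<in>{1..q}. vf i k = vf j l \<longrightarrow> k = l"
    unfolding vf_def by (rule labels(1)[OF V0 sa cross0 q_def])
  have lab2: "\<forall>i\<in>{1..t}. \<forall>j\<in>{1..t}. \<forall>k\<in>{1..q}. lev (vf i k) = lev (vf j k) \<and> vf i k \<in> V \<and> vf j k \<in> V"
    unfolding vf_def by (rule labels(2)[OF V0 sa cross0 q_def])
  have lab3: "\<forall>i\<in>{1..t}. map (vf i) [1..<q + 1] = leg_path (us i) (vs i) (Suc a) (Suc a)"
    unfolding vf_def by (rule labels(3)[OF V0 sa cross0 q_def])
  have b1: "1 \<le> b" using ab by auto
  have dis: "distinct (L i)" if "i \<in> {1..t}" for i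
    unfolding L_def by (rule distinct_leg_path) (use V[OF that] cross[OF that that] ab(1) b1 in auto)
  have len: "length (L i) = p" if "i \<in> {1..t}" for i using V[OF that] by (simp add: L_def length_leg_path p_def)
  have cS: "card (set (L i)) = p" if "i \<in> {1..t}" for i
    using distinct_card[OF dis[OF that]] len[OF that] by simp
  have X2: "\<Union>(X i) \<inter> \<Union>(Tri - X i) = set (L i)" if "i \<in> {1..t}" for i using X(2)[OF that] by (simp add: L_def)
  have ne': "set (L i) \<noteq> set (L (i + 1))" if "i \<in> {1..<t}" for i using ne[OF that] by (simp add: L_def)
  have X0: "\<forall>i\<in>{1..t}. X i \<subseteq> Tri \<and> \<Union>(X i) \<inter> \<Union>(Tri - X i) = set (L i) \<and> card (set (L i)) = p"
    using X(1) X2 cS by simp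
  have dec0: "\<forall>i\<in>{1..<t}. X (i + 1) \<subseteq> X i \<and> set (L i) \<noteq> set (L (i + 1))" using dec ne' by simp
  note sc = separators_common[OF X0 dec0]
  have Lform: "L i = c # map (vf i) [1..<q + 1] @ (if c = d' then [] else [d'])" if i: "i \<in> {1..t}" for i
  proof (cases "b = a")
    case True
    have "c \<noteq> d" using c[OF i] d[OF i True] cross[OF i i, of a] ab True by auto
    then show ?thesis unfolding bspec[OF lab3 i] using leg_path_both[of a "us i" "vs i"] V[OF i] ab True c[OF i] d[OF i True]
      by (simp add: L_def d'_def)
  next
    case False
    then have "b = Suc a" using ab by simp
    then show ?thesis unfolding bspec[OF lab3 i] using leg_path_left[of a "us i" "vs i"] V[OF i] ab c[OF i]
      by (simp add: L_def d'_def)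
  qed
  have pq: "p = q + 1 \<or> p = q + 2" using ab by (auto simp: p_def q_def)
  have cyc: "induces_cycle G (set (L i)) (c # map (vf i) [1..<q + 1] @ (if c = d' then [] else [d'])) \<and>
        c \<in> layer G (LEAST m. layer G m \<inter> set (L i) \<noteq> {}) \<and> d' \<in> layer G (LEAST m. layer G m \<inter> set (L i) \<noteq> {})"
    if i: "i \<in> {1..t}" for i
  proof -
    have "induces_cycle G (set (L i)) (L i)"
      unfolding induces_cycle_def using dis[OF i] ind[OF i] len[OF i] ab(5) G(2) by (simp add: L_def p_def)
    moreover have lc: "c \<in> layer G a" using leg[of "us i" a] V[OF i] ab c[OF i] G(3) by auto
    moreover have ld: "d' \<in> layer G a"
      using lc leg[of "vs i" a] V[OF i] ab d[OF i] G(3) by (auto simp: d'_def)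
    moreover have "(LEAST m. layer G m \<inter> set (L i) \<noteq> {}) = a"
    proof (rule Least_equality)
      have "c \<in> set (L i)" using Lform[OF i] by simp
      then show "layer G a \<inter> set (L i) \<noteq> {}" using lc by blast
      fix m assume "layer G m \<inter> set (L i) \<noteq> {}"
      then obtain x where x: "lev x = m" "x \<in> set (L i)" using G(3) by auto
      then show "a \<le> m" using leg[of "us i"] leg[of "vs i"] V[OF i] ab(1,4) by (auto simp: L_def set_leg_path)
    qed
    ultimately show ?thesis using Lform[OF i] by simp
  qed
  have L1: "layer G 1 \<subseteq> \<Union>(Tri - X 1)"
  proof
    fix x assume "x \<in> layer G 1"
    then have "x \<in> set C" using G(3)[of x 1] lev_one by auto
    then show "x \<in> \<Union>(Tri - X 1)" using outer by blast
  qed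
  have ex: "\<exists>m. vf i k \<in> layer G m \<and> vf j k \<in> layer G m" if "i \<in> {1..t}" "j \<in> {1..t}" "k \<in> {1..q}" for i j k
  proof -
    have "lev (vf i k) = lev (vf j k)" "vf i k \<in> V" "vf j k \<in> V" using lab2 that by blast+
    then have "vf i k \<in> layer G (lev (vf j k)) \<and> vf j k \<in> layer G (lev (vf j k))" unfolding G(3) by blast
    then show ?thesis by blast
  qed
  have card2: "card (set (L i) \<inter> layer G m) \<le> 2" if i: "i \<in> {1..t}" for i m
  proof -
    have "set (L i) \<inter> layer G m \<subseteq> {x \<in> set (leg_path (us i) (vs i) a b). lev x = m}" using G(3) by (auto simp: L_def)
    then have "card (set (L i) \<inter> layer G m) \<le> card {x \<in> set (leg_path (us i) (vs i) a b). lev x = m}"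
      by (rule card_mono[rotated]) simp
    also have "\<dots> \<le> 2" using two_per_layer[of "us i" "vs i" a b m] V[OF i] ab(1) b1 by simp
    finally show ?thesis .
  qed
  have cd: "\<exists>c d. \<forall>i\<in>{1..t}. induces_cycle G (set (L i)) (c # map (vf i) [1..<q + 1] @ (if c = d then [] else [d])) \<and>
             c \<in> layer G (LEAST m. layer G m \<inter> set (L i) \<noteq> {}) \<and>
             d \<in> layer G (LEAST m. layer G m \<inter> set (L i) \<noteq> {})"
    using cyc by blast
  have card2': "\<forall>i\<in>{1..t}. \<forall>m. card (set (L i) \<inter> layer G m) \<le> 2" using card2 by blast
  have main: "\<exists>(q'::nat) (v :: nat \<Rightarrow> nat \<Rightarrow> 'a).
        ((q' = p \<and>
          (\<forall>i\<in>{1..t}. induces_path G (set (L i)) (map (v i) [1..<q' + 1]) \<and>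
             v i 1 \<in> layer G 1 \<and> v i q' \<in> layer G 1))
         \<or>
         (layer G 1 \<subseteq> \<Union>(Tri - X 1) \<and> (p = q' + 1 \<or> p = q' + 2) \<and>
          (\<exists>c d. \<forall>i\<in>{1..t}.
             induces_cycle G (set (L i))
               (c # map (v i) [1..<q' + 1] @ (if c = d then [] else [d])) \<and>
             c \<in> layer G (LEAST m. layer G m \<inter> set (L i) \<noteq> {}) \<and>
             d \<in> layer G (LEAST m. layer G m \<inter> set (L i) \<noteq> {})))) \<and>
        (\<forall>i\<in>{1..t}. \<forall>j\<in>{1..t}. \<forall>k\<in>{1..q'}. \<forall>l\<in>{1..q'}. v i k = v j l \<longrightarrow> k = l) \<and>
        (\<forall>i\<in>{1..t}. \<forall>j\<in>{1..t}. \<forall>k\<in>{1..q'}. \<exists>m. v i k \<in> layer G m \<and> v j k \<in> layer G m)"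
    by (rule exI[of _ q], rule exI[of _ vf], intro conjI) (use L1 pq cd lab1 ex in blast)+
  have "well_formed_separator_sequence G t p (\<lambda>i. \<Union>(Tri - X i)) (\<lambda>i. set (L i)) (\<lambda>i. \<Union>(X i))"
    unfolding well_formed_separator_sequence_def G(1,2) by (intro conjI sc main card2')
  moreover have "p \<le> p1 + p2" using ab b1 by (auto simp: p_def)
  ultimately show ?thesis unfolding L_def by blast
qed

end

text \<open>Regions closed by a chord may grow along the chain; they are then enumerated backwards
  to obtain the order required of a separator sequence.\<close>

lemma monotone_enumeration:
  fixes J :: "nat set" and X :: "nat \<Rightarrow> 'b set"
  assumes J: "finite J" "t \<le> card J"
    and mono: "(\<forall>i\<in>J. \<forall>j\<in>J. i < j \<longrightarrow> X j \<subseteq> X i) \<or> (\<forall>i\<in>J. \<forall>j\<in>J. i < j \<longrightarrow> X i \<subseteq> X j)"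
  obtains \<sigma> where "\<And>i. i \<in> {1..t} \<Longrightarrow> \<sigma> i \<in> J"
    "\<And>i. i \<in> {1..<t} \<Longrightarrow> \<sigma> i \<noteq> \<sigma> (i + 1) \<and> X (\<sigma> (i + 1)) \<subseteq> X (\<sigma> i)"
proof -
  obtain \<sigma> where \<sigma>: "\<And>i. 1 \<le> i \<Longrightarrow> i \<le> t \<Longrightarrow> \<sigma> i \<in> J" "\<And>i j. 1 \<le> i \<Longrightarrow> i < j \<Longrightarrow> j \<le> t \<Longrightarrow> \<sigma> i < \<sigma> j"
    using increasing_enumeration[OF J] by blast
  from mono show ?thesis
  proof
    assume m: "\<forall>i\<in>J. \<forall>j\<in>J. i < j \<longrightarrow> X j \<subseteq> X i"
    show ?thesis
    proof (rule that[of \<sigma>])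
      show "\<sigma> i \<in> J" if "i \<in> {1..t}" for i using \<sigma>(1) that by simp
      show "\<sigma> i \<noteq> \<sigma> (i + 1) \<and> X (\<sigma> (i + 1)) \<subseteq> X (\<sigma> i)" if "i \<in> {1..<t}" for i
      proof -
        have "\<sigma> i < \<sigma> (i + 1)" "\<sigma> i \<in> J" "\<sigma> (i + 1) \<in> J" using \<sigma> that by auto
        then show ?thesis using m by auto
      qed
    qed
  next
    assume m: "\<forall>i\<in>J. \<forall>j\<in>J. i < j \<longrightarrow> X i \<subseteq> X j"
    show ?thesis
    proof (rule that[of "\<lambda>i. \<sigma> (Suc t - i)"])
      show "\<sigma> (Suc t - i) \<in> J" if "i \<in> {1..t}" for i using \<sigma>(1)[of "Suc t - i"] that by auto
      show "\<sigma> (Suc t - i) \<noteq> \<sigma> (Suc t - (i + 1)) \<and> X (\<sigma> (Suc t - (i + 1))) \<subseteq> X (\<sigma> (Suc t - i))" if "i \<in> {1..<t}" for i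
      proof -
        have "\<sigma> (Suc t - (i + 1)) < \<sigma> (Suc t - i)" "\<sigma> (Suc t - i) \<in> J" "\<sigma> (Suc t - (i + 1)) \<in> J"
          using \<sigma>(1)[of "Suc t - i"] \<sigma>(1)[of "Suc t - (i + 1)"] \<sigma>(2)[of "Suc t - (i + 1)" "Suc t - i"] that by auto
        then show ?thesis using m by auto
      qed
    qed
  qed
qed

section \<open>Inducedness of the separators\<close>

context leveled_disk
begin

text \<open>No triangle of \<open>X\<close> contains \<open>f\<close>, so \<open>f\<close> is not on
  the boundary of \<open>X \<inter> Y\<close>, whose non-tree boundary is therefore at most
  \<open>e\<close>. Uniqueness leaves the empty set and \<open>X\<close>.\<close>

lemma nontree_bd_inter:
  assumes "X \<subseteq> Tri" "Y \<subseteq> Tri" "nontree_bd X = {e}" "nontree_bd Y = {f}" "\<forall>t\<in>X. \<not> f \<subseteq> t" "X \<noteq> Tri"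
  shows "X \<inter> Y = {} \<or> X \<subseteq> Y"
proof -
  have XY: "X \<inter> Y \<subseteq> Tri" using assms(1) by blast
  have sub: "nontree_bd (X \<inter> Y) \<subseteq> {e}"
  proof
    fix g assume g: "g \<in> nontree_bd (X \<inter> Y)"
    then have gI: "g \<in> E - cycle_edges C" "g \<in> bd (X \<inter> Y)" "g \<notin> tree_edges" using bd_inner_edges by (auto simp: nontree_bd_def)
    obtain t1 t2 where t: "\<And>X. X \<subseteq> Tri \<Longrightarrow> g \<in> bd X \<longleftrightarrow> (t1 \<in> X \<longleftrightarrow> t2 \<notin> X)"
      by (rule inner_pair[OF gI(1)]) blast
    have "g \<in> bd X \<or> g \<in> bd Y" using t[OF XY] t[OF assms(1)] t[OF assms(2)] gI(2) by blast
    then have "g \<in> nontree_bd X \<or> g \<in> nontree_bd Y" using gI(3) by (simp add: nontree_bd_def)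
    then have "g = e \<or> g = f" using assms(3,4) by simp
    moreover have "g \<noteq> f"
    proof
      assume "g = f"
      obtain s where "s \<in> X \<inter> Y" "g \<subseteq> s" using gI(2) unfolding boundary_def by blast
      then show False using assms(5) \<open>g = f\<close> by blast
    qed
    ultimately show "g \<in> {e}" by simp
  qed
  then consider "nontree_bd (X \<inter> Y) = {}" | "nontree_bd (X \<inter> Y) = nontree_bd X" using assms(3) by auto
  then show ?thesis
  proof cases
    case 1
    then show ?thesis using nontree_bd_empty[OF XY] assms(1,6) by blast
  next
    case 2
    then have "X \<inter> Y = X \<or> X \<inter> Y = Tri - X" using nontree_bd_eq[OF XY assms(1)] by blast
    then show ?thesis using assms(1,6) by blast
  qed
qed

lemma same_leg_edge:
  assumes "w \<in> V" "1 \<le> a" "a \<le> l" "l \<le> lev w" "a \<le> l'" "l' \<le> lev w" "{leg w l, leg w l'} \<in> E"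
  shows "\<exists>k. a \<le> k \<and> k < lev w \<and> {leg w l, leg w l'} = {leg w k, leg w (Suc k)}"
proof -
  have lv: "lev (leg w l) = l" "lev (leg w l') = l'" using leg[OF assms(1)] assms by auto
  have "l \<le> Suc l'" "l' \<le> Suc l" using lev_edge[OF assms(7)] lev_edge[of "leg w l'" "leg w l"] assms(7) lv
    by (auto simp: insert_commute)
  moreover have "l \<noteq> l'" using edge_in_V[OF assms(7)] by auto
  ultimately consider "l' = Suc l" | "l = Suc l'" by linarith
  then show ?thesis
  proof cases
    case 1 then show ?thesis using assms by (intro exI[of _ l]) auto
  next
    case 2 then show ?thesis using assms by (intro exI[of _ l']) (auto simp: insert_commute)
  qed
qed

end

context separator_chain
begin

text \<open>One of the two triangles at the edge of member \<open>i\<close> is outside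
  \<open>F i\<close>, the other is removed in step \<open>i\<close>. Neither belongs to
  \<open>F j\<close>, where the edge of member \<open>j\<close> has a triangle.\<close>

lemma edges_distinct:
  assumes "1 \<le> i" "i < j" "j \<le> N"
  shows "{u i, v i} \<noteq> {u j, v j}"
proof
  assume eq: "{u i, v i} = {u j, v j}"
  have iN: "i < N" "i \<le> N" "1 \<le> j" using assms by auto
  obtain w F'' where w: "F i = insert {u i, v i, w} (F (Suc i) \<union> F'')" "{u i, v i, w} \<notin> F (Suc i)" "{u i, v i, w} \<in> Tri"
    using stepE[OF iN(1)] by metis
  have sub: "F j \<subseteq> F (Suc i)" "F j \<subseteq> F i" using F_dec[of "Suc i" j] F_dec[of i j] assms by auto
  obtain t' where t': "t' \<in> Tri - F i" "{u i, v i} \<subseteq> t'" using Region_tri(2)[OF reg[OF assms(1) iN(2)]] by blast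
  obtain s where s: "s \<in> F j" "{u i, v i} \<subseteq> s" using Region_tri(1)[OF reg[OF iN(3) assms(3)]] eq by auto
  have I: "{u i, v i} \<in> E - cycle_edges C" using reg_nontree[OF assms(1) iN(2)] by (simp add: nontree_edges_def)
  obtain t1 t2 where t: "\<And>t. t \<in> Tri \<Longrightarrow> {u i, v i} \<subseteq> t \<Longrightarrow> t = t1 \<or> t = t2"
    by (rule inner_pair[OF I]) blast
  have "{u i, v i} \<subseteq> {u i, v i, w}" by auto
  moreover have "s \<in> Tri" using s F_Tri[OF assms(3)] by blast
  moreover have "{u i, v i, w} \<in> F i" using w(1) by simp
  ultimately show False using t[of "{u i, v i, w}"] t[of s] t[of t'] w(2,3) t' s sub by blast
qed

lemma outer_covered:
  assumes "1 \<le> i" "i \<le> N" "h i \<ge> 1"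
  shows "set C \<subseteq> \<Union>(Tri - F i)"
proof
  fix z assume "z \<in> set C"
  then obtain e where e: "e \<in> cycle_edges C" "z \<in> e" using cycle_edges_cover by metis
  then obtain t where "t \<in> Tri" "e \<subseteq> t" using edge_Tri[of e] C_cycle(4) by (meson subsetD)
  then show "z \<in> \<Union>(Tri - F i)" using inside_region[OF assms e(1)] e by blast
qed

end

context constant_join
begin

lemma levels: "\<alpha> \<le> i \<Longrightarrow> i \<le> \<beta> \<Longrightarrow> H < lev (u i) \<and> H < lev (v i)"
proof -
  assume i: "\<alpha> \<le> i" "i \<le> \<beta>"
  then have "{u i, v i} \<in> E" "{u i, v i} \<notin> tree_edges" using reg_nontree[of i] \<alpha> \<beta> by (auto simp: nontree_edges_def)
  then show ?thesis using join_level_less hH[OF i] by (auto simp: h_def)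
qed

lemma distinct_edges:
  assumes "\<alpha> \<le> i" "i \<le> \<beta>" "\<alpha> \<le> j" "j \<le> \<beta>" "i \<noteq> j"
  shows "{u i, v i} \<noteq> {u j, v j}"
  using edges_distinct[of i j] edges_distinct[of j i] assms \<alpha> \<beta> by (cases "i < j") auto

lemma edge_in:
  assumes "\<alpha> \<le> i" "i \<le> \<beta>"
  shows "{u i, v i} \<in> E - cycle_edges C" "{u i, v i} \<notin> tree_edges" "{u i, v i} \<in> E"
  using reg_nontree[of i] assms \<alpha> \<beta> by (auto simp: nontree_edges_def)

text \<open>Levels of adjacent vertices differ by at most one, so an edge with both ends on one leg
  is an edge of that leg; an edge between the legs is a chord unless it is the edge of the
  member.\<close>

lemma induced_above:
  assumes j: "\<alpha> \<le> j" "j \<le> \<beta>" and ab: "H < a" "H < b" "a \<le> lev (u j)" "b \<le> lev (v j)"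
    and e: "e \<in> E" "e \<subseteq> set (leg_path (u j) (v j) a b)"
  shows "e \<in> walk_edges (leg_path (u j) (v j) a b) \<or> (\<exists>l l'. a \<le> l \<and> b \<le> l' \<and> chord j l l' \<and> e = chord_edge j l l')"
proof -
  note V = UV(1)[OF j] UV(2)[OF j]
  have ab1: "1 \<le> a" "1 \<le> b" using ab by auto
  obtain x y where xy: "x \<noteq> y" "e = {x, y}" using edge_ends[OF e(1)] by blast
  have mixed: ?thesis if l: "a \<le> l" "l \<le> lev (u j)" "b \<le> l'" "l' \<le> lev (v j)" "e = {leg (u j) l, leg (v j) l'}" for l l'
  proof (cases "l = lev (u j) \<and> l' = lev (v j)")
    case True
    then have "e = {u j, v j}" using l by (simp add: leg_self)
    then show ?thesis using walk_leg_path_sub(1)[OF V ab1 ab(3,4)] by simp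
  next
    case False
    then have "chord j l l'" using l ab e(1) by (auto simp: chord_def)
    then show ?thesis using l by (auto simp: chord_edge_def)
  qed
  have w: "walk_edges (leg_path (u j) (v j) a b) = insert {u j, v j} ({{leg (u j) l, leg (u j) (Suc l)} | l. a \<le> l \<and> l < lev (u j)} \<union>
     {{leg (v j) l, leg (v j) (Suc l)} | l. b \<le> l \<and> l < lev (v j)})" by (rule walk_leg_path[OF ab(3,4)])
  have "x \<in> leg (u j) ` {a..lev (u j)} \<union> leg (v j) ` {b..lev (v j)}" "y \<in> leg (u j) ` {a..lev (u j)} \<union> leg (v j) ` {b..lev (v j)}"
    using e(2) xy by (auto simp: set_leg_path)
  then consider l l' where "a \<le> l" "l \<le> lev (u j)" "a \<le> l'" "l' \<le> lev (u j)" "x = leg (u j) l" "y = leg (u j) l'"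
    | l l' where "a \<le> l" "l \<le> lev (u j)" "b \<le> l'" "l' \<le> lev (v j)" "x = leg (u j) l" "y = leg (v j) l'"
    | l l' where "b \<le> l" "l \<le> lev (v j)" "a \<le> l'" "l' \<le> lev (u j)" "x = leg (v j) l" "y = leg (u j) l'"
    | l l' where "b \<le> l" "l \<le> lev (v j)" "b \<le> l'" "l' \<le> lev (v j)" "x = leg (v j) l" "y = leg (v j) l'"
    by auto
  then show ?thesis
  proof cases
    case 1
    then show ?thesis using same_leg_edge[OF V(1) ab1(1), of l l'] e(1) xy unfolding w by auto
  next
    case 2
    then show ?thesis using mixed[of l l'] xy by simp
  next
    case 3
    then show ?thesis using mixed[of l' l] xy by (simp add: insert_commute)
  next
    case 4
    then show ?thesis using same_leg_edge[OF V(2) ab1(2), of l l'] e(1) xy unfolding w by auto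
  qed
qed

lemma walk_leg_path_edges:
  assumes "\<alpha> \<le> j" "j \<le> \<beta>" "1 \<le> a" "1 \<le> b" "a \<le> lev (u j)" "b \<le> lev (v j)"
  shows "walk_edges (leg_path (u j) (v j) a b) \<subseteq> insert {u j, v j} tree_edges" "walk_edges (leg_path (u j) (v j) a b) \<subseteq> E"
  using walk_leg_path_sub(2)[OF UV(1)[OF assms(1,2)] UV(2)[OF assms(1,2)] assms(3-6)] edge_in(3)[OF assms(1,2)] tree_edges_inner
  by auto

lemma cycle_leg_path:
  assumes "\<alpha> \<le> j" "j \<le> \<beta>" "a \<le> lev (u j)" "b \<le> lev (v j)"
  shows "cycle_edges (leg_path (u j) (v j) a b) = insert {leg (u j) a, leg (v j) b} (walk_edges (leg_path (u j) (v j) a b))"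
proof -
  have "leg_path (u j) (v j) a b \<noteq> []" using assms length_leg_path[of "u j" "v j" a b] by auto
  then show ?thesis
    using cycle_edges_walk_edges[of "leg_path (u j) (v j) a b"] hd_leg_path[OF assms(3), of "v j" b] last_leg_path[OF assms(4), of "u j" a]
    by (simp add: insert_commute)
qed

lemma edge_in_leg_path:
  assumes "a \<le> lev (u j)" "b \<le> lev (v j)"
  shows "{u j, v j} \<subseteq> set (leg_path (u j) (v j) a b)"
  using assms leg_self[of "u j"] leg_self[of "v j"] by (auto simp: set_leg_path image_iff) (metis atLeastAtMost_iff order_refl)+

text \<open>Chords do not account for edges at the join. By the levels of their ends such edges lead
  only to the next vertex of either leg, and both of these belong to the cycle.\<close>

lemma induced_join:
  assumes j: "\<alpha> \<le> j" "j \<le> \<beta>" and H1: "H \<ge> 1" and nc: "\<And>a b. \<not> chord j a b"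
  shows "{e \<in> E. e \<subseteq> set (leg_path (u j) (v j) H (Suc H))} = cycle_edges (leg_path (u j) (v j) H (Suc H))"
proof -
  note V = UV(1)[OF j] UV(2)[OF j]
  note lv = levels[OF j]
  have hj: "join_level (u j) (v j) = H" using hH[OF j] by (simp add: h_def)
  have eqH: "leg (u j) H = leg (v j) H" using join_level_leg[OF V H1] hj by simp
  have chord_edge: "cycle_edges (leg_path (u j) (v j) H (Suc H)) = insert {leg (u j) H, leg (v j) (Suc H)} (walk_edges (leg_path (u j) (v j) H (Suc H)))"
    using cycle_leg_path[OF j, of H "Suc H"] lv by simp
  have tr: "{leg (u j) H, leg (v j) (Suc H)} \<in> tree_edges" unfolding eqH using leg_edge[OF V(2) H1] lv by simp
  have "leg_path (u j) (v j) H (Suc H) = leg (u j) H # leg_path (u j) (v j) (Suc H) (Suc H)" using leg_path_left[of H "u j" "v j"] lv by simp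
  then have w: "walk_edges (leg_path (u j) (v j) (Suc H) (Suc H)) \<subseteq> walk_edges (leg_path (u j) (v j) H (Suc H))"
    by (cases "leg_path (u j) (v j) (Suc H) (Suc H)") auto
  have w2: "walk_edges (leg_path (u j) (v j) H (Suc H)) = insert {u j, v j} ({{leg (u j) l, leg (u j) (Suc l)} | l. H \<le> l \<and> l < lev (u j)} \<union>
     {{leg (v j) l, leg (v j) (Suc l)} | l. Suc H \<le> l \<and> l < lev (v j)})" by (rule walk_leg_path) (use lv in auto)
  have "e \<in> cycle_edges (leg_path (u j) (v j) H (Suc H))" if e: "e \<in> E" "e \<subseteq> set (leg_path (u j) (v j) H (Suc H))" for e
  proof (cases "leg (u j) H \<in> e")
    case False
    have "set (leg_path (u j) (v j) H (Suc H)) = insert (leg (u j) H) (set (leg_path (u j) (v j) (Suc H) (Suc H)))"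
      using leg_path_left[of H "u j" "v j"] lv by simp
    then have "e \<subseteq> insert (leg (u j) H) (set (leg_path (u j) (v j) (Suc H) (Suc H)))" using e(2) by simp
    then have "e \<subseteq> set (leg_path (u j) (v j) (Suc H) (Suc H))" using False by (simp add: subset_insert)
    then have "e \<in> walk_edges (leg_path (u j) (v j) (Suc H) (Suc H))"
      using induced_above[OF j, of "Suc H" "Suc H" e] lv e(1) nc by auto
    then show ?thesis using w chord_edge by blast
  next
    case True
    then obtain y where y: "e = {leg (u j) H, y}" using edge_ends[OF e(1)] by blast
    have "y \<in> leg (u j) ` {H..lev (u j)} \<union> leg (v j) ` {Suc H..lev (v j)}" using e(2) y by (auto simp: set_leg_path)
    then consider l where "H \<le> l" "l \<le> lev (u j)" "y = leg (u j) l" | l where "Suc H \<le> l" "l \<le> lev (v j)" "y = leg (v j) l"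
      by auto
    then show ?thesis
    proof cases
      case 1
      then show ?thesis using same_leg_edge[OF V(1) H1 order_refl, of l] lv e(1) y unfolding chord_edge w2 by auto
    next
      case 2
      have "lev (leg (u j) H) = H" "lev y = l" using leg[OF V(1), of H] leg[OF V(2), of l] H1 lv 2 by auto
      then have "l \<le> Suc H" using lev_edge[of "leg (u j) H" y] e(1) y by auto
      then have "l = Suc H" using 2 by simp
      then show ?thesis unfolding chord_edge using y 2 by simp
    qed
  qed
  moreover have "cycle_edges (leg_path (u j) (v j) H (Suc H)) \<subseteq> E"
    unfolding chord_edge using walk_leg_path_edges(2)[OF j H1, of "Suc H"] lv tr tree_edges_inner by auto
  ultimately show ?thesis using cycle_edges_subset by blast
qed

lemma no_chord_separators:
  fixes G :: "'a drawn_graph"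
  assumes G: "vertices G = V" "edges G = E" "\<And>x m. x \<in> layer G m \<longleftrightarrow> x \<in> V \<and> lev x = m"
    and J: "finite J" "t \<le> card J" "J \<subseteq> {\<alpha>..\<beta>}" "t \<ge> 1"
    and lv: "\<And>j. j \<in> J \<Longrightarrow> lev (u j) = p1 \<and> lev (v j) = p2"
    and nc: "\<And>j a b. j \<in> J \<Longrightarrow> \<not> chord j a b"
  shows "\<exists>p A S B. well_formed_separator_sequence G t p A S B \<and> p \<le> p1 + p2"
proof -
  have J': "\<alpha> \<le> j" "j \<le> \<beta>" "1 \<le> j" "j \<le> N" if "j \<in> J" for j
  proof -
    have "j \<in> {\<alpha>..\<beta>}" using that J(3) by blast
    then show "\<alpha> \<le> j" "j \<le> \<beta>" "1 \<le> j" "j \<le> N" using \<alpha> \<beta> by auto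
  qed
  have mono: "(\<forall>i\<in>J. \<forall>j\<in>J. i < j \<longrightarrow> F j \<subseteq> F i) \<or> (\<forall>i\<in>J. \<forall>j\<in>J. i < j \<longrightarrow> F i \<subseteq> F j)"
  proof (intro disjI1 ballI impI)
    fix i j assume "i \<in> J" "j \<in> J" "i < j"
    then show "F j \<subseteq> F i" using F_dec[of i j] J'(4)[of j] by simp
  qed
  obtain \<sigma> where \<sigma>: "\<And>i. i \<in> {1..t} \<Longrightarrow> \<sigma> i \<in> J" "\<And>i. i \<in> {1..<t} \<Longrightarrow> \<sigma> i \<noteq> \<sigma> (i + 1) \<and> F (\<sigma> (i + 1)) \<subseteq> F (\<sigma> i)"
    using monotone_enumeration[OF J(1,2) mono] by blast
  have sj: "\<alpha> \<le> \<sigma> i" "\<sigma> i \<le> \<beta>" "1 \<le> \<sigma> i" "\<sigma> i \<le> N" "lev (u (\<sigma> i)) = p1" "lev (v (\<sigma> i)) = p2"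
    "u (\<sigma> i) \<in> V" "v (\<sigma> i) \<in> V" "H < p1" "H < p2" if "i \<in> {1..t}" for i
    using J'[OF \<sigma>(1)[OF that]] lv[OF \<sigma>(1)[OF that]] UV[of "\<sigma> i"] levels[of "\<sigma> i"] by auto
  have i1: "i \<in> {1..t}" "i + 1 \<in> {1..t}" if "i \<in> {1..<t}" for i using that by auto
  have one: "1 \<in> {1..t}" using J(4) by simp
  have cr: "leg (u (\<sigma> i)) l \<noteq> leg (v (\<sigma> j)) l" if "i \<in> {1..t}" "j \<in> {1..t}" "H < l" "l \<le> p1" "l \<le> p2" for i j l
    using cross[OF sj(1,2)[OF that(1)] sj(1,2)[OF that(2)] that(3)] sj(5)[OF that(1)] sj(6)[OF that(2)] that(4,5) by simp
  \<comment> \<open>With equal vertex sets the edge of the next member would be an induced edge of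
    this one. As it is not a tree edge it would be the same edge, although edges of different
    members differ.\<close>
  have neq: "set (leg_path (u (\<sigma> i)) (v (\<sigma> i)) a b) \<noteq> set (leg_path (u (\<sigma> (i + 1))) (v (\<sigma> (i + 1))) a b)"
    if i: "i \<in> {1..<t}" and ab: "1 \<le> a" "1 \<le> b" "a \<le> p1" "b \<le> p2"
      and ind: "\<And>e. e \<in> E \<Longrightarrow> e \<subseteq> set (leg_path (u (\<sigma> i)) (v (\<sigma> i)) a b) \<Longrightarrow> e \<in> insert {u (\<sigma> i), v (\<sigma> i)} tree_edges" for i a b
  proof
    assume eq: "set (leg_path (u (\<sigma> i)) (v (\<sigma> i)) a b) = set (leg_path (u (\<sigma> (i + 1))) (v (\<sigma> (i + 1))) a b)"
    note k = sj[OF i1(1)[OF i]] and k' = sj[OF i1(2)[OF i]]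
    have "{u (\<sigma> (i + 1)), v (\<sigma> (i + 1))} \<subseteq> set (leg_path (u (\<sigma> i)) (v (\<sigma> i)) a b)"
      unfolding eq by (rule edge_in_leg_path) (use k' ab in auto)
    then have "{u (\<sigma> (i + 1)), v (\<sigma> (i + 1))} = {u (\<sigma> i), v (\<sigma> i)}"
      using ind[of "{u (\<sigma> (i + 1)), v (\<sigma> (i + 1))}"] edge_in[OF k'(1,2)] by simp
    then show False using distinct_edges[OF k(1,2) k'(1,2)] \<sigma>(2)[OF i] by metis
  qed
  show ?thesis
  proof (cases "H = 0")
    case True
    have ind: "{e \<in> E. e \<subseteq> set (leg_path (u (\<sigma> i)) (v (\<sigma> i)) 1 1)} = walk_edges (leg_path (u (\<sigma> i)) (v (\<sigma> i)) 1 1)" if i: "i \<in> {1..t}" for i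
    proof -
      note k = sj[OF i]
      have "e \<in> walk_edges (leg_path (u (\<sigma> i)) (v (\<sigma> i)) 1 1)" if "e \<in> E" "e \<subseteq> set (leg_path (u (\<sigma> i)) (v (\<sigma> i)) 1 1)" for e
        using induced_above[OF k(1,2), of 1 1 e] that True k nc[OF \<sigma>(1)[OF i]] by auto
      moreover have "walk_edges (leg_path (u (\<sigma> i)) (v (\<sigma> i)) 1 1) \<subseteq> E"
        using walk_leg_path_edges(2)[OF k(1,2), of 1 1] k by auto
      ultimately show ?thesis using walk_edges_subset by blast
    qed
    have "well_formed_separator_sequence G t (p1 + p2) (\<lambda>i. \<Union>(Tri - F (\<sigma> i)))
        (\<lambda>i. set (leg_path (u (\<sigma> i)) (v (\<sigma> i)) 1 1)) (\<lambda>i. \<Union>(F (\<sigma> i)))"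
    proof (rule wfs_path[OF G, where us = "\<lambda>i. u (\<sigma> i)" and vs = "\<lambda>i. v (\<sigma> i)" and X = "\<lambda>i. F (\<sigma> i)" and t = t and ?p1.0 = p1 and ?p2.0 = p2])
      show "u (\<sigma> i) \<in> V \<and> v (\<sigma> i) \<in> V \<and> lev (u (\<sigma> i)) = p1 \<and> lev (v (\<sigma> i)) = p2" if "i \<in> {1..t}" for i
        using sj[OF that] by simp
      show "leg (u (\<sigma> i)) l \<noteq> leg (v (\<sigma> j)) l" if "i \<in> {1..t}" "j \<in> {1..t}" "1 \<le> l" "l \<le> p1" "l \<le> p2" for i j l
        using cr[OF that(1,2)] that True by simp
      show "F (\<sigma> i) \<subseteq> Tri" if "i \<in> {1..t}" for i using F_Tri[OF sj(4)[OF that]] .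
      show "\<Union>(F (\<sigma> i)) \<inter> \<Union>(Tri - F (\<sigma> i)) = set (leg_path (u (\<sigma> i)) (v (\<sigma> i)) 1 1)" if "i \<in> {1..t}" for i
        using S_eq[OF sj(3,4)[OF that]] hH[OF sj(1,2)[OF that]] True by (simp add: S_def leg_set_def set_leg_path h_def)
      show "F (\<sigma> (i + 1)) \<subseteq> F (\<sigma> i)" if "i \<in> {1..<t}" for i using \<sigma>(2)[OF that] by simp
      show "set (leg_path (u (\<sigma> i)) (v (\<sigma> i)) 1 1) \<noteq> set (leg_path (u (\<sigma> (i + 1))) (v (\<sigma> (i + 1))) 1 1)" if i: "i \<in> {1..<t}" for i
      proof (rule neq[OF i])
        note k = sj[OF i1(1)[OF i]]
        fix e assume "e \<in> E" "e \<subseteq> set (leg_path (u (\<sigma> i)) (v (\<sigma> i)) 1 1)"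
        then have "e \<in> walk_edges (leg_path (u (\<sigma> i)) (v (\<sigma> i)) 1 1)" using ind[OF i1(1)[OF i]] by blast
        then show "e \<in> insert {u (\<sigma> i), v (\<sigma> i)} tree_edges" using walk_leg_path_edges(1)[OF k(1,2), of 1 1] k by auto
      qed (use sj[OF i1(1)[OF i]] in auto)
      show "{e \<in> E. e \<subseteq> set (leg_path (u (\<sigma> i)) (v (\<sigma> i)) 1 1)} = walk_edges (leg_path (u (\<sigma> i)) (v (\<sigma> i)) 1 1)" if "i \<in> {1..t}" for i
        by (rule ind[OF that])
      show "1 \<le> p1" "1 \<le> p2" using sj[OF one] by auto
    qed
    then show ?thesis by blast
  next
    case False
    then have H1: "H \<ge> 1" by simp
    have "\<exists>p. p \<le> p1 + p2 \<and> well_formed_separator_sequence G t p (\<lambda>i. \<Union>(Tri - F (\<sigma> i)))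
        (\<lambda>i. set (leg_path (u (\<sigma> i)) (v (\<sigma> i)) H (Suc H))) (\<lambda>i. \<Union>(F (\<sigma> i)))"
    \<comment> \<open>By \<open>join_const\<close> all members have the same join vertex, so it can
      be named through the member \<open>\<alpha>\<close>.\<close>
    proof (rule wfs_cycle[OF G, where us = "\<lambda>i. u (\<sigma> i)" and vs = "\<lambda>i. v (\<sigma> i)" and X = "\<lambda>i. F (\<sigma> i)" and t = t
         and ?p1.0 = p1 and ?p2.0 = p2 and a = H and b = "Suc H" and c = "leg (u \<alpha>) H" and d = undefined])
      show "u (\<sigma> i) \<in> V \<and> v (\<sigma> i) \<in> V \<and> lev (u (\<sigma> i)) = p1 \<and> lev (v (\<sigma> i)) = p2" if "i \<in> {1..t}" for i
        using sj[OF that] by simp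
      show "1 \<le> H" "H \<le> p1" "Suc H \<le> p2" "Suc H = H \<or> Suc H = Suc H" "3 \<le> (Suc p1 - H) + (Suc p2 - Suc H)"
        using H1 sj(9,10)[OF one] by auto
      show "leg (u (\<sigma> i)) l \<noteq> leg (v (\<sigma> j)) l" if "i \<in> {1..t}" "j \<in> {1..t}" "H \<le> l" "Suc H \<le> l" "l \<le> p1" "l \<le> p2" for i j l
        using cr[OF that(1,2)] that by simp
      show "leg (u (\<sigma> i)) H = leg (u \<alpha>) H" if "i \<in> {1..t}" for i using join_const[of \<alpha> "\<sigma> i"] sj(1,2)[OF that] H1 by simp
      show "leg (v (\<sigma> i)) H = undefined" if "Suc H = H" for i using that by simp
      show "F (\<sigma> i) \<subseteq> Tri" if "i \<in> {1..t}" for i using F_Tri[OF sj(4)[OF that]] .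
      show "\<Union>(F (\<sigma> i)) \<inter> \<Union>(Tri - F (\<sigma> i)) = set (leg_path (u (\<sigma> i)) (v (\<sigma> i)) H (Suc H))" if i: "i \<in> {1..t}" for i
      proof -
        have hi: "join_level (u (\<sigma> i)) (v (\<sigma> i)) = H" using hH[OF sj(1,2)[OF i]] by (simp add: h_def)
        have "set (leg_path (u (\<sigma> i)) (v (\<sigma> i)) H (Suc H)) = leg_set (u (\<sigma> i)) (v (\<sigma> i))"
          using cycle_region_join[OF edge_in(1,2)[OF sj(1,2)[OF i]]] hi H1 by metis
        then show ?thesis using S_eq[OF sj(3,4)[OF i]] by (simp add: S_def)
      qed
      show "F (\<sigma> (i + 1)) \<subseteq> F (\<sigma> i)" if "i \<in> {1..<t}" for i using \<sigma>(2)[OF that] by simp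
      show "{e \<in> E. e \<subseteq> set (leg_path (u (\<sigma> i)) (v (\<sigma> i)) H (Suc H))} = cycle_edges (leg_path (u (\<sigma> i)) (v (\<sigma> i)) H (Suc H))" if i: "i \<in> {1..t}" for i
        using induced_join[OF sj(1,2)[OF i] H1] nc[OF \<sigma>(1)[OF i]] by blast
      show "set (leg_path (u (\<sigma> i)) (v (\<sigma> i)) H (Suc H)) \<noteq> set (leg_path (u (\<sigma> (i + 1))) (v (\<sigma> (i + 1))) H (Suc H))" if i: "i \<in> {1..<t}" for i
      proof (rule neq[OF i])
        note k = sj[OF i1(1)[OF i]]
        fix e assume "e \<in> E" "e \<subseteq> set (leg_path (u (\<sigma> i)) (v (\<sigma> i)) H (Suc H))"
        then have "e \<in> cycle_edges (leg_path (u (\<sigma> i)) (v (\<sigma> i)) H (Suc H))"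
          using induced_join[OF k(1,2) H1] nc[OF \<sigma>(1)[OF i1(1)[OF i]]] by blast
        moreover have "{leg (u (\<sigma> i)) H, leg (v (\<sigma> i)) (Suc H)} \<in> tree_edges"
          using cycle_region_join[OF edge_in(1,2)[OF k(1,2)]] hH[OF k(1,2)] H1 unfolding h_def by metis
        ultimately show "e \<in> insert {u (\<sigma> i), v (\<sigma> i)} tree_edges"
          using walk_leg_path_edges(1)[OF k(1,2) H1, of "Suc H"] cycle_leg_path[OF k(1,2), of H "Suc H"] k by auto
      qed (use sj[OF i1(1)[OF i]] H1 in auto)
      show "set C \<subseteq> \<Union>(Tri - F (\<sigma> 1))" using outer_covered[OF sj(3,4)[OF one]] hH[OF sj(1,2)[OF one]] H1 by simp
    qed
    then show ?thesis by blast
  qed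
qed

text \<open>The cycle closed by the chord bounds the sum modulo 2 of \<open>F j\<close> and a region
  \<open>Q\<close> of the chord that does not depend on \<open>j\<close>; for a chord on the outer
  cycle it bounds \<open>F j\<close> or the complement. As the chord lies on the same side of all
  members, \<open>Q\<close> is related to all \<open>F j\<close> in the same way, so the new regions
  are nested as well, though possibly in the opposite order.\<close>

lemma chord_regions:
  assumes J: "J \<subseteq> {\<alpha>..\<beta>}" "J \<noteq> {}"
    and ch: "\<And>j. j \<in> J \<Longrightarrow> chord j a b \<and> leg (u j) a = x \<and> leg (v j) b = y"
    and side: "(\<forall>j\<in>J. \<exists>t\<in>F j. {x, y} \<subseteq> t) \<or> (\<forall>j\<in>J. \<exists>t\<in>Tri - F j. {x, y} \<subseteq> t)"
  obtains X where "\<And>j. j \<in> J \<Longrightarrow> X j \<subseteq> Tri \<and> \<Union>(X j) \<inter> \<Union>(Tri - X j) = set (leg_path (u j) (v j) a b) \<and> set C \<subseteq> \<Union>(Tri - X j)"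
    "(\<forall>i\<in>J. \<forall>j\<in>J. i < j \<longrightarrow> X j \<subseteq> X i) \<or> (\<forall>i\<in>J. \<forall>j\<in>J. i < j \<longrightarrow> X i \<subseteq> X j)"
proof -
  define f where "f = {x, y}"
  have J': "\<alpha> \<le> j" "j \<le> \<beta>" "1 \<le> j" "j \<le> N" if "j \<in> J" for j
  proof -
    have "j \<in> {\<alpha>..\<beta>}" using that J(1) by blast
    then show "\<alpha> \<le> j" "j \<le> \<beta>" "1 \<le> j" "j \<le> N" using \<alpha> \<beta> by auto
  qed
  have f: "f \<in> E" "f \<notin> tree_edges" "f \<noteq> {u j, v j}" "chord_edge j a b = f" if j: "j \<in> J" for j
  proof -
    show chord_edge: "chord_edge j a b = f" using ch[OF j] by (simp add: chord_edge_def f_def)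
    show "f \<in> E" "f \<notin> tree_edges" "f \<noteq> {u j, v j}" using chord_ne[OF J'(1,2)[OF j], of a b] ch[OF j] chord_edge by auto
  qed
  have N1: "1 \<le> N" using J'(3,4) J(2) by fastforce
  obtain t0 where t0: "t0 \<in> Tri" "{u 0, v 0} \<subseteq> t0" "\<And>i. 1 \<le> i \<Longrightarrow> i \<le> N \<Longrightarrow> t0 \<notin> F i"
    using start_triangle[OF N1] by blast
  have t0F: "t0 \<notin> F j" if "j \<in> J" for j using t0(3) J'(3,4)[OF that] by blast
  define P where "P = (\<lambda>j X. X \<subseteq> Tri \<and> nontree_bd X = insert {u j, v j} ({f} - cycle_edges C) \<and>
      \<Union>X \<inter> \<Union>(Tri - X) = set (leg_path (u j) (v j) a b) \<and> (\<forall>e\<in>cycle_edges C. \<forall>t\<in>Tri. e \<subseteq> t \<longrightarrow> (t \<in> X \<longleftrightarrow> e = f)))"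
  have ex: "\<exists>X. P j X" if j: "j \<in> J" for j
  proof -
    note k = J'(1,2)[OF j]
    have c: "H < a" "a \<le> lev (u j)" "H < b" "b \<le> lev (v j)" "a \<noteq> lev (u j) \<or> b \<noteq> lev (v j)" "{leg (u j) a, leg (v j) b} \<in> E"
      using ch[OF j] by (auto simp: chord_def)
    have a1: "1 \<le> a" "1 \<le> b" using c by auto
    have sp: "leg (u j) l \<noteq> leg (v j) l" if "a \<le> l" "b \<le> l" "l \<le> lev (u j)" "l \<le> lev (v j)" for l
      using sep[OF k, of l] that c by simp
    have fe: "{leg (u j) a, leg (v j) b} = f" using f(4)[OF j] by (simp add: chord_edge_def)
    obtain X where X: "X \<subseteq> Tri" "nontree_bd X = insert {u j, v j} ({{leg (u j) a, leg (v j) b}} - cycle_edges C - tree_edges)"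
      "\<Union>X \<inter> \<Union>(Tri - X) = set (leg_path (u j) (v j) a b)"
      "\<And>e t. e \<in> cycle_edges C \<Longrightarrow> t \<in> Tri \<Longrightarrow> e \<subseteq> t \<Longrightarrow> t \<in> X \<longleftrightarrow> e = {leg (u j) a, leg (v j) b}"
      by (rule leg_path_region[OF edge_in(1,2)[OF k] a1(1) c(2) a1(2) c(4,5) sp c(6)], assumption+) blast
    have "P j X" unfolding P_def using X f(2)[OF j] unfolding fe by auto
    then show ?thesis by blast
  qed
  then obtain X where XP: "\<And>j. j \<in> J \<Longrightarrow> P j (X j)" by metis
  have X: "X j \<subseteq> Tri" "nontree_bd (X j) = insert {u j, v j} ({f} - cycle_edges C)"
    "\<Union>(X j) \<inter> \<Union>(Tri - X j) = set (leg_path (u j) (v j) a b)"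
    "\<And>e t. e \<in> cycle_edges C \<Longrightarrow> t \<in> Tri \<Longrightarrow> e \<subseteq> t \<Longrightarrow> t \<in> X j \<longleftrightarrow> e = f" if "j \<in> J" for j
    using XP[OF that] by (simp_all add: P_def)
  have cover: "set C \<subseteq> \<Union>(Tri - X j)" if j: "j \<in> J" for j
  proof
    fix z assume z: "z \<in> set C"
    have fP: "f \<subseteq> set (leg_path (u j) (v j) a b)"
      using ch[OF j] by (auto simp: f_def set_leg_path chord_def)
    obtain e where e: "e \<in> cycle_edges C" "z \<in> e" using z cycle_edges_cover by metis
    then obtain t where t: "t \<in> Tri" "e \<subseteq> t" using edge_Tri[of e] C_cycle(4) by (meson subsetD)
    show "z \<in> \<Union>(Tri - X j)"
    proof (cases "e = f")
      case True
      then have "z \<in> set (leg_path (u j) (v j) a b)" using e fP by blast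
      then show ?thesis using X(3)[OF j] by blast
    next
      case False
      then have "t \<notin> X j" using X(4)[OF j e(1) t] by simp
      then show ?thesis using t e by blast
    qed
  qed
  have Fdec: "F j \<subseteq> F i" if "i \<in> J" "j \<in> J" "i < j" for i j using F_dec[of i j] J'(4)[OF that(2)] that(3) by simp
  have FT: "F j \<subseteq> Tri" "nontree_bd (F j) = {{u j, v j}}" "F j \<noteq> {}" if "j \<in> J" for j
    using reg[OF J'(3,4)[OF that]] Region_tri(1)[OF reg[OF J'(3,4)[OF that]]] by (auto simp: Region_def)
  have decI: "\<forall>i\<in>J. \<forall>j\<in>J. i < j \<longrightarrow> X j \<subseteq> X i"
    if g: "\<And>j. j \<in> J \<Longrightarrow> X j = g (F j)" "\<And>A B. A \<subseteq> B \<Longrightarrow> g A \<subseteq> g B" for g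
  proof (intro ballI impI)
    fix i j assume ij: "i \<in> J" "j \<in> J" "i < j"
    show "X j \<subseteq> X i" unfolding g(1)[OF ij(1)] g(1)[OF ij(2)] by (rule g(2)[OF Fdec[OF ij]])
  qed
  have incI: "\<forall>i\<in>J. \<forall>j\<in>J. i < j \<longrightarrow> X i \<subseteq> X j"
    if g: "\<And>j. j \<in> J \<Longrightarrow> X j = g (F j)" "\<And>A B. A \<subseteq> B \<Longrightarrow> g B \<subseteq> g A" for g
  proof (intro ballI impI)
    fix i j assume ij: "i \<in> J" "j \<in> J" "i < j"
    show "X i \<subseteq> X j" unfolding g(1)[OF ij(1)] g(1)[OF ij(2)] by (rule g(2)[OF Fdec[OF ij]])
  qed
  have "(\<forall>i\<in>J. \<forall>j\<in>J. i < j \<longrightarrow> X j \<subseteq> X i) \<or> (\<forall>i\<in>J. \<forall>j\<in>J. i < j \<longrightarrow> X i \<subseteq> X j)"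
  proof (cases "f \<in> cycle_edges C")
    case True
    have XF: "X j = F j \<or> X j = Tri - F j" if j: "j \<in> J" for j
      using nontree_bd_eq[OF X(1)[OF j] FT(1)[OF j]] X(2)[OF j] FT(2)[OF j] True by simp
    have tX: "t0 \<in> X j \<longleftrightarrow> {u 0, v 0} = f" if "j \<in> J" for j using X(4)[OF that e0 t0(1,2)] .
    show ?thesis
    proof (cases "{u 0, v 0} = f")
      case True
      then have "X j = Tri - F j" if "j \<in> J" for j using XF[OF that] tX[OF that] t0F[OF that] by metis
      then show ?thesis using incI[of "\<lambda>A. Tri - A"] by blast
    next
      case False
      then have "X j = F j" if "j \<in> J" for j using XF[OF that] tX[OF that] t0F[OF that] t0(1) by (metis DiffI)
      then show ?thesis using decI[of "\<lambda>A. A"] by blast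
    qed
  next
    case False
    obtain j0 where j0: "j0 \<in> J" using J(2) by blast
    have fNT: "{x, y} \<in> nontree_edges" using f(1,2)[OF j0] False by (simp add: nontree_edges_def f_def)
    obtain R where "Region x y R" using Region_exists[OF fNT] by blast
    then have "Region x y R" "Region x y (Tri - R)" by (auto intro: Region_compl)
    then obtain Q where Q: "Region x y Q" "t0 \<notin> Q" using t0(1) by blast
    have QT: "Q \<subseteq> Tri" "nontree_bd Q = {f}" using Q(1) by (auto simp: Region_def f_def)
    \<comment> \<open>The boundary leaves two candidates, and \<open>t0\<close> decides between
      them: it belongs to none of \<open>X j\<close>, \<open>F j\<close> and
      \<open>Q\<close>.\<close>
    have Xeq: "X j = sym_diff (F j) Q" if j: "j \<in> J" for j
    proof -
      have sd: "sym_diff (F j) Q \<subseteq> Tri" using FT(1)[OF j] QT(1) by blast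
      have "nontree_bd (sym_diff (F j) Q) = sym_diff {{u j, v j}} {f}"
        using nontree_bd_sym_diff[OF FT(1)[OF j] QT(1)] FT(2)[OF j] QT(2) by simp
      also have "\<dots> = insert {u j, v j} {f}" using f(3)[OF j] by auto
      also have "\<dots> = nontree_bd (X j)"
      proof -
        have "{f} - cycle_edges C = {f}" using False by blast
        then show ?thesis using X(2)[OF j] by metis
      qed
      finally have "X j = sym_diff (F j) Q \<or> X j = Tri - sym_diff (F j) Q"
        using nontree_bd_eq[OF X(1)[OF j] sd] by simp
      moreover have "t0 \<notin> X j" using X(4)[OF j e0 t0(1,2)] False e0 by auto
      moreover have "t0 \<in> Tri - sym_diff (F j) Q" using t0F[OF j] Q(2) t0(1) by blast
      ultimately show ?thesis by metis
    qed
    have io: "\<not> ((\<exists>t\<in>F j. f \<subseteq> t) \<and> (\<exists>t\<in>Tri - F j. f \<subseteq> t))" if j: "j \<in> J" for j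
      using in_out[OF J'(1,2)[OF j] f(1,2,3)[OF j]] .
    from side show ?thesis
    proof
      assume s: "\<forall>j\<in>J. \<exists>t\<in>F j. {x, y} \<subseteq> t"
      have "Q \<subseteq> F j" if j: "j \<in> J" for j
      proof -
        have no: "\<forall>t\<in>Tri - F j. \<not> f \<subseteq> t" using io[OF j] s j unfolding f_def by blast
        have "nontree_bd (Tri - F j) = {{u j, v j}}" using nontree_bd_compl FT[OF j] by simp
        moreover have "Tri - F j \<noteq> Tri" "Tri - F j \<subseteq> Tri" using FT(1,3)[OF j] by blast+
        ultimately have "(Tri - F j) \<inter> Q = {} \<or> Tri - F j \<subseteq> Q"
          by (intro nontree_bd_inter[OF _ QT(1) _ QT(2) no])
        then show ?thesis using t0(1) t0F[OF j] Q(2) QT(1) by blast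
      qed
      then have "sym_diff (F j) Q = F j - Q" if "j \<in> J" for j using that by blast
      then have "X j = F j - Q" if "j \<in> J" for j using Xeq[OF that] that by metis
      then show ?thesis using decI[of "\<lambda>A. A - Q"] by blast
    next
      assume s: "\<forall>j\<in>J. \<exists>t\<in>Tri - F j. {x, y} \<subseteq> t"
      have alt: "F j \<inter> Q = {} \<or> F j \<subseteq> Q" if j: "j \<in> J" for j
      proof -
        have no: "\<forall>t\<in>F j. \<not> f \<subseteq> t" using io[OF j] s j unfolding f_def by blast
        have "F j \<noteq> Tri" using t0F[OF j] t0(1) by blast
        then show ?thesis using nontree_bd_inter[OF FT(1)[OF j] QT(1) FT(2)[OF j] QT(2) no] by blast
      qed
      \<comment> \<open>Either every member lies in \<open>Q\<close>, and then the regions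
        \<open>Q - F j\<close> increase, or some member is disjoint from \<open>Q\<close>, and then
        all are, because the regions are nested.\<close>
      show ?thesis
      proof (cases "\<forall>j\<in>J. F j \<subseteq> Q")
        case True
        then have "sym_diff (F j) Q = Q - F j" if "j \<in> J" for j using that by blast
        then have "X j = Q - F j" if "j \<in> J" for j using Xeq[OF that] that by metis
        then show ?thesis using incI[of "\<lambda>A. Q - A"] by blast
      next
        case False
        then obtain j1 where j1: "j1 \<in> J" "\<not> F j1 \<subseteq> Q" by blast
        then have d1: "F j1 \<inter> Q = {}" using alt by blast
        have "F j \<inter> Q = {}" if j: "j \<in> J" for j
        proof (cases j j1 rule: linorder_cases)
          case less
          have "F j1 \<subseteq> F j" by (rule Fdec[OF j j1(1) less])
          then have "\<not> F j \<subseteq> Q" using j1(2) by blast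
          then show ?thesis using alt[OF j] by blast
        next
          case equal then show ?thesis using d1 by simp
        next
          case greater
          have "F j \<subseteq> F j1" by (rule Fdec[OF j1(1) j greater])
          then show ?thesis using d1 by blast
        qed
        then have "sym_diff (F j) Q = F j \<union> Q" if "j \<in> J" for j using that by blast
        then have "X j = F j \<union> Q" if "j \<in> J" for j using Xeq[OF that] that by metis
        then show ?thesis using decI[of "\<lambda>A. A \<union> Q"] by blast
      qed
    qed
  qed
  moreover have "X j \<subseteq> Tri \<and> \<Union>(X j) \<inter> \<Union>(Tri - X j) = set (leg_path (u j) (v j) a b) \<and> set C \<subseteq> \<Union>(Tri - X j)"
    if "j \<in> J" for j using X(1,3)[OF that] cover[OF that] by simp
  ultimately show ?thesis by (intro that)
qed

text \<open>The chord has the greatest level sum among the chords of each member, so the part of the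
  legs on its cycle has no further chord. By \<open>a \<le> b\<close> and the levels of adjacent
  vertices \<open>b\<close> is \<open>a\<close> or \<open>Suc a\<close>, which puts the
  distinguished vertices on the lowest layer.\<close>

lemma chord_separators:
  fixes G :: "'a drawn_graph"
  assumes G: "vertices G = V" "edges G = E" "\<And>x m. x \<in> layer G m \<longleftrightarrow> x \<in> V \<and> lev x = m"
    and J: "finite J" "t \<le> card J" "J \<subseteq> {\<alpha>..\<beta>}" "t \<ge> 1"
    and lv: "\<And>j. j \<in> J \<Longrightarrow> lev (u j) = p1 \<and> lev (v j) = p2"
    and ch: "\<And>j. j \<in> J \<Longrightarrow> chord j a b \<and> leg (u j) a = x \<and> leg (v j) b = y"
    and mx: "\<And>j a' b'. j \<in> J \<Longrightarrow> chord j a' b' \<Longrightarrow> a' + b' \<le> a + b"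
    and side: "(\<forall>j\<in>J. \<exists>t\<in>F j. {x, y} \<subseteq> t) \<or> (\<forall>j\<in>J. \<exists>t\<in>Tri - F j. {x, y} \<subseteq> t)"
    and ab: "a \<le> b"
  shows "\<exists>p A S B. well_formed_separator_sequence G t p A S B \<and> p \<le> p1 + p2"
proof -
  have Jne: "J \<noteq> {}" using J(2,4) by auto
  obtain X where X: "\<And>j. j \<in> J \<Longrightarrow> X j \<subseteq> Tri \<and> \<Union>(X j) \<inter> \<Union>(Tri - X j) = set (leg_path (u j) (v j) a b) \<and> set C \<subseteq> \<Union>(Tri - X j)"
    "(\<forall>i\<in>J. \<forall>j\<in>J. i < j \<longrightarrow> X j \<subseteq> X i) \<or> (\<forall>i\<in>J. \<forall>j\<in>J. i < j \<longrightarrow> X i \<subseteq> X j)"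
    using chord_regions[OF J(3) Jne ch side] by blast
  obtain \<sigma> where \<sigma>: "\<And>i. i \<in> {1..t} \<Longrightarrow> \<sigma> i \<in> J" "\<And>i. i \<in> {1..<t} \<Longrightarrow> \<sigma> i \<noteq> \<sigma> (i + 1) \<and> X (\<sigma> (i + 1)) \<subseteq> X (\<sigma> i)"
    using monotone_enumeration[OF J(1,2) X(2)] by blast
  have sj: "\<alpha> \<le> \<sigma> i" "\<sigma> i \<le> \<beta>" "lev (u (\<sigma> i)) = p1" "lev (v (\<sigma> i)) = p2"
    "u (\<sigma> i) \<in> V" "v (\<sigma> i) \<in> V" "H < a" "a \<le> p1" "H < b" "b \<le> p2" "a \<noteq> p1 \<or> b \<noteq> p2" "{x, y} \<in> E"
    "leg (u (\<sigma> i)) a = x" "leg (v (\<sigma> i)) b = y" if "i \<in> {1..t}" for i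
  proof -
    have "\<sigma> i \<in> {\<alpha>..\<beta>}" using \<sigma>(1)[OF that] J(3) by blast
    then show *: "\<alpha> \<le> \<sigma> i" "\<sigma> i \<le> \<beta>" by auto
    show **: "lev (u (\<sigma> i)) = p1" "lev (v (\<sigma> i)) = p2" using lv[OF \<sigma>(1)[OF that]] by auto
    show "u (\<sigma> i) \<in> V" "v (\<sigma> i) \<in> V" using UV[OF *] by auto
    show "H < a" "a \<le> p1" "H < b" "b \<le> p2" "a \<noteq> p1 \<or> b \<noteq> p2" "{x, y} \<in> E" "leg (u (\<sigma> i)) a = x" "leg (v (\<sigma> i)) b = y"
      using ch[OF \<sigma>(1)[OF that]] ** by (auto simp: chord_def)
  qed
  have i1: "i \<in> {1..t}" "i + 1 \<in> {1..t}" if "i \<in> {1..<t}" for i using that by auto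
  have one: "1 \<in> {1..t}" using J(4) by simp
  note o = sj[OF one]
  have lx: "lev x = a" "lev y = b" using leg_lev[OF o(1,2)] o by auto
  have bb: "b = a \<or> b = Suc a" using lev_edge[OF o(12)] lx ab by auto
  have a1: "1 \<le> a" "1 \<le> b" using o(7,9) by auto
  have cedge: "cycle_edges (leg_path (u (\<sigma> i)) (v (\<sigma> i)) a b) = insert {x, y} (walk_edges (leg_path (u (\<sigma> i)) (v (\<sigma> i)) a b))"
    if i: "i \<in> {1..t}" for i using cycle_leg_path[OF sj(1,2)[OF i], of a b] sj[OF i] by simp
  have ind: "{e \<in> E. e \<subseteq> set (leg_path (u (\<sigma> i)) (v (\<sigma> i)) a b)} = cycle_edges (leg_path (u (\<sigma> i)) (v (\<sigma> i)) a b)" if i: "i \<in> {1..t}" for i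
  proof -
    note k = sj[OF i]
    have "e \<in> cycle_edges (leg_path (u (\<sigma> i)) (v (\<sigma> i)) a b)" if e: "e \<in> E" "e \<subseteq> set (leg_path (u (\<sigma> i)) (v (\<sigma> i)) a b)" for e
    proof -
      have "e \<in> walk_edges (leg_path (u (\<sigma> i)) (v (\<sigma> i)) a b) \<or> (\<exists>l l'. a \<le> l \<and> b \<le> l' \<and> chord (\<sigma> i) l l' \<and> e = chord_edge (\<sigma> i) l l')"
        using induced_above[OF k(1,2) k(7,9) _ _ e] k by simp
      then show ?thesis
      proof
        assume "\<exists>l l'. a \<le> l \<and> b \<le> l' \<and> chord (\<sigma> i) l l' \<and> e = chord_edge (\<sigma> i) l l'"
        then obtain l l' where l: "a \<le> l" "b \<le> l'" "chord (\<sigma> i) l l'" "e = chord_edge (\<sigma> i) l l'" by blast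
        then have "l = a" "l' = b" using mx[OF \<sigma>(1)[OF i] l(3)] by auto
        then show ?thesis using l(4) k cedge[OF i] by (simp add: chord_edge_def)
      qed (use cedge[OF i] in simp)
    qed
    moreover have "cycle_edges (leg_path (u (\<sigma> i)) (v (\<sigma> i)) a b) \<subseteq> E"
      unfolding cedge[OF i] using walk_leg_path_edges(2)[OF k(1,2) a1] k by auto
    ultimately show ?thesis using cycle_edges_subset by blast
  qed
  have "\<exists>p. p \<le> p1 + p2 \<and> well_formed_separator_sequence G t p (\<lambda>i. \<Union>(Tri - X (\<sigma> i)))
        (\<lambda>i. set (leg_path (u (\<sigma> i)) (v (\<sigma> i)) a b)) (\<lambda>i. \<Union>(X (\<sigma> i)))"
  proof (rule wfs_cycle[OF G, where us = "\<lambda>i. u (\<sigma> i)" and vs = "\<lambda>i. v (\<sigma> i)" and X = "\<lambda>i. X (\<sigma> i)" and t = t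
       and ?p1.0 = p1 and ?p2.0 = p2 and a = a and b = b and c = x and d = y])
    show "u (\<sigma> i) \<in> V \<and> v (\<sigma> i) \<in> V \<and> lev (u (\<sigma> i)) = p1 \<and> lev (v (\<sigma> i)) = p2" if "i \<in> {1..t}" for i
      using sj[OF that] by simp
    show "1 \<le> a" "a \<le> p1" "b \<le> p2" "b = a \<or> b = Suc a" "3 \<le> (Suc p1 - a) + (Suc p2 - b)"
      using o bb a1 by auto
    show "leg (u (\<sigma> i)) l \<noteq> leg (v (\<sigma> j)) l" if "i \<in> {1..t}" "j \<in> {1..t}" "a \<le> l" "b \<le> l" "l \<le> p1" "l \<le> p2" for i j l
      using cross[OF sj(1,2)[OF that(1)] sj(1,2)[OF that(2)], of l] sj[OF that(1)] sj(4)[OF that(2)] that by simp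
    show "leg (u (\<sigma> i)) a = x" if "i \<in> {1..t}" for i using sj(13)[OF that] .
    show "leg (v (\<sigma> i)) a = y" if "i \<in> {1..t}" "b = a" for i using sj(14)[OF that(1)] that(2) by simp
    show "X (\<sigma> i) \<subseteq> Tri" "\<Union>(X (\<sigma> i)) \<inter> \<Union>(Tri - X (\<sigma> i)) = set (leg_path (u (\<sigma> i)) (v (\<sigma> i)) a b)" if "i \<in> {1..t}" for i
      using X(1)[OF \<sigma>(1)[OF that]] by simp_all
    show "X (\<sigma> (i + 1)) \<subseteq> X (\<sigma> i)" if "i \<in> {1..<t}" for i using \<sigma>(2)[OF that] by simp
    show "{e \<in> E. e \<subseteq> set (leg_path (u (\<sigma> i)) (v (\<sigma> i)) a b)} = cycle_edges (leg_path (u (\<sigma> i)) (v (\<sigma> i)) a b)" if "i \<in> {1..t}" for i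
      by (rule ind[OF that])
    show "set (leg_path (u (\<sigma> i)) (v (\<sigma> i)) a b) \<noteq> set (leg_path (u (\<sigma> (i + 1))) (v (\<sigma> (i + 1))) a b)" if i: "i \<in> {1..<t}" for i
    proof
      assume eq: "set (leg_path (u (\<sigma> i)) (v (\<sigma> i)) a b) = set (leg_path (u (\<sigma> (i + 1))) (v (\<sigma> (i + 1))) a b)"
      note k = sj[OF i1(1)[OF i]] and k' = sj[OF i1(2)[OF i]]
      have "{u (\<sigma> (i + 1)), v (\<sigma> (i + 1))} \<subseteq> set (leg_path (u (\<sigma> i)) (v (\<sigma> i)) a b)"
        unfolding eq by (rule edge_in_leg_path) (use k' in auto)
      then have "{u (\<sigma> (i + 1)), v (\<sigma> (i + 1))} \<in> insert {x, y} (walk_edges (leg_path (u (\<sigma> i)) (v (\<sigma> i)) a b))"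
        unfolding cedge[OF i1(1)[OF i], symmetric] ind[OF i1(1)[OF i], symmetric] using edge_in(3)[OF k'(1,2)] by simp
      moreover have "{u (\<sigma> (i + 1)), v (\<sigma> (i + 1))} \<noteq> {x, y}"
        using chord_ne(1)[OF k'(1,2), of a b] ch[OF \<sigma>(1)[OF i1(2)[OF i]]] by (auto simp: chord_edge_def)
      ultimately have "{u (\<sigma> (i + 1)), v (\<sigma> (i + 1))} \<in> insert {u (\<sigma> i), v (\<sigma> i)} tree_edges"
        using walk_leg_path_edges(1)[OF k(1,2) a1] k by auto
      then have "{u (\<sigma> (i + 1)), v (\<sigma> (i + 1))} = {u (\<sigma> i), v (\<sigma> i)}" using edge_in(2)[OF k'(1,2)] by simp
      then show False using distinct_edges[OF k(1,2) k'(1,2)] \<sigma>(2)[OF i] by metis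
    qed
    show "set C \<subseteq> \<Union>(Tri - X (\<sigma> 1))" using X(1)[OF \<sigma>(1)[OF one]] by simp
  qed
  then show ?thesis by blast
qed

text \<open>Exchanging the two ends reduces to \<open>a \<le> b\<close>.\<close>

lemma chord_separators_any:
  fixes G :: "'a drawn_graph"
  assumes G: "vertices G = V" "edges G = E" "\<And>x m. x \<in> layer G m \<longleftrightarrow> x \<in> V \<and> lev x = m"
    and J: "finite J" "t \<le> card J" "J \<subseteq> {\<alpha>..\<beta>}" "t \<ge> 1"
    and lv: "\<And>j. j \<in> J \<Longrightarrow> lev (u j) = p1 \<and> lev (v j) = p2"
    and ch: "\<And>j. j \<in> J \<Longrightarrow> chord j a b \<and> leg (u j) a = x \<and> leg (v j) b = y"
    and mx: "\<And>j a' b'. j \<in> J \<Longrightarrow> chord j a' b' \<Longrightarrow> a' + b' \<le> a + b"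
    and side: "(\<forall>j\<in>J. \<exists>t\<in>F j. {x, y} \<subseteq> t) \<or> (\<forall>j\<in>J. \<exists>t\<in>Tri - F j. {x, y} \<subseteq> t)"
  shows "\<exists>p A S B. well_formed_separator_sequence G t p A S B \<and> p \<le> p1 + p2"
proof (cases "a \<le> b")
  case True
  show ?thesis
    by (rule chord_separators[OF G J _ _ _ side True, where ?p1.0 = p1 and ?p2.0 = p2]) (use lv ch mx in blast)+
next
  case False
  interpret sw: constant_join V E Tri C lev r v u F N \<alpha> \<beta> H by (rule swapped_const)
  have sc: "sw.chord j b' a' \<longleftrightarrow> chord j a' b'" for j a' b'
    by (auto simp: sw.chord_def chord_def insert_commute)
  have lv': "lev (v j) = p2 \<and> lev (u j) = p1" if "j \<in> J" for j using lv[OF that] by simp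
  have ch': "sw.chord j b a \<and> leg (v j) b = y \<and> leg (u j) a = x" if "j \<in> J" for j using ch[OF that] sc by simp
  have mx': "b' + a' \<le> b + a" if "j \<in> J" "sw.chord j b' a'" for j a' b' using mx[OF that(1), of a' b'] that(2) sc by simp
  have side': "(\<forall>j\<in>J. \<exists>t\<in>F j. {y, x} \<subseteq> t) \<or> (\<forall>j\<in>J. \<exists>t\<in>Tri - F j. {y, x} \<subseteq> t)" using side by (simp add: insert_commute)
  have "b \<le> a" using False by simp
  then have "\<exists>p A S B. well_formed_separator_sequence G t p A S B \<and> p \<le> p2 + p1"
    by (intro sw.chord_separators[OF G J _ _ _ side', where ?p1.0 = p2 and ?p2.0 = p1]) (use lv' ch' mx' in blast)+
  then show ?thesis by (simp add: add.commute)
qed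

text \<open>A chord of a member of \<open>J\<close> has level sum less than \<open>c\<close>, so it
  is never the edge of a member of the interval; this removes the only obstruction to its
  persistence. Once the levels of the ends, the greatest level sum of a chord and the side of that
  chord are fixed, a single chord serves a whole class.\<close>

lemma select_separators:
  fixes G :: "'a drawn_graph"
  assumes G: "vertices G = V" "edges G = E" "\<And>x m. x \<in> layer G m \<longleftrightarrow> x \<in> V \<and> lev x = m"
    and J: "finite J" "4 * r\<^sup>2 * t \<le> card J" "J \<subseteq> {\<alpha>..\<beta>}" "t \<ge> 1" "r \<ge> 1"
    and mn: "\<And>i. \<alpha> \<le> i \<Longrightarrow> i \<le> \<beta> \<Longrightarrow> c \<le> lev (u i) + lev (v i)"
    and eq: "\<And>j. j \<in> J \<Longrightarrow> lev (u j) + lev (v j) = c"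
  shows "\<exists>p A S B. well_formed_separator_sequence G t p A S B \<and> p \<le> 2 * r"
proof -
  have J': "\<alpha> \<le> j" "j \<le> \<beta>" "1 \<le> j" "j \<le> N" if "j \<in> J" for j
  proof -
    have "j \<in> {\<alpha>..\<beta>}" using that J(3) by blast
    then show "\<alpha> \<le> j" "j \<le> \<beta>" "1 \<le> j" "j \<le> N" using \<alpha> \<beta> by auto
  qed
  have Jlev: "1 \<le> lev (u j)" "lev (u j) \<le> r" "1 \<le> lev (v j)" "lev (v j) \<le> r" if "j \<in> J" for j
    using lev_bounds UV[OF J'(1,2)[OF that]] by auto
  have "0 < 4 * r\<^sup>2 * t" using J(4,5) by simp
  then have Jne: "J \<noteq> {}" using J(2) by fastforce
  have cle: "c \<le> 2 * r" using Jne Jlev eq by fastforce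
  have small: "a + b < c" if "j \<in> J" "chord j a b" for j a b
    using that eq[OF that(1)] by (auto simp: chord_def)
  have not_chain: "chord_edge j a b \<noteq> {u k, v k}" if j: "j \<in> J" "chord j a b" and k: "\<alpha> \<le> k" "k \<le> \<beta>" for j a b k
  proof
    assume e: "chord_edge j a b = {u k, v k}"
    have lv: "lev (leg (u j) a) = a" "lev (leg (v j) b) = b"
      using leg_lev[OF J'(1,2)[OF j(1)]] j(2) by (auto simp: chord_def)
    have "a + b = lev (u k) + lev (v k)" using e lv by (auto simp: chord_edge_def doubleton_eq_iff)
    then show False using small[OF j] mn[OF k] by simp
  qed
  define best where "best = (\<lambda>j (a, b). chord j a b \<and> (\<forall>a' b'. chord j a' b' \<longrightarrow> a' + b' \<le> a + b))"
  have best_ex: "\<exists>ab. best j ab" if j: "j \<in> J" "\<exists>a b. chord j a b" for j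
  proof -
    obtain a b where ab: "chord j a b" using j(2) by blast
    obtain p where p: "(\<lambda>(a, b). chord j a b) p" "\<And>q. (\<lambda>(a, b). chord j a b) q \<Longrightarrow> (\<lambda>(a, b). a + b) q \<le> (\<lambda>(a, b). a + b) p"
    proof (rule ex_has_greatest_nat[of "\<lambda>(a, b). chord j a b" "(a, b)" "\<lambda>(a, b). a + b" "Suc c", THEN exE])
      show "(\<lambda>(a, b). chord j a b) (a, b)" using ab by simp
      show "\<forall>y. (\<lambda>(a, b). chord j a b) y \<longrightarrow> (\<lambda>(a, b). a + b) y < Suc c" using small[OF j(1)] by fastforce
    qed blast
    obtain a' b' where "p = (a', b')" by (cases p)
    then show ?thesis using p by (intro exI[of _ p]) (auto simp: best_def)
  qed
  define B where "B = (\<lambda>j. SOME ab. best j ab)"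
  have bestB: "best j (B j)" if "j \<in> J" "\<exists>a b. chord j a b" for j
    unfolding B_def by (rule someI_ex[OF best_ex[OF that]])
  \<comment> \<open>The value 0 stands for the absence of chords, since chords have ends on positive
    levels.\<close>
  define wt where "wt = (\<lambda>j. if \<exists>a b. chord j a b then fst (B j) + snd (B j) else 0)"
  define sd where "sd = (\<lambda>j. \<exists>s\<in>F j. chord_edge j (fst (B j)) (snd (B j)) \<subseteq> s)"
  \<comment> \<open>The level of \<open>v j\<close> follows from that of \<open>u j\<close>, because
    their sum is \<open>c\<close>. There are \<open>r\<close> levels, \<open>2 * r\<close> weights
    and two sides: this is the factor \<open>4 * r\<^sup>2\<close>.\<close>
  define cl where "cl = (\<lambda>j. (lev (u j), wt j, sd j))"
  have wtb: "wt j < 2 * r" if "j \<in> J" for j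
  proof (cases "\<exists>a b. chord j a b")
    case True
    then have "chord j (fst (B j)) (snd (B j))" using bestB[OF that True] by (auto simp: best_def split: prod.splits)
    then show ?thesis using small[OF that] cle True by (fastforce simp: wt_def)
  next
    case False
    then have "wt j = 0" unfolding wt_def by (rule if_not_P)
    then show ?thesis using J(5) by simp
  qed
  have img: "cl ` J \<subseteq> {1..r} \<times> {..<2 * r} \<times> UNIV" using Jlev wtb by (auto simp: cl_def)
  have cK: "card ({1..r} \<times> {..<2 * r} \<times> (UNIV :: bool set)) * t \<le> card J"
    using J(2) by (simp add: card_cartesian_product power2_eq_square)
  obtain y where y: "t \<le> card {j \<in> J. cl j = y}"
  proof (rule pigeonhole_class[OF J(1) img _ cK Jne])
    show "finite ({1..r} \<times> {..<2 * r} \<times> (UNIV :: bool set))" by simp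
  qed (rule that)
  define K where "K = {j \<in> J. cl j = y}"
  obtain p1 \<kappa> s where ys: "y = (p1, \<kappa>, s)" by (cases y)
  have KJ: "K \<subseteq> J" "finite K" "t \<le> card K" "K \<subseteq> {\<alpha>..\<beta>}" using J(1,3) y by (auto simp: K_def)
  have Kne: "K \<noteq> {}" using KJ(3) J(4) by auto
  define p2 where "p2 = c - p1"
  have Kl: "lev (u j) = p1 \<and> lev (v j) = p2" "wt j = \<kappa>" "sd j = s" if "j \<in> K" for j
    using that eq[of j] by (auto simp: K_def cl_def ys p2_def)
  obtain k0 where k0: "k0 \<in> K" using Kne by blast
  have p12: "p1 + p2 \<le> 2 * r" using Kl(1)[OF k0] Jlev[of k0] KJ(1) k0 by auto
  have "\<exists>p A S B. well_formed_separator_sequence G t p A S B \<and> p \<le> p1 + p2"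
  proof (cases "\<kappa> = 0")
    case True
    have nc: "\<not> chord j a b" if j: "j \<in> K" for j a b
    proof
      assume c: "chord j a b"
      then have ex: "\<exists>a b. chord j a b" by blast
      have "a + b \<le> fst (B j) + snd (B j)" using bestB[OF _ ex] c KJ(1) j by (auto simp: best_def split: prod.splits)
      moreover have "fst (B j) + snd (B j) = 0" using Kl(2)[OF j] True ex by (simp add: wt_def)
      ultimately show False using c by (auto simp: chord_def)
    qed
    show ?thesis by (rule no_chord_separators[OF G KJ(2,3,4) J(4)]) (use Kl(1) nc in blast)+
  next
    case False
    have cB: "chord j (fst (B j)) (snd (B j))" "fst (B j) + snd (B j) = \<kappa>" "\<And>a' b'. chord j a' b' \<Longrightarrow> a' + b' \<le> \<kappa>" if j: "j \<in> K" for j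
    proof -
      have ex: "\<exists>a b. chord j a b" using Kl(2)[OF j] False by (auto simp: wt_def split: if_splits)
      have jJ: "j \<in> J" using j KJ(1) by blast
      show "chord j (fst (B j)) (snd (B j))" using bestB[OF jJ ex] by (auto simp: best_def split: prod.splits)
      show k: "fst (B j) + snd (B j) = \<kappa>" using Kl(2)[OF j] ex by (simp add: wt_def)
      show "a' + b' \<le> \<kappa>" if "chord j a' b'" for a' b'
        using bestB[OF jJ ex] that k by (auto simp: best_def split: prod.splits)
    qed
    show ?thesis
    proof (cases s)
      case True
      \<comment> \<open>Chords on the inner side persist to the right, so the chord of the first
        member is a chord of all. Since all members have the same weight, it has the greatest level
        sum in each of them.\<close>
      define j0 where "j0 = Min K"
      have j0: "j0 \<in> K" "\<And>j. j \<in> K \<Longrightarrow> j0 \<le> j" using KJ(2) Kne by (auto simp: j0_def)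
      have j0J: "j0 \<in> J" using j0 KJ(1) by blast
      define a where "a = fst (B j0)"
      define b where "b = snd (B j0)"
      have c0: "chord j0 a b" using cB(1)[OF j0(1)] by (simp add: a_def b_def)
      have in0: "\<exists>t\<in>F j0. chord_edge j0 a b \<subseteq> t" using Kl(3)[OF j0(1)] True by (simp add: sd_def a_def b_def)
      have per: "(\<exists>t\<in>F j. chord_edge j0 a b \<subseteq> t) \<and> chord j a b \<and> leg (u j) a = leg (u j0) a \<and> leg (v j) b = leg (v j0) b"
        if j: "j \<in> K" for j
      proof (rule right_persist[OF J'(1)[OF j0J] c0 in0 j0(2)[OF j]])
        have jJ: "j \<in> J" using j KJ(1) by blast
        show "j \<le> \<beta>" using J'(2)[OF jJ] .
        show "chord_edge j0 a b \<noteq> {u k, v k}" if "j0 < k" "k \<le> j" for k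
          using not_chain[OF j0J c0, of k] that J'(1)[OF j0J] J'(2)[OF jJ] by simp
      qed
      show ?thesis
      proof (rule chord_separators_any[OF G KJ(2,3,4) J(4) Kl(1), where a = a and b = b and x = "leg (u j0) a" and y = "leg (v j0) b"])
        show "chord j a b \<and> leg (u j) a = leg (u j0) a \<and> leg (v j) b = leg (v j0) b" if "j \<in> K" for j using per[OF that] by simp
        show "a' + b' \<le> a + b" if "j \<in> K" "chord j a' b'" for j a' b'
          using cB(3)[OF that] cB(2)[OF j0(1)] by (simp add: a_def b_def)
        show "(\<forall>j\<in>K. \<exists>t\<in>F j. {leg (u j0) a, leg (v j0) b} \<subseteq> t) \<or> (\<forall>j\<in>K. \<exists>t\<in>Tri - F j. {leg (u j0) a, leg (v j0) b} \<subseteq> t)"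
          using per by (auto simp: chord_edge_def)
      qed
    next
      case False
      \<comment> \<open>Chords on the outer side persist to the left, so here the chord of the last
        member is shared by all.\<close>
      define j0 where "j0 = Max K"
      have j0: "j0 \<in> K" "\<And>j. j \<in> K \<Longrightarrow> j \<le> j0" using KJ(2) Kne by (auto simp: j0_def)
      have j0J: "j0 \<in> J" using j0 KJ(1) by blast
      define a where "a = fst (B j0)"
      define b where "b = snd (B j0)"
      have c0: "chord j0 a b" using cB(1)[OF j0(1)] by (simp add: a_def b_def)
      have "\<not> (\<exists>t\<in>F j0. chord_edge j0 a b \<subseteq> t)" using Kl(3)[OF j0(1)] False by (simp add: sd_def a_def b_def)
      moreover have "\<exists>t\<in>Tri. chord_edge j0 a b \<subseteq> t" using edge_Tri chord_ne(3)[OF J'(1,2)[OF j0J] c0] by blast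
      ultimately have out0: "\<exists>t\<in>Tri - F j0. chord_edge j0 a b \<subseteq> t" by blast
      have per: "(\<exists>t\<in>Tri - F j. chord_edge j0 a b \<subseteq> t) \<and> chord j a b \<and> leg (u j) a = leg (u j0) a \<and> leg (v j) b = leg (v j0) b"
        if j: "j \<in> K" for j
      proof (rule left_persist[OF J'(2)[OF j0J] c0 out0 j0(2)[OF j]])
        have jJ: "j \<in> J" using j KJ(1) by blast
        show "\<alpha> \<le> j" using J'(1)[OF jJ] .
        show "chord_edge j0 a b \<noteq> {u k, v k}" if "j \<le> k" "k < j0" for k
          using not_chain[OF j0J c0, of k] that J'(2)[OF j0J] J'(1)[OF jJ] by simp
      qed
      show ?thesis
      proof (rule chord_separators_any[OF G KJ(2,3,4) J(4) Kl(1), where a = a and b = b and x = "leg (u j0) a" and y = "leg (v j0) b"])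
        show "chord j a b \<and> leg (u j) a = leg (u j0) a \<and> leg (v j) b = leg (v j0) b" if "j \<in> K" for j using per[OF that] by simp
        show "a' + b' \<le> a + b" if "j \<in> K" "chord j a' b'" for j a' b'
          using cB(3)[OF that] cB(2)[OF j0(1)] by (simp add: a_def b_def)
        show "(\<forall>j\<in>K. \<exists>t\<in>F j. {leg (u j0) a, leg (v j0) b} \<subseteq> t) \<or> (\<forall>j\<in>K. \<exists>t\<in>Tri - F j. {leg (u j0) a, leg (v j0) b} \<subseteq> t)"
          using per by (auto simp: chord_edge_def)
      qed
    qed
  qed
  then show ?thesis using p12 order_trans by blast
qed

end

section \<open>Parameters and the final bound\<close>

lemma (in leveled_disk) separators_exist:
  fixes G :: "'a drawn_graph" and t :: nat
  assumes G: "vertices G = V" "edges G = E" "\<And>x m. x \<in> layer G m \<longleftrightarrow> x \<in> V \<and> lev x = m"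
    and t: "t \<ge> 1" and r: "r \<ge> 1"
    and big: "2 ^ (r * (4 * r\<^sup>2 * t) ^ (2 * r - 1) + 1) \<le> card Tri + 1"
  shows "\<exists>p A S B. well_formed_separator_sequence G t p A S B \<and> p \<le> 2 * r"
proof -
  \<comment> \<open>Join levels range from 0 to \<open>r - 1\<close>, which gives the factor
    \<open>r\<close> in \<open>N\<close>. Sums of levels range from 2 to \<open>2 * r\<close>, which
    gives the exponent \<open>2 * r - 1\<close>.\<close>
  define s where "s = 4 * r\<^sup>2 * t"
  define M where "M = s ^ (2 * r - 1)"
  define N where "N = r * M"
  have s1: "s \<ge> 1" using t r by (simp add: s_def)
  then have M1: "M \<ge> 1" by (simp add: M_def)
  have bigN: "2 ^ (N + 1) \<le> card Tri + 1" using big by (simp add: N_def M_def s_def)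
  obtain u v F where c: "F 0 = Tri" "{u 0, v 0} \<in> outer_edges"
     "\<forall>i<N. chain_step (u i) (v i) (F i) (u (Suc i)) (v (Suc i)) (F (Suc i))"
    using chain_exists[OF bigN] by blast
  interpret separator_chain V E Tri C lev r u v F N
    by unfold_locales (use c in auto)
  have hr: "h i < r" if "1 \<le> i" "i \<le> N" for i
  proof -
    have "{u i, v i} \<in> E" "{u i, v i} \<notin> tree_edges" using reg_nontree[OF that] by (auto simp: nontree_edges_def)
    then have "h i < lev (u i)" unfolding h_def by (rule join_level_less(1))
    then show ?thesis using lev_bounds uvV[OF that] by (meson le_trans not_less)
  qed
  have rM: "r * M \<le> N" by (simp add: N_def)
  obtain a b H where ab: "1 \<le> a" "b \<le> N" "a + M \<le> Suc b" "\<And>i. a \<le> i \<Longrightarrow> i \<le> b \<Longrightarrow> h i = H"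
    using constant_interval[of N h r M, OF h_mono hr M1 rM r] by blast
  have wt: "2 \<le> lev (u i) + lev (v i) \<and> lev (u i) + lev (v i) < 2 + (2 * r - 1)" if "a \<le> i" "i < a + M" for i
  proof -
    have "1 \<le> i" "i \<le> N" using that ab by auto
    then have "u i \<in> V" "v i \<in> V" using uvV by blast+
    then show ?thesis using lev_bounds[of "u i"] lev_bounds[of "v i"] r by linarith
  qed
  have sM: "s ^ (2 * r - 1) \<le> M" by (simp add: M_def)
  have "\<exists>a' b' J c'. a \<le> a' \<and> b' \<le> a + M \<and> J \<subseteq> {a'..<b'} \<and> s \<le> card J \<and>
      (\<forall>i\<in>{a'..<b'}. c' \<le> lev (u i) + lev (v i)) \<and> (\<forall>j\<in>J. lev (u j) + lev (v j) = c')"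
    by (rule repeated_minimum[where lo = 2, OF s1 sM]) (rule wt)
  then obtain a' b' J c' where J: "a \<le> a'" "b' \<le> a + M" "J \<subseteq> {a'..<b'}" "s \<le> card J"
    "\<forall>i\<in>{a'..<b'}. c' \<le> lev (u i) + lev (v i)" "\<forall>j\<in>J. lev (u j) + lev (v j) = c'"
    by blast
  have Jne: "J \<noteq> {}" using J(4) s1 by auto
  then have b'1: "a' < b'" using J(3) by fastforce
  interpret constant_join V E Tri C lev r u v F N a' "b' - 1" H
  proof unfold_locales
    show "1 \<le> a'" "b' - 1 \<le> N" using ab J b'1 by auto
    show "h i = H" if "a' \<le> i" "i \<le> b' - 1" for i using ab(3,4) J(1,2) that b'1 by auto
  qed
  have J2: "J \<subseteq> {a'..b' - 1}" using J(3) by fastforce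
  have fin: "finite J" using J(3) finite_subset by blast
  show ?thesis
  proof (rule select_separators[OF G fin _ J2 t r])
    show "4 * r\<^sup>2 * t \<le> card J" using J(4) by (simp add: s_def)
    show "c' \<le> lev (u i) + lev (v i)" if "a' \<le> i" "i \<le> b' - 1" for i using J(5) that b'1 by auto
    show "lev (u j) + lev (v j) = c'" if "j \<in> J" for j using J(6) that by blast
  qed
qed

lemma four_square_le: "r \<ge> 1 \<Longrightarrow> 4 * r\<^sup>2 \<le> (6::nat) ^ r"
proof (induction r rule: nat_induct_at_least)
  case (Suc n)
  have "n \<le> n * n" by simp
  moreover have "4 * (Suc n)\<^sup>2 = 4 * (n * n) + 8 * n + 4" "6 * (4 * n\<^sup>2) = 24 * (n * n)"
    by (simp_all add: power2_eq_square)
  ultimately have "4 * (Suc n)\<^sup>2 \<le> 6 * (4 * n\<^sup>2)" using Suc.hyps by linarith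
  then show ?case using Suc by simp
qed simp

lemma plus_five_le: "r \<ge> 1 \<Longrightarrow> r + 5 \<le> (6::nat) ^ r"
  by (induction r rule: nat_induct_at_least) auto

text \<open>The estimate \<open>4 * r\<^sup>2 \<le> 6 ^ r\<close> takes care of
  \<open>2 * r - 1\<close> factors; the remaining one is at least \<open>r + 5\<close> and absorbs
  the factor \<open>r\<close> and the additive constant.\<close>

lemma chain_length_bound:
  assumes "r \<ge> 1" "t \<ge> 1"
  shows "r * (4 * r\<^sup>2 * t) ^ (2 * r - 1) + 3 \<le> (6 ^ r * t) ^ (2 * r)"
proof -
  define Q where "Q = (6 ^ r * t) ^ (2 * r - 1)"
  have Q1: "Q \<ge> 1" using assms by (simp add: Q_def)
  have "4 * r\<^sup>2 * t \<le> 6 ^ r * t" using four_square_le[OF assms(1)] by (rule mult_le_mono1)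
  then have "(4 * r\<^sup>2 * t) ^ (2 * r - 1) \<le> Q" unfolding Q_def by (rule power_mono) simp
  then have "r * (4 * r\<^sup>2 * t) ^ (2 * r - 1) + 3 \<le> r * Q + 5 * Q" using Q1 by (intro add_mono mult_le_mono2) auto
  also have "\<dots> = (r + 5) * Q" by (simp add: algebra_simps)
  also have "\<dots> \<le> (6 ^ r * t) * Q"
  proof (rule mult_le_mono1)
    have "(6::nat) ^ r * 1 \<le> 6 ^ r * t" using assms(2) by (rule mult_le_mono2)
    then show "r + 5 \<le> 6 ^ r * t" using plus_five_le[OF assms(1)] by linarith
  qed
  also have "\<dots> = (6 ^ r * t) ^ Suc (2 * r - 1)" by (simp add: Q_def)
  also have "Suc (2 * r - 1) = 2 * r" using assms by simp
  finally show ?thesis .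
qed

lemma log_root_bound:
  fixes n t r :: nat
  assumes "r \<ge> 1" "n \<ge> 1" "real t \<le> root (2 * r) (log 2 (real n)) / 6 ^ r"
  shows "2 ^ ((6 ^ r * t) ^ (2 * r)) \<le> n"
proof -
  define L where "L = log 2 (real n)"
  have L0: "L \<ge> 0" using assms(2) by (simp add: L_def)
  have "6 ^ r * real t \<le> root (2 * r) L" using assms(3) by (simp add: L_def field_simps)
  then have "(6 ^ r * real t) ^ (2 * r) \<le> root (2 * r) L ^ (2 * r)" by (intro power_mono) auto
  also have "\<dots> = L" using L0 assms(1) by (simp add: real_root_pow_pos2)
  finally have "real ((6 ^ r * t) ^ (2 * r)) \<le> L" by simp
  then have "2 powr real ((6 ^ r * t) ^ (2 * r)) \<le> 2 powr L" by simp
  also have "2 powr L = real n" using assms(2) by (simp add: L_def)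
  finally have "real (2 ^ ((6 ^ r * t) ^ (2 * r))) \<le> real n" by (subst (asm) powr_realpow) auto
  then show ?thesis by (simp only: of_nat_le_iff)
qed

lemma trivial_separators: "well_formed_separator_sequence G 0 0 A S B"
  unfolding well_formed_separator_sequence_def by auto

lemma (in leveled_disk) long_separator_sequence:
  fixes G :: "'a drawn_graph"
  assumes G: "vertices G = V" "edges G = E" "\<And>x m. x \<in> layer G m \<longleftrightarrow> x \<in> V \<and> lev x = m"
    and r: "r \<ge> 1"
  shows "\<exists>t p A S B. well_formed_separator_sequence G t p A S B \<and>
           int t \<ge> \<lfloor>root (2 * r) (log 2 (real (card V))) / 6 ^ r\<rfloor> \<and> p \<le> 2 * r"
proof -
  define y where "y = root (2 * r) (log 2 (real (card V))) / 6 ^ r"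
  define t where "t = nat \<lfloor>y\<rfloor>"
  have ty: "int t \<ge> \<lfloor>y\<rfloor>" by (simp add: t_def)
  have "\<exists>p A S B. well_formed_separator_sequence G t p A S B \<and> p \<le> 2 * r"
  proof (cases "t = 0")
    \<comment> \<open>The required length is 0 here, and the empty sequence qualifies.\<close>
    case True
    have "well_formed_separator_sequence G t 0 (\<lambda>_. {}) (\<lambda>_. {}) (\<lambda>_. {})"
      unfolding True by (rule trivial_separators)
    then show ?thesis by (meson le0)
  next
    case False
    then have t1: "t \<ge> 1" by simp
    have "0 < \<lfloor>y\<rfloor>" using False by (simp add: t_def)
    then have "real t = of_int \<lfloor>y\<rfloor>" by (simp add: t_def)
    then have rt: "real t \<le> y" by simp
    have "C \<noteq> []" using C_cycle(1) by auto
    then have "V \<noteq> {}" using C_cycle(3) by (metis hd_in_set empty_iff subsetD)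
    then have n1: "card V \<ge> 1" using finite_V by (simp add: Suc_le_eq card_gt_0_iff)
    define N where "N = r * (4 * r\<^sup>2 * t) ^ (2 * r - 1)"
    \<comment> \<open>Of the three extra factors 2, one is demanded by the chain of length
      \<open>N\<close>, and the other two outweigh the factor 3 between vertices and
      triangles.\<close>
    have "2 ^ (N + 3) \<le> (2::nat) ^ ((6 ^ r * t) ^ (2 * r))"
      using chain_length_bound[OF r t1] by (intro power_increasing) (auto simp: N_def)
    also have "\<dots> \<le> card V" using log_root_bound[OF r n1] rt by (simp add: y_def)
    also have "\<dots> \<le> 3 * card Tri" by (rule card_Tri_ge)
    finally have "4 * 2 ^ (N + 1) \<le> 3 * card Tri" by (simp add: power_add)
    then have "2 ^ (N + 1) \<le> card Tri + 1" by linarith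
    then show ?thesis using separators_exist[OF G t1 r] by (simp add: N_def)
  qed
  then show ?thesis using ty unfolding y_def by blast
qed

section \<open>The separator sequence\<close>

theorem theorem1:
  fixes G :: "'a drawn_graph" and r n :: nat
  assumes "r \<ge> 1"
    and "triangulated_disk G"
    and "at_most_layers G r"
    and "n = card (vertices G)"
  shows "\<exists>t p A S B.
           well_formed_separator_sequence G t p A S B \<and>
           int t \<ge> \<lfloor>root (2 * r) (log 2 (real n)) / 6 ^ r\<rfloor> \<and>
           p \<le> 2 * r"
proof -
  obtain C where "bounded_by_cycle G (outer_face G (vertices G)) C"
    using assms(2) by (auto simp: triangulated_disk_def)
  then interpret disk_drawing G C using assms(2) by unfold_locales
  note lf = lev_facts[OF assms(3)]
  interpret ld: leveled_disk V E Tri C lev r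
  proof unfold_locales
    show "finite V" by (rule finite_V)
    show "\<exists>u\<in>V. \<exists>v\<in>V. u \<noteq> v \<and> e = {u, v}" if "e \<in> E" for e using edgeE[OF that] by metis
    show "length C \<ge> 3" "distinct C" "set C \<subseteq> V" "cycle_edges C \<subseteq> E" using is_cycle_C by (auto simp: is_cycle_def)
    show "\<exists>a b c. t = {a, b, c} \<and> a \<noteq> b \<and> b \<noteq> c \<and> a \<noteq> c \<and> {a, b} \<in> E \<and> {b, c} \<in> E \<and> {a, c} \<in> E"
      if t: "t \<in> Tri" for t
    proof -
      obtain xs where xs: "length xs = 3" "is_cycle G xs" "set xs = t" using TriE[OF t] by metis
      obtain a b c where "xs = [a, b, c]" using xs(1) by (auto simp: numeral_3_eq_3 length_Suc_conv)
      then show ?thesis using xs(2,3)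
        by (intro exI[of _ a] exI[of _ b] exI[of _ c]) (auto simp: is_cycle_def cycle_edges_three insert_commute)
    qed
    show "card {t \<in> Tri. e \<subseteq> t} = 2" if "e \<in> E - cycle_edges C" for e using inner_edge_two that by blast
    show "card {t \<in> Tri. e \<subseteq> t} = 1" if "e \<in> cycle_edges C" for e using outer_edge_one[OF that] .
    show "\<exists>t\<in>Tri. v \<in> t" if "v \<in> V" for v using vertex_in_Tri[OF that] by blast
    show "X = {} \<or> X = Tri" if "X \<subseteq> Tri" "bd X = {}" for X by (rule bd_empty[OF that])
    show "\<exists>X\<subseteq>Tri. bd X = cycle_edges xs - cycle_edges C \<and>
          (\<forall>v\<in>V - set xs. \<forall>t\<in>Tri. \<forall>t'\<in>Tri. v \<in> t \<longrightarrow> v \<in> t' \<longrightarrow> t \<in> X \<longrightarrow> t' \<in> X) \<and>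
          (\<forall>e\<in>cycle_edges C. \<forall>t\<in>Tri. e \<subseteq> t \<longrightarrow> t \<in> X \<longleftrightarrow> e \<in> cycle_edges xs)"
      if "length xs \<ge> 3" "distinct xs" "set xs \<subseteq> V" "cycle_edges xs \<subseteq> E" for xs
      by (rule cycle_bounds) (use that in \<open>simp add: is_cycle_def\<close>)
    show "1 \<le> lev v \<and> lev v \<le> r" "lev v = 1 \<longleftrightarrow> v \<in> set C" if "v \<in> V" for v
      using lf(2)[OF that] lf(3)[OF that] by auto
    show "lev v \<le> Suc (lev u)" if "{u, v} \<in> E" for u v by (rule lf(4)[OF that])
    show "\<exists>u. {u, v} \<in> E \<and> Suc (lev u) = lev v" if "v \<in> V" "lev v \<ge> 2" for v by (rule lf(5)[OF that])
  qed
  have "x \<in> layer G m \<longleftrightarrow> x \<in> V \<and> lev x = m" for x m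
    using lf(1)[of x m] lev_eq[of x m] reach_sub_V by blast
  then show ?thesis using ld.long_separator_sequence[OF refl refl _ assms(1)] unfolding assms(4) by blast
qed

end
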